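(* Let $m,d$ be positive integers, let $n=\lceil 2md+1\rceil_p-1$, and let $F_1,F_2,\ldots,F_{d+1}$ be families of $n$ sets of points of $\mathbb{R}^d$ each. Consider the families $F_i=\{T_{i,j}:1\le j\le n\}$ as the color classes. Suppose that $\operatorname{conv}(T_{i,j})$ contains a ball of radius $1$ for all $i,j$. Then there is a choice of points $t_{i,j}\in T_{i,j}$ and a partition of the resulting set into $m$ parts $A_1,\ldots,A_m$ such that each $A_i$ contains at most $2d$ points of each color class and $\bigcap_{i=1}^m\operatorname{conv}(A_i)$ contains a ball of radius $(\pi/e^2)\,d^{-2d-2}$. In addition, if one takes instead $n'=n^{\mathrm{bms}}(d,\varepsilon)$ (with $\varepsilon>0$) and $$n=\lceil m\cdot((n'-1)d+1)+1\rceil_p-1,$$ and allows each $A_i$ to have $(n'-1)d+1$ points of each color, then in the conclusion one can guarantee that $\bigcap_{i=1}^m\operatorname{conv}(A_i)$ contains a ball of radius $(1+\varepsilon)^{-1}$.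
   Context: For an integer $q$, $\lceil q\rceil_p$ denotes the smallest prime which is greater than or equal to $q$. Balls are Euclidean balls in $\mathbb{R}^d$, and $\operatorname{conv}$ denotes the convex hull. The points of the $i$-th color class are the chosen points $t_{i,j}$, $1\le j\le n$. For a positive integer $d$ and $\varepsilon>0$, $n^{\mathrm{bms}}(d,\varepsilon)$ denotes the smallest integer such that, for any compact convex set $K\subset\mathbb{R}^d$ that is centrally symmetric about the origin, has positive volume and has $C^2$ boundary, there is a polytope $P$ of at most $n^{\mathrm{bms}}(d,\varepsilon)$ vertices and an invertible linear transformation $\lambda:\mathbb{R}^d\to\mathbb{R}^d$ such that $P\subset\lambda(K)\subset(1+\varepsilon)P$, where $(1+\varepsilon)P=\{(1+\varepsilon)x:x\in P\}$. A polytope is the convex hull of finitely many points.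
   Formalization: The parts A_i are disjoint sets of indexed chosen points, required to exhaust them only if n equals m times the per-color bound; otherwise a true partition is impossible (m=d=2: n=10, but two parts hold at most 8 points of a color). *)

theory Defs
  imports "HOL-Analysis.Analysis" "HOL-Computational_Algebra.Primes"
begin

definition next_prime :: "nat \<Rightarrow> nat" where
  "next_prime q = (LEAST p. prime p \<and> q \<le> p)"

definition contains_ball :: "real \<Rightarrow> (real ^ 'd) set \<Rightarrow> bool" where
  "contains_ball r S \<longleftrightarrow> (\<exists>c. cball c r \<subseteq> S)"

text \<open>The boundary is locally the zero set of a twice continuously differentiable function
  without critical points; \<open>G\<close> is the gradient of \<open>g\<close> and \<open>H\<close> the derivative of \<open>G\<close>.\<close>

definition C2_boundary :: "(real ^ 'd) set \<Rightarrow> bool" where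
  "C2_boundary K \<longleftrightarrow>
     (\<forall>x \<in> frontier K. \<exists>U (g :: real ^ 'd \<Rightarrow> real) (G :: real ^ 'd \<Rightarrow> real ^ 'd)
         (H :: real ^ 'd \<Rightarrow> (real ^ 'd) \<Rightarrow>\<^sub>L (real ^ 'd)).
        open U \<and> x \<in> U \<and>
        (\<forall>y\<in>U. (g has_derivative (\<lambda>h. G y \<bullet> h)) (at y)) \<and>
        (\<forall>y\<in>U. (G has_derivative blinfun_apply (H y)) (at y)) \<and>
        continuous_on U H \<and>
        (\<forall>y\<in>U. G y \<noteq> 0) \<and>
        frontier K \<inter> U = {y \<in> U. g y = 0})"

definition symmetric_C2_body :: "(real ^ 'd) set \<Rightarrow> bool" where
  "symmetric_C2_body K \<longleftrightarrow>
     compact K \<and> convex K \<and> (\<forall>x\<in>K. - x \<in> K) \<and> measure lebesgue K > 0 \<and> C2_boundary K"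

text \<open>The type argument carries the dimension \<open>d = CARD('d)\<close>. A polytope has finitely many
  extreme points, so the cardinality below is the honest number of its vertices.\<close>

definition n_bms :: "'d::finite itself \<Rightarrow> real \<Rightarrow> nat" where
  "n_bms (_ :: 'd itself) \<epsilon> =
     (LEAST N. \<forall>K :: (real ^ 'd) set. symmetric_C2_body K \<longrightarrow>
        (\<exists>P (l :: real ^ 'd \<Rightarrow> real ^ 'd).
           polytope P \<and> card {v. v extreme_point_of P} \<le> N \<and> linear l \<and> bij l \<and>
           P \<subseteq> l ` K \<and> l ` K \<subseteq> (\<lambda>x. (1 + \<epsilon>) *\<^sub>R x) ` P))"

text \<open>Points are chosen from the sets \<open>T i j\<close> (colour \<open>i\<close>, index \<open>j\<close>) and distributed
  over \<open>m\<close> parts, each with at most \<open>s\<close> points of each colour, such that the convex hulls of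
  the parts have a ball of radius \<open>r\<close> in common.

  The chosen points form an indexed family, since points with different indices may coincide
  (and must, if all the \<open>T i j\<close> are the vertex set of one simplex and \<open>n > d + 1\<close>); so a part
  is a set of index pairs.

  The \<open>m\<close> parts hold at most \<open>m * s\<close> points of a colour. If \<open>n > m * s\<close> they therefore cannot
  exhaust the \<open>n\<close> points of a colour class, and they are only required to be pairwise disjoint.
  If \<open>n = m * s\<close> they are required to form a partition of all the chosen points.\<close>

definition tverberg_choice ::
  "nat \<Rightarrow> nat \<Rightarrow> nat \<Rightarrow> real \<Rightarrow> (nat \<Rightarrow> nat \<Rightarrow> (real ^ 'd) set) \<Rightarrow> bool" where
  "tverberg_choice m n s r T \<longleftrightarrow>
     (\<exists>(t :: nat \<Rightarrow> nat \<Rightarrow> real ^ 'd) (A :: nat \<Rightarrow> (nat \<times> nat) set).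
        (\<forall>i\<in>{1..CARD('d) + 1}. \<forall>j\<in>{1..n}. t i j \<in> T i j) \<and>
        (\<forall>k\<in>{1..m}. A k \<subseteq> {1..CARD('d) + 1} \<times> {1..n}) \<and>
        disjoint_family_on A {1..m} \<and>
        (n = m * s \<longrightarrow> (\<Union>k\<in>{1..m}. A k) = {1..CARD('d) + 1} \<times> {1..n}) \<and>
        (\<forall>k\<in>{1..m}. \<forall>i\<in>{1..CARD('d) + 1}. card {j. (i, j) \<in> A k} \<le> s) \<and>
        contains_ball r (\<Inter>k\<in>{1..m}. convex hull ((\<lambda>(i, j). t i j) ` A k)))"

end

theory Submission
  imports Defs "Jordan_Normal_Form.Determinant"
begin

text \<open>
  Let \<open>c i j\<close> be the centre of a unit ball in the hull of \<open>T i j\<close>. By the optimal coloured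
  Tverberg theorem of Blagojevic, Matschke and Ziegler (\<open>optimal_coloured_tverberg\<close>, which needs
  \<open>n + 1\<close> to be a prime) the centres can be split into \<open>n\<close> rainbow sets, with one centre of each
  colour, whose hulls have a point \<open>x\<close> in common. If \<open>x\<close> is the combination of the centres of a
  rainbow set with coefficients \<open>\<alpha> i\<close>, then the combinations \<open>\<Sum>i. \<alpha> i *\<^sub>R t i\<close> with \<open>t i\<close> in the
  corresponding sets form a set whose hull contains the unit ball about \<open>x\<close>. A part is made of
  \<open>s\<close> rainbow sets, hence uses at most \<open>s\<close> points of each colour. From the \<open>s\<close> sets of
  combinations a colourful Steinitz theorem selects one point each such that the hull of the
  selected points still contains a ball about \<open>x\<close>, and a selected point is a convex combination of
  points \<open>t i\<close> of the part (\<open>tverberg_choice_of_colourful_selection\<close>).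

  The two claims differ in the Steinitz theorem. If a polytope inside the unit ball has \<open>N\<close>
  vertices, then \<open>(N - 1) d + 1\<close> sets suffice to cover a rotated copy of it
  (\<open>colourful_polytope\<close>): one point lies beyond the first vertex, and \<open>d\<close> points capture each
  further vertex by the colourful Caratheodory theorem. A ball inside the polytope is covered, too. With \<open>2 d\<close> sets
  (\<open>colourful_steinitz\<close>), \<open>d\<close> of them are first thinned out to \<open>d^2 + 1\<close> points each, so that few
  hyperplanes through the origin are spanned by their points. A point \<open>q\<close> far from all these
  hyperplanes is deep inside the simplex of \<open>d\<close> points that captures it, and the other \<open>d\<close> sets
  capture \<open>- q\<close>.

  The coloured Tverberg theorem is proved by a degree argument in which everything is a
  determinant. By Sarkaria's tensor trick it says that the origin lies in the hull of some simplex of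
  a map from a join of chessboard complexes, joined with one more point, to a space on which
  the cyclic group of order \<open>p = n + 1\<close> acts. The join is a pseudomanifold, so the signed number of
  its simplices that meet a generic ray does not depend on the ray. If a vertex is moved, this number
  changes by a multiple of \<open>p\<close>, because the simplices that sweep over the origin come in orbits of the
  cyclic group. For one special map the number is \<open>\<plusminus> (n!)^(d + 1)\<close>, which is prime to \<open>p\<close>. Hence for
  points in general position it does not vanish, and the ray opposite to the additional point is
  hit (\<open>generic_cone_hit\<close>); the general case follows by a limit (\<open>chessboard_zero\<close>).

  For the second claim it also matters that \<open>n_bms\<close> is attained, that is, that the number of vertices
  needed is bounded over all symmetric bodies; a volume count gives this (\<open>bms_bound_exists\<close>).
\<close>

no_notation vec_index (infixl "$" 100)
no_notation Matrix.scalar_prod (infix "\<bullet>" 70)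
hide_const (open) Matrix.mat Matrix.vec Matrix.transpose_mat

section \<open>Determinants and open simplicial cones\<close>

text \<open>The dimension in which the degree argument takes place depends on \<open>n\<close>. Its vectors are therefore
  functions of which only the values below \<open>M\<close> matter, and \<open>G c\<close> is column \<open>c\<close> of the matrix.\<close>
definition cdet :: "nat \<Rightarrow> (nat \<Rightarrow> nat \<Rightarrow> real) \<Rightarrow> real" where
  "cdet M G = Determinant.det (Matrix.mat M M (\<lambda>(r, c). G c r))"

lemma cdet_cong:
  assumes "\<And>c r. c < M \<Longrightarrow> r < M \<Longrightarrow> G c r = H c r"
  shows "cdet M G = cdet M H"
proof -
  have "Matrix.mat M M (\<lambda>(r, c). G c r) = Matrix.mat M M (\<lambda>(r, c). H c r)"
    by (rule eq_matI) (auto simp: assms)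
  then show ?thesis by (simp add: cdet_def)
qed

lemma cdet_cramer:
  assumes w: "\<And>r. r < M \<Longrightarrow> w r = (\<Sum>c<M. \<omega> c * G c r)" and k: "k < M"
  shows "cdet M (G(k := w)) = \<omega> k * cdet M G"
proof -
  let ?A = "Matrix.mat M M (\<lambda>(r, c). G c r)" and ?x = "Matrix.vec M \<omega>"
  have "replace_col ?A (?A *\<^sub>v ?x) k = Matrix.mat M M (\<lambda>(r, c). (G(k := w)) c r)"
    by (rule eq_matI)
       (auto simp: replace_col_def scalar_prod_def w atLeast0LessThan intro!: sum.cong)
  moreover have "Determinant.det (replace_col ?A (?A *\<^sub>v ?x) k) = vec_index ?x k * Determinant.det ?A"
    by (rule cramer_lemma_mat) (auto simp: k)
  ultimately show ?thesis
    using k by (simp add: cdet_def)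
qed

lemma cdet_eq_0_iff:
  "cdet M G = 0 \<longleftrightarrow> (\<exists>l. (\<exists>c<M. l c \<noteq> 0) \<and> (\<forall>r<M. (\<Sum>c<M. l c * G c r) = 0))"
proof -
  let ?A = "Matrix.mat M M (\<lambda>(r, c). G c r)"
  have eq: "cdet M G = 0 \<longleftrightarrow> (\<exists>v. v \<in> carrier_vec M \<and> v \<noteq> 0\<^sub>v M \<and> ?A *\<^sub>v v = 0\<^sub>v M)"
    unfolding cdet_def by (rule det_0_iff_vec_prod_zero) auto
  show ?thesis
  proof
    assume "cdet M G = 0"
    then obtain v where v: "v \<in> carrier_vec M" "v \<noteq> 0\<^sub>v M" "?A *\<^sub>v v = 0\<^sub>v M"
      using eq by blast
    have "\<exists>c<M. vec_index v c \<noteq> 0"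
    proof (rule ccontr)
      assume "\<not> ?thesis"
      then have "v = 0\<^sub>v M" using v(1) by (intro eq_vecI) auto
      with v(2) show False by simp
    qed
    moreover have "(\<Sum>c<M. vec_index v c * G c r) = 0" if "r < M" for r
    proof -
      have "vec_index (?A *\<^sub>v v) r = (\<Sum>c<M. vec_index v c * G c r)"
        using that v(1) by (auto simp: scalar_prod_def atLeast0LessThan intro!: sum.cong)
      then show ?thesis using v(3) that by simp
    qed
    ultimately show "\<exists>l. (\<exists>c<M. l c \<noteq> 0) \<and> (\<forall>r<M. (\<Sum>c<M. l c * G c r) = 0)"
      by (intro exI[of _ "vec_index v"]) auto
  next
    assume "\<exists>l. (\<exists>c<M. l c \<noteq> 0) \<and> (\<forall>r<M. (\<Sum>c<M. l c * G c r) = 0)"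
    then obtain l c0 where c0: "c0 < M" "l c0 \<noteq> 0" and l: "\<forall>r<M. (\<Sum>c<M. l c * G c r) = 0"
      by blast
    have "Matrix.vec M l \<noteq> 0\<^sub>v M"
      using c0 by (metis index_vec index_zero_vec(1))
    moreover have "?A *\<^sub>v Matrix.vec M l = 0\<^sub>v M"
    proof (rule eq_vecI)
      fix r assume "r < dim_vec (0\<^sub>v M :: real Matrix.vec)"
      then have r: "r < M" by simp
      have "vec_index (?A *\<^sub>v Matrix.vec M l) r = (\<Sum>c<M. l c * G c r)"
        using r by (auto simp: scalar_prod_def atLeast0LessThan intro!: sum.cong)
      then show "vec_index (?A *\<^sub>v Matrix.vec M l) r = vec_index (0\<^sub>v M) r"
        using l r by simp
    qed auto
    ultimately show "cdet M G = 0" using eq by (metis vec_carrier)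
  qed
qed

lemma cdet_transpose: "cdet M (\<lambda>c r. G r c) = cdet M G"
proof -
  have "Matrix.transpose_mat (Matrix.mat M M (\<lambda>(r, c). G c r)) = Matrix.mat M M (\<lambda>(r, c). G r c)"
    by (rule eq_matI) auto
  then show ?thesis
    unfolding cdet_def by (metis det_transpose mat_carrier)
qed

lemma cdet_mult: "cdet M (\<lambda>c r. \<Sum>l<M. S l r * G c l) = cdet M S * cdet M G"
proof -
  have "Matrix.mat M M (\<lambda>(r, c). \<Sum>l<M. S l r * G c l) =
      Matrix.mat M M (\<lambda>(r, c). S c r) * Matrix.mat M M (\<lambda>(r, c). G c r)"
    by (rule eq_matI) (auto simp: scalar_prod_def atLeast0LessThan intro!: sum.cong)
  then show ?thesis
    unfolding cdet_def by (simp add: Determinant.det_mult[of _ M])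
qed

lemma cdet_solve:
  assumes "cdet M G \<noteq> 0"
  obtains \<omega> where "\<And>r. r < M \<Longrightarrow> w r = (\<Sum>c<M. \<omega> c * G c r)"
proof -
  let ?A = "Matrix.mat M M (\<lambda>(r, c). G c r)"
  define v where "v = adj_mat ?A *\<^sub>v Matrix.vec M w"
  have A: "?A \<in> carrier_mat M M" by simp
  have v: "v \<in> carrier_vec M"
    unfolding v_def using adj_mat(1)[OF A] by (rule mult_mat_vec_carrier) simp
  have "?A *\<^sub>v v = (?A * adj_mat ?A) *\<^sub>v Matrix.vec M w"
    unfolding v_def by (rule assoc_mult_mat_vec[OF A adj_mat(1)[OF A], symmetric]) simp
  also have "\<dots> = (Determinant.det ?A \<cdot>\<^sub>m 1\<^sub>m M) *\<^sub>v Matrix.vec M w"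
    by (simp only: adj_mat(2)[OF A])
  also have "\<dots> = cdet M G \<cdot>\<^sub>v Matrix.vec M w"
    by (auto simp: cdet_def)
  finally have eq: "?A *\<^sub>v v = cdet M G \<cdot>\<^sub>v Matrix.vec M w" .
  have "w r = (\<Sum>c<M. (vec_index v c / cdet M G) * G c r)" if "r < M" for r
  proof -
    have "cdet M G * w r = vec_index (?A *\<^sub>v v) r" unfolding eq using that by simp
    also have "\<dots> = (\<Sum>c<M. G c r * vec_index v c)"
      using that v by (auto simp: scalar_prod_def atLeast0LessThan intro!: sum.cong)
    finally have "w r = (\<Sum>c<M. G c r * vec_index v c) / cdet M G"
      using assms by (simp add: field_simps)
    then show ?thesis by (simp add: sum_divide_distrib mult.commute)
  qed
  then show thesis by (rule that)
qed

lemma cdet_swap: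
  assumes "k < M" "l < M" "k \<noteq> l"
  shows "cdet M (G(k := G l, l := G k)) = - cdet M G"
proof -
  let ?A = "Matrix.mat M M (\<lambda>(r, c). G c r)"
  have "swapcols k l ?A = Matrix.mat M M (\<lambda>(r, c). (G(k := G l, l := G k)) c r)"
    using assms by (intro eq_matI) (auto simp: mat_swapcols_def)
  then show ?thesis
    using det_swapcols[OF assms, of ?A] by (simp add: cdet_def)
qed

lemma cdet_leibniz:
  "cdet M G = (\<Sum>p | p permutes {0..<M}. of_int (sign p) * (\<Prod>r<M. G (p r) r))"
proof -
  have "cdet M G = (\<Sum>p | p permutes {0..<M}. signof p * (\<Prod>r = 0..<M. Matrix.mat M M (\<lambda>(r, c). G c r) $$ (r, p r)))"
    unfolding cdet_def by (rule det_def') auto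
  also have "\<dots> = (\<Sum>p | p permutes {0..<M}. of_int (sign p) * (\<Prod>r<M. G (p r) r))"
  proof (rule sum.cong[OF refl])
    fix p assume "p \<in> {p. p permutes {0..<M}}"
    then have p: "p permutes {0..<M}" by simp
    have "(\<Prod>r = 0..<M. Matrix.mat M M (\<lambda>(r, c). G c r) $$ (r, p r)) = (\<Prod>r<M. G (p r) r)"
      using permutes_in_image[OF p] by (auto simp: atLeast0LessThan intro!: prod.cong)
    then show "signof p * (\<Prod>r = 0..<M. Matrix.mat M M (\<lambda>(r, c). G c r) $$ (r, p r)) = of_int (sign p) * (\<Prod>r<M. G (p r) r)"
      by simp
  qed
  finally show ?thesis .
qed

lemma tendsto_cdet:
  assumes "\<And>c r. c < M \<Longrightarrow> r < M \<Longrightarrow> ((\<lambda>t. G t c r) \<longlongrightarrow> H c r) F"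
  shows "((\<lambda>t. cdet M (G t)) \<longlongrightarrow> cdet M H) F"
  unfolding cdet_leibniz
proof (intro tendsto_sum tendsto_mult tendsto_const tendsto_prod)
  fix p r assume "p \<in> {p. p permutes {0..<M}}" "r \<in> {..<M}"
  then show "((\<lambda>t. G t (p r) r) \<longlongrightarrow> H (p r) r) F"
    using assms permutes_in_image[of p "{0..<M}" r] by simp
qed

text \<open>Along a segment a determinant is a polynomial in the parameter. It does not vanish at the end point
  \<open>t = 1\<close>, so it has finitely many zeros.\<close>
lemma cdet_segment_eventually_nonzero:
  assumes "cdet M Z \<noteq> 0"
  shows "eventually (\<lambda>t. cdet M (\<lambda>c r. (1 - t) * Y c r + t * Z c r) \<noteq> 0) (at_right 0)"
proof -
  define P where "P = (\<Sum>p | p permutes {0..<M}. Polynomial.smult (of_int (sign p))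
      (\<Prod>r<M. [:Y (p r) r, Z (p r) r - Y (p r) r:]))"
  have P: "poly P t = cdet M (\<lambda>c r. (1 - t) * Y c r + t * Z c r)" for t
    by (auto simp: P_def cdet_leibniz poly_sum poly_prod algebra_simps intro!: sum.cong prod.cong)
  have "poly P 1 \<noteq> 0" using assms by (simp add: P)
  then have "P \<noteq> 0" by auto
  then have fin: "finite {t. poly P t = 0}" by (rule poly_roots_finite)
  then have "open (- ({t. poly P t = 0} - {0}))"
    by (intro open_Compl finite_imp_closed) simp
  then have "eventually (\<lambda>t. t \<in> - ({t. poly P t = 0} - {0})) (nhds 0)"
    by (rule eventually_nhds_in_open) simp
  then show ?thesis
    unfolding at_within_def eventually_inf_principal
    by (auto simp: P elim: eventually_mono)
qed

text \<open>The contribution of one simplex to a degree: its orientation, if the ray through \<open>w\<close> meets its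
  interior.\<close>
definition cone_sign :: "nat \<Rightarrow> (nat \<Rightarrow> nat \<Rightarrow> real) \<Rightarrow> (nat \<Rightarrow> real) \<Rightarrow> int" where
  "cone_sign M G w =
     (if \<exists>\<omega>. (\<forall>c<M. \<omega> c > 0) \<and> (\<forall>r<M. w r = (\<Sum>c<M. \<omega> c * G c r))
      then (if cdet M G > 0 then 1 else if cdet M G < 0 then -1 else 0) else 0)"

lemma coefficients_unique:
  assumes "cdet M G \<noteq> 0" "\<And>r. r < M \<Longrightarrow> (\<Sum>c<M. a c * G c r) = (\<Sum>c<M. b c * G c r)" "c < M"
  shows "a c = b c"
proof -
  have "a c * cdet M G = cdet M (G(c := \<lambda>r. \<Sum>c<M. a c * G c r))"
    using assms(3) by (intro cdet_cramer[symmetric]) auto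
  also have "\<dots> = b c * cdet M G"
    using assms(2,3) by (intro cdet_cramer) auto
  finally show ?thesis using assms(1) by simp
qed

lemma cone_sign_eq:
  assumes "cdet M G \<noteq> 0" "\<And>r. r < M \<Longrightarrow> w r = (\<Sum>c<M. \<omega> c * G c r)"
  shows "cone_sign M G w = (if \<forall>c<M. \<omega> c > 0 then (if cdet M G > 0 then 1 else -1) else 0)"
proof -
  have "(\<exists>a. (\<forall>c<M. a c > 0) \<and> (\<forall>r<M. w r = (\<Sum>c<M. a c * G c r))) \<longleftrightarrow> (\<forall>c<M. \<omega> c > 0)"
  proof
    assume "\<exists>a. (\<forall>c<M. a c > 0) \<and> (\<forall>r<M. w r = (\<Sum>c<M. a c * G c r))"
    then obtain a where "\<forall>c<M. a c > 0" "\<forall>r<M. w r = (\<Sum>c<M. a c * G c r)" by blast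
    with coefficients_unique[OF assms(1), of a \<omega>] assms(2) show "\<forall>c<M. \<omega> c > 0" by simp
  qed (use assms(2) in blast)
  with assms(1) show ?thesis by (auto simp: cone_sign_def)
qed

lemma cone_sign_cong:
  assumes "\<And>c r. c < M \<Longrightarrow> r < M \<Longrightarrow> G c r = H c r" "\<And>r. r < M \<Longrightarrow> v r = w r"
  shows "cone_sign M G v = cone_sign M H w"
  using assms cdet_cong[OF assms(1)] by (simp add: cone_sign_def cong: conj_cong)

text \<open>The parameters at which a half-line crosses the boundary hyperplanes of a convex polyhedral
  region. It can leave the region only through a hyperplane in \<open>P\<close> and enter it only through one in
  \<open>N\<close>, and \<open>feas i\<close> says that the crossing with number \<open>i\<close> is on the half-line and on the boundary of the
  region. The starting point minus the exits plus the entries yields whether the half-line ends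
  inside.\<close>
lemma ray_crossings:
  fixes t :: "'a \<Rightarrow> real"
  assumes fin: "finite P" "finite N" and disj: "P \<inter> N = {}"
    and inj: "inj_on t (P \<union> N)" and nz: "\<And>i. i \<in> P \<union> N \<Longrightarrow> t i \<noteq> 0"
  defines "feas \<equiv> \<lambda>i. t i > 0 \<and> (\<forall>j\<in>P - {i}. t i < t j) \<and> (\<forall>j\<in>N - {i}. t j < t i)"
  shows "of_bool ((\<forall>j\<in>P. t j > 0) \<and> (\<forall>j\<in>N. t j < 0)) - (\<Sum>i\<in>P. of_bool (feas i)) + (\<Sum>i\<in>N. of_bool (feas i))
     = (of_bool (P = {}) :: int)"
proof -
  have P: "(\<Sum>i\<in>P. of_bool (feas i)) = (of_bool (feas a) :: int)"
    if a: "a \<in> P" "\<And>j. j \<in> P \<Longrightarrow> t a \<le> t j" for a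
  proof -
    have "feas i \<Longrightarrow> i = a" if "i \<in> P" for i
      using a that unfolding feas_def by (metis DiffI not_le singletonD)
    then have "(\<Sum>i\<in>P. of_bool (feas i)) = (\<Sum>i\<in>P. if i = a then of_bool (feas a) else (0::int))"
      by (intro sum.cong) auto
    then show ?thesis using fin a(1) by simp
  qed
  have N: "(\<Sum>i\<in>N. of_bool (feas i)) = (of_bool (feas b) :: int)"
    if b: "b \<in> N" "\<And>j. j \<in> N \<Longrightarrow> t j \<le> t b" for b
  proof -
    have "feas i \<Longrightarrow> i = b" if "i \<in> N" for i
      using b that unfolding feas_def by (metis DiffI not_le singletonD)
    then have "(\<Sum>i\<in>N. of_bool (feas i)) = (\<Sum>i\<in>N. if i = b then of_bool (feas b) else (0::int))"
      by (intro sum.cong) auto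
    then show ?thesis using fin b(1) by simp
  qed
  have exP: "\<exists>a\<in>P. \<forall>j\<in>P. t a \<le> t j" if "P \<noteq> {}"
    using fin(1) that by (metis arg_min_if_finite(1) arg_min_least)
  have exN: "\<exists>b\<in>N. \<forall>j\<in>N. t j \<le> t b" if "N \<noteq> {}"
  proof -
    have "Max (t ` N) \<in> t ` N" using fin(2) that by simp
    then obtain b where "b \<in> N" "t b = Max (t ` N)" by auto
    then show ?thesis using fin(2) by (intro bexI[of _ b]) auto
  qed
  have strictP: "t a < t j" if "a \<in> P" "\<forall>j\<in>P. t a \<le> t j" "j \<in> P - {a}" for a j
    using that inj by (metis DiffD1 DiffD2 UnI1 inj_onD order_less_le singletonI)
  have strictN: "t j < t b" if "b \<in> N" "\<forall>j\<in>N. t j \<le> t b" "j \<in> N - {b}" for b j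
    using that inj by (metis DiffD1 DiffD2 UnI2 inj_onD order_less_le singletonI)
  show ?thesis
  proof (cases "P = {}")
    case PE: True
    show ?thesis
    proof (cases "N = {}")
      case True with PE show ?thesis by simp
    next
      case False
      then obtain b where b: "b \<in> N" "\<forall>j\<in>N. t j \<le> t b" using exN by blast
      have "feas b \<longleftrightarrow> t b > 0" using PE strictN[OF b] by (auto simp: feas_def)
      moreover have "(\<forall>j\<in>N. t j < 0) \<longleftrightarrow> t b < 0" using b by force
      moreover have "t b \<noteq> 0" using nz b by blast
      ultimately show ?thesis using PE N[of b] b by auto
    qed
  next
    case PN: False
    then obtain a where a: "a \<in> P" "\<forall>j\<in>P. t a \<le> t j" using exP by blast
    have a0: "t a \<noteq> 0" using nz a by blast
    have aP: "(\<forall>j\<in>P. t j > 0) \<longleftrightarrow> t a > 0" using a by force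
    show ?thesis
    proof (cases "N = {}")
      case True
      have "feas a \<longleftrightarrow> t a > 0" using True strictP[OF a] by (auto simp: feas_def)
      then show ?thesis using True P[of a] a aP PN by auto
    next
      case False
      then obtain b where b: "b \<in> N" "\<forall>j\<in>N. t j \<le> t b" using exN by blast
      have b0: "t b \<noteq> 0" using nz b by blast
      have bN: "(\<forall>j\<in>N. t j < 0) \<longleftrightarrow> t b < 0" using b by force
      have ab: "t a \<noteq> t b" using inj a b disj by (metis IntI UnI1 UnI2 empty_iff inj_onD)
      have diff: "N - {a} = N" "P - {b} = P" using a b disj by auto
      have "(\<forall>j\<in>N. t j < t a) \<longleftrightarrow> t b < t a" using b by (meson le_less_trans)
      moreover have "(\<forall>j\<in>P - {a}. t a < t j)" using strictP[OF a] by blast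
      ultimately have fa: "feas a \<longleftrightarrow> t a > 0 \<and> t b < t a" unfolding feas_def diff by blast
      have "(\<forall>j\<in>P. t b < t j) \<longleftrightarrow> t b < t a" using a by (meson less_le_trans)
      moreover have "(\<forall>j\<in>N - {b}. t j < t b)" using strictN[OF b] by blast
      ultimately have fb: "feas b \<longleftrightarrow> t b > 0 \<and> t b < t a" unfolding feas_def diff by blast
      have eqs: "(\<Sum>i\<in>P. of_bool (feas i)) = (of_bool (feas a) :: int)"
          "(\<Sum>i\<in>N. of_bool (feas i)) = (of_bool (feas b) :: int)"
        using P[of a] N[of b] a b by blast+
      show ?thesis unfolding eqs fa fb aP bN using a0 b0 ab PN by auto
    qed
  qed
qed

text \<open>Follow \<open>w - t v\<close> for growing \<open>t \<ge> 0\<close>. This point lies on the face of the cone opposite to \<open>G i\<close> if and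
  only if \<open>w\<close> is in the cone of \<open>G(i := v)\<close> with coefficient \<open>t\<close> at \<open>v\<close>, and in the long run it is in the
  cone if and only if \<open>- v\<close> is. By Cramer's rule the sign of \<open>cdet M (G(i := v))\<close> tells exits from
  entries.\<close>
lemma cone_sign_exchange:
  assumes G: "cdet M G \<noteq> 0"
    and Gv: "\<And>i. i < M \<Longrightarrow> cdet M (G(i := v)) \<noteq> 0"
    and Gw: "\<And>i. i < M \<Longrightarrow> cdet M (G(i := w)) \<noteq> 0"
    and Gvw: "\<And>i j. i < M \<Longrightarrow> j < M \<Longrightarrow> i \<noteq> j \<Longrightarrow> cdet M (G(i := v, j := w)) \<noteq> 0"
  shows "cone_sign M G w - (\<Sum>i<M. cone_sign M (G(i := v)) w) = cone_sign M G (\<lambda>r. - v r)"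
proof -
  obtain \<beta> where \<beta>: "\<And>r. r < M \<Longrightarrow> v r = (\<Sum>c<M. \<beta> c * G c r)"
    using cdet_solve[OF G] by blast
  obtain \<omega> where \<omega>: "\<And>r. r < M \<Longrightarrow> w r = (\<Sum>c<M. \<omega> c * G c r)"
    using cdet_solve[OF G] by blast
  have detv: "cdet M (G(i := v)) = \<beta> i * cdet M G" if "i < M" for i
    by (rule cdet_cramer[OF \<beta> that])
  have detw: "cdet M (G(i := w)) = \<omega> i * cdet M G" if "i < M" for i
    by (rule cdet_cramer[OF \<omega> that])
  have \<beta>0: "\<beta> i \<noteq> 0" if "i < M" for i using detv Gv that by auto
  have \<omega>0: "\<omega> i \<noteq> 0" if "i < M" for i using detw Gw that by auto
  define t where "t i = \<omega> i / \<beta> i" for i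
  define \<gamma> where "\<gamma> i j = (if j = i then t i else \<omega> j - \<beta> j * t i)" for i j
  have wi: "w r = (\<Sum>c<M. \<gamma> i c * (G(i := v)) c r)" if "i < M" "r < M" for i r
  proof -
    have "(\<Sum>c<M. \<gamma> i c * (G(i := v)) c r) =
        t i * v r + (\<Sum>c\<in>{..<M} - {i}. (\<omega> c - \<beta> c * t i) * G c r)"
      using that by (subst sum.remove[of _ i]) (auto simp: \<gamma>_def intro!: sum.cong)
    also have "(\<Sum>c\<in>{..<M} - {i}. (\<omega> c - \<beta> c * t i) * G c r) = (\<Sum>c<M. (\<omega> c - \<beta> c * t i) * G c r)"
      using that \<beta>0 by (subst (2) sum.remove[of _ i]) (auto simp: t_def)
    also have "\<dots> = w r - t i * v r"
      using \<beta>[OF that(2)] \<omega>[OF that(2)]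
      by (simp add: algebra_simps sum_subtractf sum_distrib_left)
    finally show ?thesis by simp
  qed
  have \<gamma>0: "\<gamma> i j \<noteq> 0" if "i < M" "j < M" "i \<noteq> j" for i j
  proof -
    have "cdet M ((G(i := v))(j := w)) = \<gamma> i j * cdet M (G(i := v))"
      using wi[OF that(1)] that(2) by (rule cdet_cramer)
    with Gvw[OF that] show ?thesis by auto
  qed
  have tne: "t i \<noteq> t j" if "i < M" "j < M" "i \<noteq> j" for i j
  proof
    assume "t i = t j"
    then have "\<beta> j * t i = \<omega> j" using \<beta>0[OF that(2)] by (simp add: t_def[of j])
    with \<gamma>0[OF that] that(3) show False by (simp add: \<gamma>_def)
  qed
  define P where "P = {i. i < M \<and> \<beta> i > 0}"
  define N where "N = {i. i < M \<and> \<beta> i < 0}"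
  have PN: "P \<union> N = {..<M}" using \<beta>0 by (auto simp: P_def N_def not_less_iff_gr_or_eq)
  define feas where "feas i \<longleftrightarrow> t i > 0 \<and> (\<forall>j\<in>P - {i}. t i < t j) \<and> (\<forall>j\<in>N - {i}. t j < t i)" for i
  have ray: "of_bool ((\<forall>j\<in>P. t j > 0) \<and> (\<forall>j\<in>N. t j < 0)) - (\<Sum>i\<in>P. of_bool (feas i)) + (\<Sum>i\<in>N. of_bool (feas i))
     = (of_bool (P = {}) :: int)"
    unfolding feas_def
  proof (rule ray_crossings)
    show "inj_on t (P \<union> N)" using tne unfolding PN by (auto intro!: inj_onI)
    show "t i \<noteq> 0" if "i \<in> P \<union> N" for i using that \<omega>0 \<beta>0 unfolding PN by (auto simp: t_def)
  qed (auto simp: P_def N_def)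
  define e :: int where "e = (if cdet M G > 0 then 1 else -1)"
  have 1: "cone_sign M G w = e * of_bool ((\<forall>j\<in>P. t j > 0) \<and> (\<forall>j\<in>N. t j < 0))"
  proof -
    have "(\<forall>c<M. \<omega> c > 0) \<longleftrightarrow> (\<forall>j\<in>P \<union> N. \<omega> j > 0)" unfolding PN by auto
    also have "\<dots> \<longleftrightarrow> (\<forall>j\<in>P. t j > 0) \<and> (\<forall>j\<in>N. t j < 0)"
      by (auto simp: t_def P_def N_def zero_less_divide_iff divide_less_0_iff)
    finally show ?thesis using cone_sign_eq[OF G \<omega>] by (simp add: e_def)
  qed
  have 2: "cone_sign M G (\<lambda>r. - v r) = e * of_bool (P = {})"
  proof -
    have "- v r = (\<Sum>c<M. - \<beta> c * G c r)" if "r < M" for r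
      using \<beta>[OF that] by (simp add: sum_negf)
    moreover have "(\<forall>c<M. - \<beta> c > 0) \<longleftrightarrow> P = {}"
    proof -
      have "- \<beta> c > 0 \<longleftrightarrow> \<not> \<beta> c > 0" if "c < M" for c using \<beta>0[OF that] by linarith
      then show ?thesis by (auto simp: P_def)
    qed
    ultimately show ?thesis using cone_sign_eq[OF G, of "\<lambda>r. - v r" "\<lambda>c. - \<beta> c"] by (simp add: e_def)
  qed
  have 3: "cone_sign M (G(i := v)) w = (if i \<in> P then e else - e) * of_bool (feas i)" if "i < M" for i
  proof -
    have "(\<forall>c<M. \<gamma> i c > 0) \<longleftrightarrow> (t i > 0 \<and> (\<forall>j\<in>(P \<union> N) - {i}. \<omega> j - \<beta> j * t i > 0))"
      using that unfolding PN \<gamma>_def by auto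
    also have "\<dots> \<longleftrightarrow> feas i"
      by (auto simp: feas_def P_def N_def t_def[of j for j] field_simps)
    finally have feas: "(\<forall>c<M. \<gamma> i c > 0) \<longleftrightarrow> feas i" .
    have "cone_sign M (G(i := v)) w =
        (if \<forall>c<M. \<gamma> i c > 0 then (if cdet M (G(i := v)) > 0 then 1 else -1) else 0)"
      using Gv[OF that] wi[OF that] by (rule cone_sign_eq)
    then show ?thesis
      unfolding feas detv[OF that] using that \<beta>0[OF that] G
      by (auto simp: e_def P_def zero_less_mult_iff mult_less_0_iff)
  qed
  have "(\<Sum>i<M. cone_sign M (G(i := v)) w) =
      (\<Sum>i\<in>P. cone_sign M (G(i := v)) w) + (\<Sum>i\<in>N. cone_sign M (G(i := v)) w)"
    unfolding PN[symmetric] by (rule sum.union_disjoint) (auto simp: P_def N_def)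
  also have "\<dots> = e * ((\<Sum>i\<in>P. of_bool (feas i)) - (\<Sum>i\<in>N. of_bool (feas i)))"
  proof -
    have "(\<Sum>i\<in>P. cone_sign M (G(i := v)) w) = (\<Sum>i\<in>P. e * of_bool (feas i))"
      by (rule sum.cong[OF refl]) (use 3 in \<open>auto simp: P_def\<close>)
    moreover have "(\<Sum>i\<in>N. cone_sign M (G(i := v)) w) = (\<Sum>i\<in>N. - (e * of_bool (feas i)))"
      by (rule sum.cong[OF refl]) (use 3 in \<open>auto simp: P_def N_def\<close>)
    ultimately show ?thesis
      by (simp only: sum_negf sum_distrib_left[symmetric] right_diff_distrib)
  qed
  finally show ?thesis
    unfolding 1 2 using arg_cong[OF ray, of "\<lambda>x. e * x"] by (simp add: algebra_simps)
qed

section \<open>The join of chessboard complexes\<close>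

text \<open>There are \<open>q\<close> colours with \<open>n\<close> points each, and \<open>p = n + 1\<close> labels \<open>0, ..., n\<close>. The point with number
  \<open>j\<close> of colour \<open>i\<close> is column \<open>i * n + j\<close>.\<close>
locale chessboard =
  fixes q n :: nat
  assumes n_pos: "n > 0" and n_even: "even n"
begin

abbreviation "p \<equiv> Suc n"
abbreviation "M \<equiv> q * n"

text \<open>A maximal simplex gives distinct labels to the \<open>n\<close> points of each colour. The labelling of colour \<open>i\<close> is
  stored as a permutation \<open>F i\<close> of all labels whose value at \<open>n\<close> is the label that the colour misses;
  then the orientation of the simplex is a product of signs of permutations.\<close>
definition facets :: "(nat \<Rightarrow> nat \<Rightarrow> nat) set" where
  "facets = PiE {..<q} (\<lambda>_. {\<phi>. \<phi> permutes {..n}})"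

definition label :: "(nat \<Rightarrow> nat \<Rightarrow> nat) \<Rightarrow> nat \<Rightarrow> nat" where
  "label F c = F (c div n) (c mod n)"

definition facet_sign :: "(nat \<Rightarrow> nat \<Rightarrow> nat) \<Rightarrow> int" where
  "facet_sign F = (\<Prod>i<q. sign (F i))"

text \<open>The degree about the origin of the map that sends the vertex "column \<open>c\<close> with label \<open>k\<close>" to
  \<open>X c k\<close>, counted on the ray through \<open>w\<close>.\<close>
definition degree_sum :: "(nat \<Rightarrow> nat \<Rightarrow> nat \<Rightarrow> real) \<Rightarrow> (nat \<Rightarrow> real) \<Rightarrow> int" where
  "degree_sum X w = (\<Sum>F\<in>facets. facet_sign F * cone_sign M (\<lambda>c. X c (label F c)) w)"

text \<open>The second facet that contains the ridge obtained by deleting column \<open>c\<close>.\<close>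
definition flip :: "nat \<Rightarrow> (nat \<Rightarrow> nat \<Rightarrow> nat) \<Rightarrow> nat \<Rightarrow> nat \<Rightarrow> nat" where
  "flip c F = F(c div n := F (c div n) \<circ> Transposition.transpose (c mod n) n)"

definition cyc :: "nat \<Rightarrow> nat" where
  "cyc k = (if k < n then Suc k else if k = n then 0 else k)"

definition rot :: "(nat \<Rightarrow> nat \<Rightarrow> nat) \<Rightarrow> nat \<Rightarrow> nat \<Rightarrow> nat" where
  "rot F = (\<lambda>i\<in>{..<q}. cyc \<circ> F i)"

lemma colour_less: "c < M \<Longrightarrow> c div n < q"
  by (rule less_mult_imp_div_less)

lemma finite_facets: "finite facets"
  unfolding facets_def by (intro finite_PiE) (auto simp: finite_permutations)

lemma facets_permutes: "F \<in> facets \<Longrightarrow> i < q \<Longrightarrow> F i permutes {..n}"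
  by (auto simp: facets_def PiE_iff)

lemma label_le: "F \<in> facets \<Longrightarrow> c < M \<Longrightarrow> label F c \<le> n"
  using facets_permutes[of F "c div n"] colour_less[of c] permutes_in_image[of "F (c div n)" "{..n}" "c mod n"]
    n_pos by (simp add: label_def less_imp_le)

lemma flip_facets:
  assumes "F \<in> facets" "c < M" shows "flip c F \<in> facets"
proof -
  have "c mod n \<le> n" using n_pos by (simp add: less_imp_le)
  then have "F (c div n) \<circ> Transposition.transpose (c mod n) n permutes {..n}"
    using facets_permutes[OF assms(1) colour_less[OF assms(2)]]
    by (intro permutes_compose permutes_swap_id) auto
  then show ?thesis
    using assms(1) colour_less[OF assms(2)] unfolding facets_def flip_def
    by (intro PiE_I) (auto simp: PiE_iff extensional_def)
qed

lemma flip_flip: "flip c (flip c F) = F"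
  by (auto simp: flip_def fun_eq_iff)

lemma label_flip: "c' < M \<Longrightarrow> c' \<noteq> c \<Longrightarrow> label (flip c F) c' = label F c'"
proof -
  assume "c' \<noteq> c"
  then have "c' mod n \<noteq> c mod n" if "c' div n = c div n"
    using that by (metis div_mod_decomp)
  moreover have "c' mod n \<noteq> n" using n_pos by (metis mod_less_divisor less_irrefl)
  ultimately show ?thesis by (auto simp: label_def flip_def)
qed

lemma facet_sign_flip:
  assumes "F \<in> facets" "c < M" shows "facet_sign (flip c F) = - facet_sign F"
proof -
  let ?i = "c div n"
  have i: "?i \<in> {..<q}" using colour_less[OF assms(2)] by simp
  have ne: "c mod n \<noteq> n" using n_pos by (metis mod_less_divisor less_irrefl)
  have "permutation (F ?i)" using facets_permutes[OF assms(1)] i by (auto simp: permutation_permutes)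
  then have "sign (F ?i \<circ> Transposition.transpose (c mod n) n) = - sign (F ?i)"
    using ne by (simp add: sign_compose permutation_swap_id sign_swap_id)
  moreover have "(\<Prod>j\<in>{..<q} - {?i}. sign (flip c F j)) = (\<Prod>j\<in>{..<q} - {?i}. sign (F j))"
    by (rule prod.cong) (auto simp: flip_def)
  ultimately show ?thesis
    unfolding facet_sign_def by (subst (1 2) prod.remove[OF _ i]) (auto simp: flip_def)
qed

text \<open>The join is an oriented pseudomanifold: a quantity that does not see column \<open>c\<close> is counted twice,
  with opposite signs.\<close>
lemma flip_cancel:
  assumes "c < M" "\<And>F. F \<in> facets \<Longrightarrow> h (flip c F) = h F"
  shows "(\<Sum>F\<in>facets. facet_sign F * h F) = (0 :: int)"
proof -
  have "(\<Sum>F\<in>facets. facet_sign F * h F) = (\<Sum>F\<in>facets. - (facet_sign F * h F))"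
    by (rule sum.reindex_bij_witness[of _ "flip c" "flip c"])
       (use assms in \<open>auto simp: flip_flip flip_facets facet_sign_flip\<close>)
  then show ?thesis by (simp add: sum_negf)
qed

text \<open>The sum of the exchange formula over all facets. The terms in which \<open>v\<close> replaces column \<open>i\<close> cancel
  in pairs, except possibly at a column \<open>a\<close> on whose label \<open>v\<close> may depend. If \<open>v\<close> is
  constant, then \<open>a = M\<close> expresses that there is no such column.\<close>
lemma degree_sum_exchange:
  assumes v: "\<And>F c. F \<in> facets \<Longrightarrow> c < M \<Longrightarrow> c \<noteq> a \<Longrightarrow> v (flip c F) = v F"
    and G: "\<And>F. F \<in> facets \<Longrightarrow> cdet M (\<lambda>c. X c (label F c)) \<noteq> 0"
    and Gv: "\<And>F i. F \<in> facets \<Longrightarrow> i < M \<Longrightarrow> cdet M ((\<lambda>c. X c (label F c))(i := v F)) \<noteq> 0"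
    and Gw: "\<And>F i. F \<in> facets \<Longrightarrow> i < M \<Longrightarrow> cdet M ((\<lambda>c. X c (label F c))(i := w)) \<noteq> 0"
    and Gvw: "\<And>F i j. F \<in> facets \<Longrightarrow> i < M \<Longrightarrow> j < M \<Longrightarrow> i \<noteq> j \<Longrightarrow>
        cdet M ((\<lambda>c. X c (label F c))(i := v F, j := w)) \<noteq> 0"
  shows "degree_sum X w - (\<Sum>F\<in>facets. if a < M
        then facet_sign F * cone_sign M ((\<lambda>c. X c (label F c))(a := v F)) w else 0)
      = (\<Sum>F\<in>facets. facet_sign F * cone_sign M (\<lambda>c. X c (label F c)) (\<lambda>r. - v F r))"
proof -
  let ?G = "\<lambda>F c. X c (label F c)"
  let ?h = "\<lambda>i F. cone_sign M ((?G F)(i := v F)) w"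
  have zero: "(\<Sum>F\<in>facets. facet_sign F * ?h i F) = 0" if i: "i < M" "i \<noteq> a" for i
  proof (rule flip_cancel[OF i(1)])
    fix F assume F: "F \<in> facets"
    have "((?G (flip i F))(i := v (flip i F))) c r = ((?G F)(i := v F)) c r" if "c < M" "r < M" for c r
      using v[OF F i] label_flip[OF that(1), of i F] by auto
    then show "?h i (flip i F) = ?h i F" by (intro cone_sign_cong) auto
  qed
  have "(\<Sum>F\<in>facets. facet_sign F * (\<Sum>i<M. ?h i F)) = (\<Sum>i<M. \<Sum>F\<in>facets. facet_sign F * ?h i F)"
    unfolding sum_distrib_left by (rule sum.swap)
  also have "\<dots> = (\<Sum>i<M. if i = a then (\<Sum>F\<in>facets. facet_sign F * ?h a F) else 0)"
    by (rule sum.cong) (auto simp: zero)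
  also have "\<dots> = (\<Sum>F\<in>facets. if a < M then facet_sign F * ?h a F else 0)"
    by simp
  finally have 1: "(\<Sum>F\<in>facets. facet_sign F * (\<Sum>i<M. ?h i F)) = \<dots>" .
  have "cone_sign M (?G F) (\<lambda>r. - v F r) = cone_sign M (?G F) w - (\<Sum>i<M. ?h i F)" if "F \<in> facets" for F
    by (rule cone_sign_exchange[symmetric]) (use that G Gv Gw Gvw in auto)
  then have "(\<Sum>F\<in>facets. facet_sign F * cone_sign M (?G F) (\<lambda>r. - v F r))
      = (\<Sum>F\<in>facets. facet_sign F * cone_sign M (?G F) w - facet_sign F * (\<Sum>i<M. ?h i F))"
    by (intro sum.cong) (auto simp: right_diff_distrib)
  then show ?thesis unfolding degree_sum_def sum_subtractf 1 by simp
qed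

lemma cyc_permutes: "cyc permutes {..n}"
proof (rule bij_imp_permutes)
  show "bij_betw cyc {..n} {..n}"
    by (rule bij_betw_byWitness[of _ "\<lambda>k. if k = 0 then n else k - 1"]) (auto simp: cyc_def)
qed (auto simp: cyc_def)

lemma cyc_eq: "k \<le> n \<Longrightarrow> cyc k = Suc k mod p"
  by (simp add: cyc_def)

lemma cyc_funpow:
  assumes "k \<le> n" shows "(cyc ^^ m) k = (k + m) mod p"
proof (induction m)
  case (Suc m)
  have "(k + m) mod p < p" by (rule mod_less_divisor) simp
  then have "cyc ((k + m) mod p) = Suc ((k + m) mod p) mod p" by (intro cyc_eq) linarith
  also have "\<dots> = (k + Suc m) mod p" by (simp only: mod_Suc_eq add_Suc_right)
  finally show ?case using Suc by (simp only: funpow.simps o_apply)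
qed (use assms in simp)

text \<open>A permutation of odd order is even.\<close>
lemma sign_cyc: "sign cyc = 1"
proof -
  have perm: "permutation cyc" using cyc_permutes by (auto simp: permutation_permutes)
  have pw: "permutation (cyc ^^ m) \<and> sign (cyc ^^ m) = sign cyc ^ m" for m
  proof (induction m)
    case (Suc m)
    then show ?case
      using permutation_compose[OF perm, of "cyc ^^ m"] sign_compose[OF perm, of "cyc ^^ m"]
      by (simp only: funpow.simps power_Suc)
  qed simp
  have "(cyc ^^ p) k = k" for k
  proof (cases "k \<le> n")
    case True
    have "(cyc ^^ p) k = (k + p) mod p" by (rule cyc_funpow[OF True])
    also have "\<dots> = k" using True by (metis mod_add_self2 mod_less le_imp_less_Suc)
    finally show ?thesis .
  next
    case False
    have "(cyc ^^ m) k = k" for m using False by (induction m) (auto simp: cyc_def)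
    then show ?thesis .
  qed
  then have "cyc ^^ p = id" by auto
  then have "sign cyc ^ p = 1" using pw[of p] by (simp add: sign_id del: funpow.simps)
  moreover have "odd p" using n_even by simp
  ultimately have "sign cyc = -1 \<Longrightarrow> (1 :: int) = -1"
    using neg_one_odd_power[of p, where ?'a = int] by metis
  then show ?thesis using sign_cases[of cyc] by auto
qed

lemma rot_facets:
  assumes "F \<in> facets" shows "rot F \<in> facets"
proof -
  have "cyc \<circ> F i permutes {..n}" if "i < q" for i
    using facets_permutes[OF assms that] cyc_permutes by (rule permutes_compose)
  then show ?thesis unfolding facets_def rot_def by (intro PiE_I) auto
qed

lemma label_rot: "c < M \<Longrightarrow> label (rot F) c = cyc (label F c)"
  by (simp add: label_def rot_def colour_less)

lemma facet_sign_rot: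
  assumes "F \<in> facets" shows "facet_sign (rot F) = facet_sign F"
  unfolding facet_sign_def
proof (rule prod.cong[OF refl])
  fix i assume "i \<in> {..<q}"
  then have "permutation (F i)" using facets_permutes[OF assms] by (auto simp: permutation_permutes)
  moreover have "permutation cyc" using cyc_permutes by (auto simp: permutation_permutes)
  ultimately show "sign (rot F i) = sign (F i)"
    using \<open>i \<in> {..<q}\<close> by (simp add: rot_def sign_compose sign_cyc)
qed

lemma inj_on_rot: "inj_on rot facets"
proof (rule inj_onI)
  fix F F' assume F: "F \<in> facets" "F' \<in> facets" and eq: "rot F = rot F'"
  show "F = F'"
  proof (rule PiE_ext)
    show "F \<in> PiE {..<q} (\<lambda>_. {\<phi>. \<phi> permutes {..n}})" "F' \<in> PiE {..<q} (\<lambda>_. {\<phi>. \<phi> permutes {..n}})"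
      using F by (auto simp: facets_def)
    fix i assume "i \<in> {..<q}"
    then have "cyc \<circ> F i = cyc \<circ> F' i" using fun_cong[OF eq, of i] by (simp add: rot_def)
    then show "F i = F' i"
      using permutes_inj[OF cyc_permutes] by (metis fun.inj_map inj_eq)
  qed
qed

lemma rot_image: "rot ` facets = facets"
  using inj_on_rot finite_facets rot_facets by (intro endo_inj_surj) auto

text \<open>The rotation of the labels changes the label of column \<open>a\<close> cyclically, so the sums over the facets
  with a given label of \<open>a\<close> are all equal, and there are \<open>p\<close> of them.\<close>
lemma rot_invariant_sum_dvd:
  fixes H :: "(nat \<Rightarrow> nat \<Rightarrow> nat) \<Rightarrow> int"
  assumes a: "a < M" and H: "\<And>F. F \<in> facets \<Longrightarrow> H (rot F) = H F"
  shows "int p dvd (\<Sum>F\<in>facets. H F)"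
proof -
  define s where "s k = (\<Sum>F\<in>{F \<in> facets. label F a = k}. H F)" for k
  have step: "s (cyc k) = s k" if "k \<le> n" for k
  proof -
    have "inj_on rot {F \<in> facets. label F a = k}" by (rule inj_on_subset[OF inj_on_rot]) auto
    moreover have "rot ` {F \<in> facets. label F a = k} = {F \<in> facets. label F a = cyc k}"
    proof -
      have "\<exists>F'\<in>facets. label F' a = k \<and> rot F' = F" if "F \<in> facets" "label F a = cyc k" for F
      proof -
        have "F \<in> rot ` facets" using that(1) rot_image by simp
        then obtain F' where F': "F = rot F'" "F' \<in> facets" by (rule imageE)
        then have "cyc (label F' a) = cyc k" using label_rot[OF a, of F'] that(2) by simp
        then have "label F' a = k" using permutes_inj[OF cyc_permutes] by (rule injD[rotated])
        with F' show ?thesis by (intro bexI[of _ F']) auto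
      qed
      moreover have "rot F \<in> {F \<in> facets. label F a = cyc k}" if "F \<in> facets" "label F a = k" for F
        using that rot_facets label_rot[OF a] by simp
      ultimately show ?thesis by blast
    qed
    ultimately have "s (cyc k) = (\<Sum>F\<in>{F \<in> facets. label F a = k}. H (rot F))"
      unfolding s_def by (metis (mono_tags, lifting) sum.reindex_cong)
    also have "\<dots> = s k" unfolding s_def by (rule sum.cong) (auto simp: H)
    finally show ?thesis .
  qed
  have s0: "s k = s 0" if "k \<le> n" for k using that
  proof (induction k)
    case (Suc k)
    then have "cyc k = Suc k" by (simp add: cyc_def)
    with Suc step[of k] show ?case by simp
  qed simp
  have "(\<Sum>F\<in>facets. H F) = (\<Sum>k\<in>{..n}. s k)"
    unfolding s_def by (rule sum.group[symmetric]) (auto simp: finite_facets label_le a)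
  also have "\<dots> = (\<Sum>k\<in>{..n}. s 0)" by (rule sum.cong[OF refl]) (rule s0, simp)
  also have "\<dots> = int p * s 0" by simp
  finally show ?thesis by simp
qed

end

section \<open>The cyclic shift and general position\<close>

context chessboard
begin

text \<open>The space is a product of \<open>q\<close> copies of \<open>\<real>^p\<close> modulo the constant vectors. A class is represented by
  the vector with last coordinate \<open>0\<close>, which is not stored; \<open>shift\<close> is the map on the quotient
  induced by the cyclic shift of the coordinates.\<close>
definition coord :: "(nat \<Rightarrow> real) \<Rightarrow> nat \<Rightarrow> nat \<Rightarrow> real" where
  "coord v i s = (if s < n then v (i * n + s) else 0)"

definition shift :: "nat \<Rightarrow> (nat \<Rightarrow> real) \<Rightarrow> nat \<Rightarrow> real" where
  "shift k v r = coord v (r div n) ((r mod n + k) mod p) - coord v (r div n) ((n + k) mod p)"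

definition unit :: "nat \<Rightarrow> nat \<Rightarrow> real" where
  "unit l r = of_bool (r = l)"

lemma sum_unit:
  assumes "c < M"
  shows "(\<Sum>l<M. a l * unit l c) = a c" "(\<Sum>l<M. a l * unit c l) = a c"
proof -
  have "(\<Sum>l<M. a l * unit l c) = (\<Sum>l<M. if l = c then a l else 0)"
    "(\<Sum>l<M. a l * unit c l) = (\<Sum>l<M. if l = c then a l else 0)"
    by (auto simp: unit_def intro!: sum.cong)
  then show "(\<Sum>l<M. a l * unit l c) = a c" "(\<Sum>l<M. a l * unit c l) = a c"
    using assms by auto
qed

lemma coord_shift:
  assumes "s \<le> n"
  shows "coord (shift k v) i s = coord v i ((s + k) mod p) - coord v i ((n + k) mod p)"
proof (cases "s < n")
  case True
  then have "(i * n + s) div n = i" "(i * n + s) mod n = s" by auto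
  then show ?thesis using True by (simp add: coord_def[of "shift k v"] shift_def)
next
  case False
  then have "s = n" using assms by simp
  then show ?thesis by (simp add: coord_def[of "shift k v"])
qed

lemma shift_add: "shift j (shift k v) = shift (j + k) v"
proof
  fix r
  have le: "(m + j) mod p \<le> n" for m
    using mod_less_divisor[of p "m + j"] by simp
  show "shift j (shift k v) r = shift (j + k) v r"
    unfolding shift_def[of j] shift_def[of "j + k"] coord_shift[OF le] mod_add_left_eq
    by (simp only: add.assoc)
qed

lemma shift_0 [simp]: "shift 0 v = v"
proof
  fix r
  have "r mod n < n" using n_pos by simp
  then show "shift 0 v r = v r" by (simp add: shift_def coord_def)
qed

lemma shift_period: "shift p v = v"
proof -
  have "shift p v = shift 0 v" unfolding shift_def by (simp only: mod_add_self2 add_0_right)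
  then show ?thesis by simp
qed

lemma shift_cyc:
  assumes "k \<le> n" shows "shift (cyc k) v = shift 1 (shift k v)"
proof (cases "k < n")
  case True then show ?thesis by (simp add: shift_add cyc_def)
next
  case False
  then have "k = n" using assms by simp
  then show ?thesis using shift_period[of v] by (simp add: shift_add cyc_def)
qed

lemma coord_linear:
  assumes "i < q" shows "coord v i s = (\<Sum>l<M. coord (unit l) i s * v l)"
proof (cases "s < n")
  case True
  have "i * n + s < Suc i * n" using True by simp
  also have "\<dots> \<le> q * n" using assms by (intro mult_right_mono) auto
  finally show ?thesis using True by (simp add: coord_def unit_def)
qed (simp add: coord_def)

lemma shift_linear:
  assumes "r < M" shows "shift k v r = (\<Sum>l<M. shift k (unit l) r * v l)"
  unfolding shift_def coord_linear[OF colour_less[OF assms], of v]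
  by (simp add: left_diff_distrib sum_subtractf)

lemma shift_minus: "shift k (\<lambda>r. - v r) = (\<lambda>r. - shift k v r)"
  by (rule ext) (simp add: shift_def coord_def)

lemma shift_affine: "shift k (\<lambda>r. a * v r + b * w r) r = a * shift k v r + b * shift k w r"
  by (simp add: shift_def coord_def algebra_simps)

lemma shift_sum:
  assumes "r < M" "\<And>r. r < M \<Longrightarrow> w r = (\<Sum>c<M. \<omega> c * G c r)"
  shows "shift k w r = (\<Sum>c<M. \<omega> c * shift k (G c) r)"
proof -
  have "shift k w r = (\<Sum>l<M. \<Sum>c<M. shift k (unit l) r * (\<omega> c * G c l))"
    by (subst shift_linear[OF assms(1)]) (simp add: assms(2) sum_distrib_left)
  also have "\<dots> = (\<Sum>c<M. \<Sum>l<M. shift k (unit l) r * (\<omega> c * G c l))" by (rule sum.swap)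
  also have "\<dots> = (\<Sum>c<M. \<omega> c * shift k (G c) r)"
    by (subst (2) shift_linear[OF assms(1)]) (simp add: sum_distrib_left mult_ac)
  finally show ?thesis .
qed

text \<open>The shift has odd order \<open>p\<close>, so its determinant is a real number with \<open>p\<close>-th power \<open>1\<close>.\<close>
lemma cdet_shift: "cdet M (\<lambda>c. shift k (G c)) = cdet M G"
proof -
  define D where "D k = cdet M (\<lambda>l. shift k (unit l))" for k
  have mult: "cdet M (\<lambda>c. shift k (G c)) = D k * cdet M G" for k G
  proof -
    have "cdet M (\<lambda>c. shift k (G c)) = cdet M (\<lambda>c r. \<Sum>l<M. shift k (unit l) r * G c l)"
      by (rule cdet_cong) (rule shift_linear)
    then show ?thesis by (simp add: cdet_mult D_def)
  qed
  have "D 0 \<noteq> 0"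
  proof
    assume "D 0 = 0"
    then obtain l c where c: "c < M" "l c \<noteq> 0" and l: "\<And>r. r < M \<Longrightarrow> (\<Sum>c<M. l c * unit c r) = 0"
      unfolding D_def cdet_eq_0_iff by auto
    have "(\<Sum>c'<M. l c' * unit c' c) = l c" using c(1) by (rule sum_unit)
    with l[OF c(1)] c(2) show False by simp
  qed
  moreover have "D 0 = D 0 * D 0" using mult[of 0 unit] by (simp add: D_def)
  ultimately have D0: "D 0 = 1" by simp
  have pow: "D j = D 1 ^ j" for j
  proof (induction j)
    case (Suc j)
    have "D (Suc j) = cdet M (\<lambda>l. shift 1 (shift j (unit l)))" by (simp add: D_def shift_add)
    also have "\<dots> = D 1 * D j" unfolding D_def[of j] by (rule mult)
    finally show ?case using Suc by simp
  qed (simp add: D0)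
  have "D p = D 0" unfolding D_def shift_period by simp
  then have p1: "D 1 ^ p = 1" using pow[of p] D0 by metis
  moreover have "odd p" using n_even by simp
  ultimately have "0 \<le> D 1" using zero_le_odd_power[of p "D 1"] by simp
  then have "D 1 = 1" using p1 power_eq_imp_eq_base[of "D 1" p 1] by simp
  then have "D k = 1" using pow[of k] by (metis power_one)
  then show ?thesis using mult[of k G] by (metis mult_1)
qed

lemma cone_sign_shift: "cone_sign M (\<lambda>c. shift k (G c)) (shift k w) = cone_sign M G w"
proof (cases "cdet M G = 0")
  case True
  then have "cdet M (\<lambda>c. shift k (G c)) = 0" by (simp add: cdet_shift)
  with True show ?thesis by (simp add: cone_sign_def)
next
  case False
  then obtain \<omega> where \<omega>: "\<And>r. r < M \<Longrightarrow> w r = (\<Sum>c<M. \<omega> c * G c r)"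
    using cdet_solve[OF False] by blast
  have 1: "cone_sign M G w = (if \<forall>c<M. \<omega> c > 0 then (if cdet M G > 0 then 1 else -1) else 0)"
    using False \<omega> by (rule cone_sign_eq)
  have "cdet M (\<lambda>c. shift k (G c)) \<noteq> 0" using False by (simp add: cdet_shift)
  then have "cone_sign M (\<lambda>c. shift k (G c)) (shift k w) =
      (if \<forall>c<M. \<omega> c > 0 then (if cdet M (\<lambda>c. shift k (G c)) > 0 then 1 else -1) else 0)"
    by (rule cone_sign_eq) (rule shift_sum[OF _ \<omega>])
  then show ?thesis unfolding 1 cdet_shift .
qed

text \<open>Any at most \<open>M\<close> members stay independent after arbitrary shifts. The condition is stated for all
  smaller sets as well in order to allow an induction on the number of members.\<close>
definition independent_family :: "(nat \<Rightarrow> nat \<Rightarrow> real) \<Rightarrow> nat \<Rightarrow> bool" where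
  "independent_family z B \<longleftrightarrow> (\<forall>A k l. A \<subseteq> {..<B} \<longrightarrow> card A \<le> M \<longrightarrow> (\<forall>b\<in>A. k b \<le> n) \<longrightarrow>
     (\<forall>r<M. (\<Sum>b\<in>A. l b * shift (k b) (z b) r) = 0) \<longrightarrow> (\<forall>b\<in>A. l b = 0))"

lemma exists_normal:
  assumes "finite A" "card A < M"
  shows "\<exists>h. (\<exists>r<M. h r \<noteq> 0) \<and> (\<forall>b\<in>A. (\<Sum>r<M. h r * g b r) = (0 :: real))"
proof -
  obtain e where e: "bij_betw e {0..<card A} A" using ex_bij_betw_nat_finite[OF assms(1)] by blast
  define G where "G c = (if c < card A then g (e c) else (\<lambda>_. 0))" for c
  have "cdet M G = 0"
    unfolding cdet_eq_0_iff
  proof (intro exI[of _ "unit (card A)"] conjI exI[of _ "card A"] allI impI)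
    show "(\<Sum>c<M. unit (card A) c * G c r) = 0" for r
      by (intro sum.neutral) (auto simp: unit_def G_def)
  qed (use assms in \<open>auto simp: unit_def\<close>)
  then have "cdet M (\<lambda>c r. G r c) = 0" unfolding cdet_transpose[of M G] .
  then obtain h where h: "\<exists>r<M. h r \<noteq> 0" "\<forall>c<M. (\<Sum>r<M. h r * G c r) = 0"
    unfolding cdet_eq_0_iff by (elim exE, elim conjE) (rule that)
  have "(\<Sum>r<M. h r * g b r) = 0" if b: "b \<in> A" for b
  proof -
    have "b \<in> e ` {0..<card A}" using e b by (simp add: bij_betw_def)
    then obtain c where "c < card A" "e c = b" by auto
    then show ?thesis using h(2)[rule_format, of c] assms(2) by (simp add: G_def)
  qed
  with h(1) show ?thesis by blast
qed

text \<open>The moment curve and its shifted images meet each hyperplane in finitely many points: a nonzero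
  linear form becomes a nonzero polynomial in the parameter.\<close>
lemma finite_moment_roots:
  assumes h: "\<exists>r<M. h r \<noteq> 0" and k: "k \<le> n"
  shows "finite {s :: real. (\<Sum>r<M. h r * shift k (\<lambda>l. s ^ l) r) = 0}"
proof -
  define a where "a l = (\<Sum>r<M. h r * shift k (unit l) r)" for l
  have ev: "(\<Sum>r<M. h r * shift k v r) = (\<Sum>l<M. a l * v l)" for v
  proof -
    have "(\<Sum>r<M. h r * shift k v r) = (\<Sum>r<M. \<Sum>l<M. h r * (shift k (unit l) r * v l))"
      by (rule sum.cong[OF refl]) (simp add: shift_linear[of _ k v] sum_distrib_left)
    also have "\<dots> = (\<Sum>l<M. \<Sum>r<M. h r * (shift k (unit l) r * v l))" by (rule sum.swap)
    finally show ?thesis by (simp add: a_def sum_distrib_right mult.assoc)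
  qed
  obtain r0 where r0: "r0 < M" "h r0 \<noteq> 0" using h by blast
  have "\<exists>l<M. a l \<noteq> 0"
  proof (rule ccontr)
    assume "\<not> ?thesis"
    then have "(\<Sum>r<M. h r * shift k (shift (p - k) (unit r0)) r) = 0" unfolding ev by simp
    moreover have "shift k (shift (p - k) (unit r0)) = unit r0"
      using k shift_period by (simp add: shift_add)
    ultimately have "(\<Sum>r<M. h r * unit r0 r) = 0" by simp
    then show False using r0 by (simp add: sum_unit)
  qed
  then obtain l0 where l0: "l0 < M" "a l0 \<noteq> 0" by blast
  define P where "P = (\<Sum>l<M. Polynomial.monom (a l) l)"
  have P: "poly P s = (\<Sum>l<M. a l * s ^ l)" for s
    by (simp add: P_def poly_sum poly_monom)
  have "poly.coeff P l0 = a l0" using l0(1) by (simp add: P_def coeff_sum)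
  then have "P \<noteq> 0" using l0(2) by auto
  then have "finite {s. poly P s = 0}" by (rule poly_roots_finite)
  then show ?thesis by (simp add: P ev)
qed

text \<open>New members are taken from the moment curve, avoiding a normal vector of each of the finitely many
  subspaces spanned by fewer than \<open>M\<close> shifted old members.\<close>
lemma exists_independent_family: "\<exists>z. independent_family z B"
proof (induction B)
  case 0
  then show ?case by (auto simp: independent_family_def)
next
  case (Suc B)
  then obtain z where z: "independent_family z B" by blast
  define I where "I = Sigma {A. A \<subseteq> {..<B} \<and> card A < M} (\<lambda>A. PiE A (\<lambda>_. {..n}))"
  have finI: "finite I"
    unfolding I_def by (intro finite_SigmaI finite_PiE) (auto intro: finite_subset)
  have "\<exists>h. (\<exists>r<M. h r \<noteq> 0) \<and> (\<forall>b\<in>fst i. (\<Sum>r<M. h r * shift (snd i b) (z b) r) = (0 :: real))"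
    if "i \<in> I" for i
  proof (rule exists_normal)
    have "fst i \<subseteq> {..<B}" using that by (auto simp: I_def)
    then show "finite (fst i)" by (rule finite_subset) simp
    show "card (fst i) < M" using that by (auto simp: I_def)
  qed
  then obtain H where H: "\<And>i. i \<in> I \<Longrightarrow> \<exists>r<M. H i r \<noteq> (0 :: real)"
      "\<And>i b. i \<in> I \<Longrightarrow> b \<in> fst i \<Longrightarrow> (\<Sum>r<M. H i r * shift (snd i b) (z b) r) = 0"
    by metis
  define bad where "bad = (\<Union>i\<in>I. \<Union>k\<in>{..n}. {s :: real. (\<Sum>r<M. H i r * shift k (\<lambda>l. s ^ l) r) = 0})"
  have "finite bad" unfolding bad_def using finI H(1) finite_moment_roots by auto
  then obtain s where s: "s \<notin> bad" using ex_new_if_finite[OF infinite_UNIV_char_0] by blast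
  define z' where "z' = z(B := \<lambda>l. s ^ l)"
  have "independent_family z' (Suc B)"
    unfolding independent_family_def
  proof (intro allI impI)
    fix A k l assume A: "A \<subseteq> {..<Suc B}" "card A \<le> M" "\<forall>b\<in>A. k b \<le> n"
      and rel: "\<forall>r<M. (\<Sum>b\<in>A. l b * shift (k b) (z' b) r) = 0"
    define A' where "A' = A - {B}"
    have A': "A' \<subseteq> {..<B}" using A(1) by (auto simp: A'_def)
    have finA: "finite A" using A(1) finite_subset by blast
    have lB: "l B = 0" if "B \<in> A"
    proof -
      define i where "i = (A', restrict k A')"
      have "card A' < M" unfolding A'_def using that finA A(2) by (metis card_Diff1_less less_le_trans)
      then have i: "i \<in> I" using A A' by (auto simp: i_def I_def A'_def)
      have "0 = (\<Sum>r<M. H i r * (\<Sum>b\<in>A. l b * shift (k b) (z' b) r))" using rel by simp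
      also have "\<dots> = (\<Sum>b\<in>A. l b * (\<Sum>r<M. H i r * shift (k b) (z' b) r))"
        unfolding sum_distrib_left by (subst sum.swap) (simp add: mult_ac)
      also have "\<dots> = l B * (\<Sum>r<M. H i r * shift (k B) (z' B) r)
          + (\<Sum>b\<in>A'. l b * (\<Sum>r<M. H i r * shift (k b) (z' b) r))"
        unfolding A'_def by (rule sum.remove[OF finA that])
      also have "(\<Sum>b\<in>A'. l b * (\<Sum>r<M. H i r * shift (k b) (z' b) r)) = 0"
      proof (rule sum.neutral, rule ballI)
        fix b assume b: "b \<in> A'"
        then have "(\<Sum>r<M. H i r * shift (k b) (z b) r) = 0" using H(2)[OF i, of b] by (simp add: i_def)
        moreover have "z' b = z b" using b by (auto simp: z'_def A'_def)
        ultimately show "l b * (\<Sum>r<M. H i r * shift (k b) (z' b) r) = 0" by simp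
      qed
      finally have "l B * (\<Sum>r<M. H i r * shift (k B) (\<lambda>l. s ^ l) r) = 0" by (simp add: z'_def)
      moreover have "(\<Sum>r<M. H i r * shift (k B) (\<lambda>l. s ^ l) r) \<noteq> 0"
        using s i A(3) that by (auto simp: bad_def)
      ultimately show ?thesis by simp
    qed
    have "(\<Sum>b\<in>A'. l b * shift (k b) (z b) r) = 0" if "r < M" for r
    proof -
      have "(\<Sum>b\<in>A. l b * shift (k b) (z' b) r) = (\<Sum>b\<in>A'. l b * shift (k b) (z' b) r)"
        by (rule sum.mono_neutral_right) (use finA lB in \<open>auto simp: A'_def\<close>)
      also have "\<dots> = (\<Sum>b\<in>A'. l b * shift (k b) (z b) r)"
        by (rule sum.cong) (auto simp: A'_def z'_def)
      finally show ?thesis using rel that by simp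
    qed
    moreover have "card A' \<le> M" using A(2) card_Diff1_le[of A B] by (simp add: A'_def)
    ultimately have "\<forall>b\<in>A'. l b = 0"
      using z A' A(3) unfolding independent_family_def A'_def by blast
    then show "\<forall>b\<in>A. l b = 0" using lB by (auto simp: A'_def)
  qed
  then show ?case by blast
qed

definition in_general_position :: "(nat \<Rightarrow> nat \<Rightarrow> real) \<Rightarrow> nat \<Rightarrow> bool" where
  "in_general_position x B \<longleftrightarrow> (\<forall>c k. inj_on c {..<M} \<longrightarrow> c ` {..<M} \<subseteq> {..<B} \<longrightarrow> (\<forall>i<M. k i \<le> n) \<longrightarrow>
     cdet M (\<lambda>i. shift (k i) (x (c i))) \<noteq> 0)"

lemma independent_family_imp_general_position:
  assumes z: "independent_family z B" shows "in_general_position z B"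
  unfolding in_general_position_def
proof (intro allI impI notI)
  fix c k assume c: "inj_on c {..<M}" "c ` {..<M} \<subseteq> {..<B}" and k: "\<forall>i<M. k i \<le> n"
    and "cdet M (\<lambda>i. shift (k i) (z (c i))) = 0"
  then obtain l i0 where i0: "i0 < M" "l i0 \<noteq> 0"
    and l: "\<And>r. r < M \<Longrightarrow> (\<Sum>i<M. l i * shift (k i) (z (c i)) r) = 0"
    unfolding cdet_eq_0_iff by auto
  let ?j = "the_inv_into {..<M} c"
  have j: "?j (c i) = i" if "i < M" for i using the_inv_into_f_f[OF c(1)] that by simp
  have "(\<Sum>b\<in>c ` {..<M}. l (?j b) * shift (k (?j b)) (z b) r) = 0" if "r < M" for r
    using l[OF that] by (subst sum.reindex[OF c(1)]) (simp add: j)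
  moreover have "\<forall>b\<in>c ` {..<M}. k (?j b) \<le> n" using k j by auto
  moreover have "card (c ` {..<M}) \<le> M" using card_image[OF c(1)] by simp
  ultimately have "\<forall>b\<in>c ` {..<M}. l (?j b) = 0"
    using z[unfolded independent_family_def, rule_format, of "c ` {..<M}" "\<lambda>b. k (?j b)" "\<lambda>b. l (?j b)"] c(2)
    by blast
  with i0 j show False by simp
qed

text \<open>Each family can be moved into general position, by arbitrarily little, along the segment to
  a fixed family in general position.\<close>
lemma general_position_perturbation:
  obtains z where "eventually (\<lambda>t. in_general_position (\<lambda>b r. (1 - t) * y b r + t * z b r) B) (at_right 0)"
proof -
  obtain z where z: "in_general_position z B"
    using exists_independent_family independent_family_imp_general_position by blast
  let ?x = "\<lambda>t b r. (1 - t) * y b r + t * z b r"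
  let ?C = "{c \<in> PiE {..<M} (\<lambda>_. {..<B}). inj_on c {..<M}}" and ?K = "PiE {..<M} (\<lambda>_. {..n})"
  have "eventually (\<lambda>t. \<forall>c\<in>?C. \<forall>k\<in>?K. cdet M (\<lambda>i. shift (k i) (?x t (c i))) \<noteq> 0) (at_right 0)"
  proof (intro eventually_ball_finite ballI)
    fix c k assume c: "c \<in> ?C" and k: "k \<in> ?K"
    have "cdet M (\<lambda>i. shift (k i) (z (c i))) \<noteq> 0"
      using z c k unfolding in_general_position_def by (auto simp: PiE_iff image_subset_iff)
    from cdet_segment_eventually_nonzero[OF this, of "\<lambda>i. shift (k i) (y (c i))"]
    show "eventually (\<lambda>t. cdet M (\<lambda>i. shift (k i) (?x t (c i))) \<noteq> 0) (at_right 0)"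
      by (simp add: shift_affine[abs_def])
  qed (auto intro!: finite_PiE)
  then have "eventually (\<lambda>t. in_general_position (?x t) B) (at_right 0)"
  proof (rule eventually_mono)
    fix t assume *: "\<forall>c\<in>?C. \<forall>k\<in>?K. cdet M (\<lambda>i. shift (k i) (?x t (c i))) \<noteq> 0"
    show "in_general_position (?x t) B"
      unfolding in_general_position_def
    proof (intro allI impI)
      fix c k assume c: "inj_on c {..<M}" "c ` {..<M} \<subseteq> {..<B}" and k: "\<forall>i<M. k i \<le> n"
      have "restrict c {..<M} \<in> ?C" using c by (auto simp: inj_on_def)
      moreover have "restrict k {..<M} \<in> ?K" using k by auto
      ultimately have "cdet M (\<lambda>i. shift (restrict k {..<M} i) (?x t (restrict c {..<M} i))) \<noteq> 0"
        using * by blast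
      also have "cdet M (\<lambda>i. shift (restrict k {..<M} i) (?x t (restrict c {..<M} i))) =
          cdet M (\<lambda>i. shift (k i) (?x t (c i)))" by (rule cdet_cong) simp
      finally show "cdet M (\<lambda>i. shift (k i) (?x t (c i))) \<noteq> 0" .
    qed
  qed
  then show thesis by (rule that)
qed

end

section \<open>The degree modulo a prime\<close>

text \<open>The hypothesis on \<open>\<omega>\<close> says that \<open>v\<close> is inside the open cone or outside the closed one, never on the
  boundary. By Cramer's rule both are open conditions on determinants.\<close>
lemma cone_sign_eventually_eq:
  assumes H: "cdet M H \<noteq> 0" and v: "\<And>r. r < M \<Longrightarrow> v r = (\<Sum>c<M. \<omega> c * H c r)"
    and \<omega>: "(\<forall>c<M. \<omega> c > 0) \<or> (\<exists>c<M. \<omega> c < 0)"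
    and G: "\<And>c r. c < M \<Longrightarrow> r < M \<Longrightarrow> ((\<lambda>t. G t c r) \<longlongrightarrow> H c r) F"
    and w: "\<And>r. r < M \<Longrightarrow> ((\<lambda>t. w t r) \<longlongrightarrow> v r) F"
  shows "eventually (\<lambda>t. cone_sign M (G t) (w t) = cone_sign M H v) F"
proof -
  define e where "e = cdet M H"
  have e0: "e * e > 0" using H by (auto simp: e_def zero_less_mult_iff not_less_iff_gr_or_eq)
  have detG: "((\<lambda>t. cdet M (G t) * e) \<longlongrightarrow> e * e) F"
    using tendsto_cdet[OF G] by (intro tendsto_mult tendsto_const) (auto simp: e_def)
  have detGw: "((\<lambda>t. cdet M ((G t)(c := w t)) * e) \<longlongrightarrow> \<omega> c * (e * e)) F" if "c < M" for c
  proof -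
    have "((\<lambda>t. cdet M ((G t)(c := w t))) \<longlongrightarrow> cdet M (H(c := v))) F"
      by (rule tendsto_cdet) (use G w in auto)
    also have "cdet M (H(c := v)) = \<omega> c * e" unfolding e_def using v that by (rule cdet_cramer)
    finally have "((\<lambda>t. cdet M ((G t)(c := w t)) * e) \<longlongrightarrow> (\<omega> c * e) * e) F"
      by (intro tendsto_mult tendsto_const)
    then show ?thesis by (simp add: mult.assoc)
  qed
  have ev1: "eventually (\<lambda>t. cdet M (G t) * e > 0) F"
    by (rule order_tendstoD(1)[OF detG e0])
  have sgn: "(if cdet M (G t) > 0 then 1 else - 1 :: int) = (if e > 0 then 1 else - 1)" if "cdet M (G t) * e > 0" for t
    using that by (auto simp: zero_less_mult_iff)
  have coef: "(\<omega>' c > 0 \<longleftrightarrow> cdet M ((G t)(c := w t)) * e > 0)"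
    if t: "cdet M (G t) * e > 0" and \<omega>': "\<And>r. r < M \<Longrightarrow> w t r = (\<Sum>c<M. \<omega>' c * G t c r)" and c: "c < M" for t \<omega>' c
  proof -
    have "cdet M ((G t)(c := w t)) = \<omega>' c * cdet M (G t)" using \<omega>' c by (rule cdet_cramer)
    then have "cdet M ((G t)(c := w t)) * e = \<omega>' c * (cdet M (G t) * e)" by simp
    then show ?thesis using t by (metis mult_pos_pos zero_less_mult_pos2)
  qed
  have Hv: "cone_sign M H v = (if \<forall>c<M. \<omega> c > 0 then (if e > 0 then 1 else -1) else 0)"
    unfolding e_def using H v by (rule cone_sign_eq)
  have Gw: "cone_sign M (G t) (w t) =
      (if \<forall>c<M. cdet M ((G t)(c := w t)) * e > 0 then (if e > 0 then 1 else -1) else 0)"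
    if t: "cdet M (G t) * e > 0" for t
  proof -
    have nz: "cdet M (G t) \<noteq> 0" using t by auto
    obtain \<omega>' where \<omega>': "\<And>r. r < M \<Longrightarrow> w t r = (\<Sum>c<M. \<omega>' c * G t c r)"
      using cdet_solve[OF nz] by blast
    have "cone_sign M (G t) (w t) = (if \<forall>c<M. \<omega>' c > 0 then (if cdet M (G t) > 0 then 1 else -1) else 0)"
      using nz \<omega>' by (rule cone_sign_eq)
    moreover have "(\<forall>c<M. \<omega>' c > 0) \<longleftrightarrow> (\<forall>c<M. cdet M ((G t)(c := w t)) * e > 0)"
      using coef[OF t \<omega>'] by blast
    ultimately show ?thesis using sgn[OF t] by simp
  qed
  from \<omega> show ?thesis
  proof
    assume pos: "\<forall>c<M. \<omega> c > 0"
    have "eventually (\<lambda>t. \<forall>c\<in>{..<M}. cdet M ((G t)(c := w t)) * e > 0) F"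
    proof (intro eventually_ball_finite ballI)
      fix c assume "c \<in> {..<M}"
      then show "eventually (\<lambda>t. cdet M ((G t)(c := w t)) * e > 0) F"
        using order_tendstoD(1)[OF detGw[of c], of 0] pos e0 by simp
    qed simp
    with ev1 show ?thesis
      by eventually_elim (use Gw Hv pos in auto)
  next
    assume "\<exists>c<M. \<omega> c < 0"
    then obtain c where c: "c < M" "\<omega> c < 0" by blast
    have "\<omega> c * (e * e) < 0" using c(2) e0 by (rule mult_neg_pos)
    then have "eventually (\<lambda>t. cdet M ((G t)(c := w t)) * e < 0) F"
      by (rule order_tendstoD(2)[OF detGw[OF c(1)]])
    with ev1 show ?thesis
    proof eventually_elim
      case (elim t)
      then have "\<not> (\<forall>c<M. cdet M ((G t)(c := w t)) * e > 0)" using c(1) by (metis less_asym)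
      moreover have "\<not> (\<forall>c<M. \<omega> c > 0)" using c by (metis less_asym)
      ultimately show ?case using Gw[OF elim(1)] Hv by simp
    qed
  qed
qed

context chessboard
begin

text \<open>\<open>\<pi> c\<close> is the number, in a fixed family of \<open>B\<close> points, of the point at which column \<open>c\<close> sits.\<close>
definition placed :: "(nat \<Rightarrow> nat) \<Rightarrow> nat \<Rightarrow> bool" where
  "placed \<pi> B \<longleftrightarrow> inj_on \<pi> {..<M} \<and> \<pi> ` {..<M} \<subseteq> {..<B}"

lemma placed_update: "placed \<pi> B \<Longrightarrow> e < B \<Longrightarrow> e \<notin> \<pi> ` {..<M} \<Longrightarrow> placed (\<pi>(i := e)) B"
  unfolding placed_def by (auto intro: inj_on_fun_updI)

lemma placed_cdet:
  assumes "in_general_position x B" "placed \<pi> B" "\<And>i. i < M \<Longrightarrow> k i \<le> n"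
  shows "cdet M (\<lambda>i. shift (k i) (x (\<pi> i))) \<noteq> 0"
  using assms unfolding in_general_position_def placed_def by blast

lemma placed_cdet_update:
  assumes "in_general_position x B" "placed \<pi> B" "\<And>i. i < M \<Longrightarrow> k i \<le> n"
    and "e < B" "e \<notin> \<pi> ` {..<M}" "k' \<le> n"
  shows "cdet M ((\<lambda>i. shift (k i) (x (\<pi> i)))(c := shift k' (x e))) \<noteq> 0"
proof -
  have "(\<lambda>i. shift (k i) (x (\<pi> i)))(c := shift k' (x e)) = (\<lambda>i. shift ((k(c := k')) i) (x ((\<pi>(c := e)) i)))"
    by auto
  then show ?thesis
    using placed_cdet[OF assms(1) placed_update[OF assms(2,4,5)], of "k(c := k')"] assms(3,6) by simp
qed

lemma placed_cdet_update2:
  assumes "in_general_position x B" "placed \<pi> B" "\<And>i. i < M \<Longrightarrow> k i \<le> n"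
    and "e < B" "e \<notin> \<pi> ` {..<M}" "k' \<le> n" "d < B" "d \<notin> \<pi> ` {..<M}" "e \<noteq> d"
  shows "cdet M ((\<lambda>i. shift (k i) (x (\<pi> i)))(c := shift k' (x e), c' := x d)) \<noteq> 0"
proof -
  have eq: "(\<lambda>i. shift (k i) (x (\<pi> i)))(c := shift k' (x e)) = (\<lambda>i. shift ((k(c := k')) i) (x ((\<pi>(c := e)) i)))"
    by auto
  have "d \<notin> (\<pi>(c := e)) ` {..<M}" using assms(8,9) by auto
  from placed_cdet_update[OF assms(1) placed_update[OF assms(2,4,5)] _ assms(7) this le0, of "k(c := k')"]
  show ?thesis unfolding eq using assms(3,6) by simp
qed

lemma degree_sum_negated_target:
  assumes gp: "in_general_position x B" and \<pi>: "placed \<pi> B"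
    and d: "d < B" "d \<notin> \<pi> ` {..<M}" and e: "e < B" "e \<notin> \<pi> ` {..<M}" "e \<noteq> d"
  shows "degree_sum (\<lambda>c k. shift k (x (\<pi> c))) (x d) =
    (\<Sum>F\<in>facets. facet_sign F * cone_sign M (\<lambda>c. shift (label F c) (x (\<pi> c))) (\<lambda>r. - x e r))"
proof -
  have "degree_sum (\<lambda>c k. shift k (x (\<pi> c))) (x d) - (\<Sum>F\<in>facets. if M < M then
        facet_sign F * cone_sign M ((\<lambda>c. shift (label F c) (x (\<pi> c)))(M := x e)) (x d) else 0) =
    (\<Sum>F\<in>facets. facet_sign F * cone_sign M (\<lambda>c. shift (label F c) (x (\<pi> c))) (\<lambda>r. - x e r))"
  proof (rule degree_sum_exchange)
    fix F assume F: "F \<in> facets"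
    note lab = label_le[OF F]
    show "cdet M (\<lambda>c. shift (label F c) (x (\<pi> c))) \<noteq> 0"
      by (rule placed_cdet[OF gp \<pi> lab])
    show "cdet M ((\<lambda>c. shift (label F c) (x (\<pi> c)))(i := x e)) \<noteq> 0" for i
      using placed_cdet_update[OF gp \<pi> lab e(1,2) le0] by simp
    show "cdet M ((\<lambda>c. shift (label F c) (x (\<pi> c)))(i := x d)) \<noteq> 0" for i
      using placed_cdet_update[OF gp \<pi> lab d le0] by simp
    show "cdet M ((\<lambda>c. shift (label F c) (x (\<pi> c)))(i := x e, j := x d)) \<noteq> 0" for i j
      using placed_cdet_update2[OF gp \<pi> lab e(1,2) le0 d e(3)] by simp
  qed auto
  then show ?thesis by simp
qed

text \<open>Both degrees equal the one on the ray opposite to a third point \<open>x e\<close>.\<close>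
lemma degree_sum_target_independent:
  assumes gp: "in_general_position x B" and \<pi>: "placed \<pi> B"
    and "d < B" "d \<notin> \<pi> ` {..<M}" "d' < B" "d' \<notin> \<pi> ` {..<M}" "e < B" "e \<notin> \<pi> ` {..<M}" "e \<noteq> d" "e \<noteq> d'"
  shows "degree_sum (\<lambda>c k. shift k (x (\<pi> c))) (x d) = degree_sum (\<lambda>c k. shift k (x (\<pi> c))) (x d')"
  using degree_sum_negated_target[OF gp \<pi> assms(3,4,7,8,9)]
    degree_sum_negated_target[OF gp \<pi> assms(5,6,7,8,10)] by simp

text \<open>The degree changes by the number of facets such that the segment from the old to the new
  position of column \<open>a\<close> makes them sweep over the origin. By the cyclic symmetry this is a multiple of
  \<open>p\<close>.\<close>
lemma degree_sum_move_point:
  assumes gp: "in_general_position x B" and \<pi>: "placed \<pi> B" and a: "a < M"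
    and d: "d < B" "d \<notin> \<pi> ` {..<M}" and e: "e < B" "e \<notin> \<pi> ` {..<M}" "e \<noteq> d"
  shows "int p dvd degree_sum (\<lambda>c k. shift k (x (\<pi> c))) (x d)
      - degree_sum (\<lambda>c k. shift k (x ((\<pi>(a := e)) c))) (x d)"
proof -
  let ?v = "\<lambda>F. shift (label F a) (x e)"
  let ?H = "\<lambda>F. facet_sign F * cone_sign M (\<lambda>c. shift (label F c) (x (\<pi> c))) (\<lambda>r. - ?v F r)"
  have "degree_sum (\<lambda>c k. shift k (x (\<pi> c))) (x d) - (\<Sum>F\<in>facets. if a < M then
        facet_sign F * cone_sign M ((\<lambda>c. shift (label F c) (x (\<pi> c)))(a := ?v F)) (x d) else 0) =
    (\<Sum>F\<in>facets. ?H F)"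
  proof (rule degree_sum_exchange)
    fix F assume F: "F \<in> facets"
    note lab = label_le[OF F]
    show "shift (label (flip c F) a) (x e) = ?v F" if "c < M" "c \<noteq> a" for c
      using label_flip[of a c F] a that by simp
    show "cdet M (\<lambda>c. shift (label F c) (x (\<pi> c))) \<noteq> 0"
      by (rule placed_cdet[OF gp \<pi> lab])
    show "cdet M ((\<lambda>c. shift (label F c) (x (\<pi> c)))(i := ?v F)) \<noteq> 0" for i
      by (rule placed_cdet_update[OF gp \<pi> lab e(1,2) lab[OF a]])
    show "cdet M ((\<lambda>c. shift (label F c) (x (\<pi> c)))(i := x d)) \<noteq> 0" for i
      using placed_cdet_update[OF gp \<pi> lab d le0] by simp
    show "cdet M ((\<lambda>c. shift (label F c) (x (\<pi> c)))(i := ?v F, j := x d)) \<noteq> 0" for i j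
      by (rule placed_cdet_update2[OF gp \<pi> lab e(1,2) lab[OF a] d e(3)])
  qed
  moreover have "(\<Sum>F\<in>facets. if a < M then
        facet_sign F * cone_sign M ((\<lambda>c. shift (label F c) (x (\<pi> c)))(a := ?v F)) (x d) else 0)
      = degree_sum (\<lambda>c k. shift k (x ((\<pi>(a := e)) c))) (x d)"
    unfolding degree_sum_def
  proof (rule sum.cong[OF refl])
    fix F
    have "(\<lambda>c. shift (label F c) (x (\<pi> c)))(a := ?v F) = (\<lambda>c. shift (label F c) (x ((\<pi>(a := e)) c)))"
      by auto
    then show "(if a < M then facet_sign F * cone_sign M ((\<lambda>c. shift (label F c) (x (\<pi> c)))(a := ?v F)) (x d) else 0)
        = facet_sign F * cone_sign M (\<lambda>c. shift (label F c) (x ((\<pi>(a := e)) c))) (x d)"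
      using a by simp
  qed
  moreover have "int p dvd (\<Sum>F\<in>facets. ?H F)"
  proof (rule rot_invariant_sum_dvd[OF a])
    fix F assume F: "F \<in> facets"
    have "cone_sign M (\<lambda>c. shift (label (rot F) c) (x (\<pi> c))) (\<lambda>r. - ?v (rot F) r)
        = cone_sign M (\<lambda>c. shift 1 (shift (label F c) (x (\<pi> c)))) (shift 1 (\<lambda>r. - ?v F r))"
      using label_le[OF F] a by (intro cone_sign_cong) (auto simp: label_rot shift_cyc shift_minus)
    also have "\<dots> = cone_sign M (\<lambda>c. shift (label F c) (x (\<pi> c))) (\<lambda>r. - ?v F r)"
      by (rule cone_sign_shift)
    finally show "?H (rot F) = ?H F" using facet_sign_rot[OF F] by simp
  qed
  ultimately show ?thesis by simp
qed

text \<open>The tensor product of \<open>v\<close> and the first unit vector of \<open>\<real>^p\<close>. Its shift by \<open>k\<close> corresponds to giving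
  the point \<open>v\<close> the label \<open>k\<close>.\<close>
definition column :: "(nat \<Rightarrow> real) \<Rightarrow> nat \<Rightarrow> real" where
  "column v r = (if r mod n = 0 then v (r div n) else 0)"

text \<open>All points of a colour sit at the first unit vector of the copy that belongs to the colour. Then a
  facet is a product of facets of simplices around the origin, and the ray through the vector
  \<open>(1, ..., 1)\<close> meets it if and only if each colour misses the label \<open>1\<close>.\<close>
definition special :: "nat \<Rightarrow> nat \<Rightarrow> real" where
  "special c = column (\<lambda>i. of_bool (i = c div n))"

abbreviation "special_facet \<equiv> \<lambda>F c. shift (label F c) (special c)"

definition good :: "(nat \<Rightarrow> nat \<Rightarrow> nat) \<Rightarrow> bool" where
  "good F \<longleftrightarrow> F \<in> facets \<and> (\<forall>i<q. F i n = 1)"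

lemma index_less: "i < q \<Longrightarrow> j < n \<Longrightarrow> i * n + j < M"
proof -
  assume "i < q" "j < n"
  then have "i * n + j < Suc i * n" by simp
  also have "\<dots> \<le> q * n" using \<open>i < q\<close> by (intro mult_right_mono) auto
  finally show ?thesis .
qed

lemma index_div_mod [simp]: "j < n \<Longrightarrow> (i * n + j) div n = i" "j < n \<Longrightarrow> (i * n + j) mod n = j"
  by auto

lemma coord_column: "s \<le> n \<Longrightarrow> coord (column v) i s = (if s = 0 then v i else 0)"
  using n_pos by (cases "s < n") (auto simp: coord_def column_def)

lemma shift_column:
  assumes "s < n" "k \<le> n"
  shows "shift k (column v) (i * n + s) = v i * (of_bool (k = (p - s) mod p) - of_bool (k = 1))"
proof -
  have le: "m mod p \<le> n" for m using mod_less_divisor[of p m] by simp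
  have 1: "(s + k) mod p = 0 \<longleftrightarrow> k = (p - s) mod p"
  proof (cases "s = 0")
    case True then show ?thesis using assms(2) by simp
  next
    case False
    then have "(p - s) mod p = p - s" by simp
    moreover have "(s + k) mod p = 0 \<longleftrightarrow> s + k = p"
      using assms False by (auto simp: mod_if)
    ultimately show ?thesis using assms by auto
  qed
  have 2: "(n + k) mod p = 0 \<longleftrightarrow> k = 1"
    using assms(2) n_pos by (auto simp: mod_if)
  show ?thesis
    unfolding shift_def index_div_mod[OF assms(1)] coord_column[OF le] using 1 2 by auto
qed

lemma shift_special:
  assumes "s < n" "k \<le> n"
  shows "shift k (special c) (i * n + s) =
    (if i = c div n then of_bool (k = (p - s) mod p) - of_bool (k = 1) else 0)"
  unfolding special_def shift_column[OF assms] by simp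

lemma facet_bij: "F \<in> facets \<Longrightarrow> i < q \<Longrightarrow> k \<le> n \<Longrightarrow> \<exists>j\<le>n. F i j = k"
  using permutes_image[OF facets_permutes, of F i] by (metis atMost_iff imageE)

lemma facet_inj: "F \<in> facets \<Longrightarrow> i < q \<Longrightarrow> F i j = F i j' \<Longrightarrow> j = j'"
  using permutes_inj[OF facets_permutes, of F i] by (simp add: inj_eq)

definition weight :: "(nat \<Rightarrow> nat \<Rightarrow> nat) \<Rightarrow> (nat \<Rightarrow> real) \<Rightarrow> nat \<Rightarrow> nat \<Rightarrow> real" where
  "weight F \<omega> i k = (\<Sum>j<n. \<omega> (i * n + j) * of_bool (F i j = k))"

lemma weight_label:
  assumes "F \<in> facets" "i < q" "j < n" shows "weight F \<omega> i (F i j) = \<omega> (i * n + j)"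
proof -
  have "weight F \<omega> i (F i j) = (\<Sum>j'<n. if j' = j then \<omega> (i * n + j') else 0)"
    unfolding weight_def by (rule sum.cong) (use facet_inj[OF assms(1,2)] in auto)
  then show ?thesis using assms(3) by simp
qed

lemma weight_missing:
  assumes "F \<in> facets" "i < q" shows "weight F \<omega> i (F i n) = 0"
  unfolding weight_def by (rule sum.neutral) (use facet_inj[OF assms] in auto)

lemma special_row:
  assumes F: "F \<in> facets" and i: "i < q" and s: "s < n"
  shows "(\<Sum>c<M. \<omega> c * special_facet F c (i * n + s)) = weight F \<omega> i ((p - s) mod p) - weight F \<omega> i 1"
proof -
  have "(\<Sum>c<M. \<omega> c * special_facet F c (i * n + s)) =
      (\<Sum>c\<in>{c. c < M \<and> c div n = i}. \<omega> c * (of_bool (label F c = (p - s) mod p) - of_bool (label F c = 1)))"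
    by (intro sum.mono_neutral_cong_right) (auto simp: shift_special[OF s label_le[OF F]])
  also have "\<dots> = (\<Sum>j<n. \<omega> (i * n + j) * (of_bool (F i j = (p - s) mod p) - of_bool (F i j = 1)))"
  proof (rule sum.reindex_bij_witness[of _ "\<lambda>j. i * n + j" "\<lambda>c. c mod n"])
    fix c assume c: "c \<in> {c. c < M \<and> c div n = i}"
    then show "i * n + c mod n = c" by auto
    show "c mod n \<in> {..<n}" using n_pos by simp
    show "\<omega> (i * n + c mod n) * (of_bool (F i (c mod n) = (p - s) mod p) - of_bool (F i (c mod n) = 1)) =
       \<omega> c * (of_bool (label F c = (p - s) mod p) - of_bool (label F c = 1))"
      using c \<open>i * n + c mod n = c\<close> by (auto simp: label_def)
  qed (use i index_less in auto)
  finally show ?thesis by (simp add: weight_def right_diff_distrib sum_subtractf)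
qed

lemma label_reached:
  assumes "k \<le> n" "k \<noteq> 1" obtains s where "s < n" "(p - s) mod p = k"
proof (cases "k = 0")
  case True then show thesis using that[of 0] n_pos by simp
next
  case False then show thesis using that[of "p - k"] assms by simp
qed

lemma special_facet_independent:
  assumes F: "F \<in> facets" shows "cdet M (special_facet F) \<noteq> 0"
proof
  assume "cdet M (special_facet F) = 0"
  then obtain \<omega> c where c: "c < M" "\<omega> c \<noteq> 0"
    and \<omega>: "\<And>r. r < M \<Longrightarrow> (\<Sum>c<M. \<omega> c * special_facet F c r) = 0"
    unfolding cdet_eq_0_iff by auto
  let ?i = "c div n"
  have i: "?i < q" using c(1) by (rule colour_less)
  have eq: "weight F \<omega> ?i k = weight F \<omega> ?i 1" if k: "k \<le> n" for k
  proof (cases "k = 1")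
    case False
    with k obtain s where s: "s < n" "(p - s) mod p = k" by (rule label_reached)
    show ?thesis using special_row[OF F i s(1), of \<omega>] \<omega>[OF index_less[OF i s(1)]] s(2) by simp
  qed simp
  have "F ?i n \<le> n" using facets_permutes[OF F i] permutes_in_image[of "F ?i" "{..n}" n] by simp
  then have "weight F \<omega> ?i 1 = 0" using eq weight_missing[OF F i] by metis
  moreover have "weight F \<omega> ?i (label F c) = \<omega> c"
    using weight_label[OF F i, of "c mod n" \<omega>] n_pos by (simp add: label_def)
  ultimately show False using eq[OF label_le[OF F c(1)]] c(2) by simp
qed

lemma special_bad:
  assumes F: "F \<in> facets" "\<not> good F" and \<omega>: "\<And>r. r < M \<Longrightarrow> 1 = (\<Sum>c<M. \<omega> c * special_facet F c r)"
  shows "\<exists>c<M. \<omega> c < 0"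
proof -
  obtain i where i: "i < q" "F i n \<noteq> 1" using F by (auto simp: good_def)
  have "F i n \<le> n" using facets_permutes[OF F(1) i(1)] permutes_in_image[of "F i" "{..n}" n] by simp
  from this i(2) obtain s where s: "s < n" "(p - s) mod p = F i n" by (rule label_reached)
  have "weight F \<omega> i (F i n) - weight F \<omega> i 1 = 1"
    using special_row[OF F(1) i(1) s(1), of \<omega>] \<omega>[OF index_less[OF i(1) s(1)]] s(2) by simp
  then have w: "weight F \<omega> i 1 = -1" using weight_missing[OF F(1) i(1)] by simp
  obtain j where j: "j \<le> n" "F i j = 1" using facet_bij[OF F(1) i(1)] n_pos by (metis One_nat_def Suc_leI)
  have "j < n" using j i(2) by (metis le_neq_implies_less)
  then have "\<omega> (i * n + j) = -1" using weight_label[OF F(1) i(1), of j \<omega>] j(2) w by simp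
  then show ?thesis using index_less[OF i(1) \<open>j < n\<close>] by (intro exI[of _ "i * n + j"]) simp
qed

lemma special_good:
  assumes "good F" and r: "r < M" shows "1 = (\<Sum>c<M. 1 * special_facet F c r)"
proof -
  have F: "F \<in> facets" using assms(1) by (simp add: good_def)
  define i s where "i = r div n" and "s = r mod n"
  have i: "i < q" using r by (simp add: i_def colour_less)
  have s: "s < n" using n_pos by (simp add: s_def)
  have Fn: "F i n = 1" using assms(1) i by (simp add: good_def)
  have k: "(p - s) mod p \<le> n" "(p - s) mod p \<noteq> 1"
    using s mod_less_divisor[of p "p - s"] by (auto simp: mod_if)
  obtain j where j: "j \<le> n" "F i j = (p - s) mod p" using facet_bij[OF F i k(1)] by blast
  have "j < n" using j k(2) Fn by (metis le_neq_implies_less)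
  then have "weight F (\<lambda>_. 1) i ((p - s) mod p) = 1"
    using weight_label[OF F i, of j "\<lambda>_. 1"] j(2) by simp
  moreover have "weight F (\<lambda>_. 1) i 1 = 0" using weight_missing[OF F i, of "\<lambda>_. 1"] Fn by simp
  moreover have "r = i * n + s" by (simp add: i_def s_def)
  ultimately show ?thesis using special_row[OF F i s, of "\<lambda>_. 1"] by simp
qed

end

text \<open>Sequential compactness of a finite power of the unit interval.\<close>
lemma finite_product_convergent_subseq:
  fixes f :: "nat \<Rightarrow> 'a \<Rightarrow> real"
  assumes "finite A" "\<And>m a. a \<in> A \<Longrightarrow> f m a \<in> {0..1}"
  shows "\<exists>r l. strict_mono (r :: nat \<Rightarrow> nat) \<and> (\<forall>a\<in>A. (\<lambda>m. f (r m) a) \<longlonglongrightarrow> l a)"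
  using assms
proof (induction A)
  case empty
  show ?case by (intro exI[of _ id]) (auto simp: strict_mono_def)
next
  case (insert a A)
  have "\<exists>r l. strict_mono (r :: nat \<Rightarrow> nat) \<and> (\<forall>b\<in>A. (\<lambda>m. f (r m) b) \<longlonglongrightarrow> l b)"
    by (rule insert.IH) (rule insert.prems, simp)
  then obtain r l where r: "strict_mono (r :: nat \<Rightarrow> nat)" "\<forall>b\<in>A. (\<lambda>m. f (r m) b) \<longlonglongrightarrow> l b"
    by blast
  have "\<forall>m. f (r m) a \<in> {0..1}" using insert.prems by simp
  then obtain la s where "la \<in> {0..1}"
    and s: "strict_mono (s :: nat \<Rightarrow> nat)" "((\<lambda>m. f (r m) a) \<circ> s) \<longlonglongrightarrow> la"
    by (rule seq_compactE[OF compact_imp_seq_compact[OF compact_Icc[of "0 :: real" 1]]])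
  have lim: "(\<lambda>m. f ((r \<circ> s) m) b) \<longlonglongrightarrow> (if b = a then la else l b)" if "b \<in> insert a A" for b
  proof (cases "b = a")
    case True then show ?thesis using s(2) by (simp add: o_def)
  next
    case False
    then show ?thesis using LIMSEQ_subseq_LIMSEQ[OF r(2)[rule_format] s(1), of b] that by (simp add: o_def)
  qed
  show ?case
  proof (intro exI conjI ballI)
    show "strict_mono (r \<circ> s)" using r(1) s(1) by (rule strict_mono_o)
    show "(\<lambda>m. f ((r \<circ> s) m) b) \<longlonglongrightarrow> (if b = a then la else l b)" if "b \<in> insert a A" for b
      using that by (rule lim)
  qed
qed

context chessboard
begin

definition signed_volume :: "(nat \<Rightarrow> nat \<Rightarrow> nat) \<Rightarrow> int" where
  "signed_volume F = facet_sign F * cone_sign M (special_facet F) (\<lambda>_. 1)"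

lemma signed_volume_good:
  assumes "good F"
  shows "signed_volume F = facet_sign F * (if cdet M (special_facet F) > 0 then 1 else -1)"
proof -
  have F: "F \<in> facets" using assms by (simp add: good_def)
  show ?thesis
    unfolding signed_volume_def
    using cone_sign_eq[OF special_facet_independent[OF F] special_good[OF assms]] by simp
qed

lemma signed_volume_bad:
  assumes F: "F \<in> facets" "\<not> good F" shows "signed_volume F = 0"
proof -
  obtain \<omega> where \<omega>: "\<And>r. r < M \<Longrightarrow> 1 = (\<Sum>c<M. \<omega> c * special_facet F c r)"
    using cdet_solve[OF special_facet_independent[OF F(1)], of "\<lambda>_. 1"] by blast
  have neg: "\<not> (\<forall>c<M. \<omega> c > 0)" using special_bad[OF F \<omega>] by (meson less_asym)
  have "cone_sign M (special_facet F) (\<lambda>_. 1) =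
      (if \<forall>c<M. \<omega> c > 0 then (if cdet M (special_facet F) > 0 then 1 else -1) else 0)"
    using special_facet_independent[OF F(1)] \<omega> by (rule cone_sign_eq)
  then show ?thesis
    unfolding signed_volume_def if_not_P[OF neg] by simp
qed

text \<open>The points of a colour sit at the same place, so exchanging the labels of two of them exchanges
  two columns. This changes the sign of the determinant as well as the sign of the permutation.\<close>
lemma signed_volume_swap:
  assumes "good F" "i < q" "j < n" "j' < n"
  shows "good (F(i := F i \<circ> Transposition.transpose j j'))"
    "signed_volume (F(i := F i \<circ> Transposition.transpose j j')) = signed_volume F"
proof -
  let ?F' = "F(i := F i \<circ> Transposition.transpose j j')"
  have F: "F \<in> facets" using assms(1) by (simp add: good_def)
  have perm: "F i \<circ> Transposition.transpose j j' permutes {..n}"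
    using facets_permutes[OF F assms(2)] assms(3,4) by (intro permutes_compose permutes_swap_id) auto
  have F': "?F' \<in> facets"
    using F perm assms(2) unfolding facets_def by (intro PiE_I) (auto simp: PiE_iff extensional_def)
  show good: "good ?F'"
    unfolding good_def using F' assms by (auto simp: good_def)
  show "signed_volume ?F' = signed_volume F"
  proof (cases "j = j'")
    case True then show ?thesis by simp
  next
    case False
    let ?k = "i * n + j" and ?l = "i * n + j'"
    have kl: "?k < M" "?l < M" "?k \<noteq> ?l" using assms index_less False by auto
    have fs: "facet_sign ?F' = - facet_sign F"
    proof -
      have i: "i \<in> {..<q}" using assms(2) by simp
      have "permutation (F i)" using facets_permutes[OF F assms(2)] by (auto simp: permutation_permutes)
      then have "sign (F i \<circ> Transposition.transpose j j') = - sign (F i)"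
        using False by (simp add: sign_compose permutation_swap_id sign_swap_id)
      moreover have "(\<Prod>m\<in>{..<q} - {i}. sign (?F' m)) = (\<Prod>m\<in>{..<q} - {i}. sign (F m))"
        by (rule prod.cong) auto
      ultimately show ?thesis
        unfolding facet_sign_def by (subst (1 2) prod.remove[OF _ i]) auto
    qed
    have sp: "special ?k = special ?l" using assms(3,4) by (simp add: special_def)
    have "special_facet ?F' c = ((special_facet F)(?k := special_facet F ?l, ?l := special_facet F ?k)) c" for c
    proof -
      consider "c = ?k" | "c = ?l" | "c div n \<noteq> i" | "c div n = i" "c mod n \<noteq> j" "c mod n \<noteq> j'"
        using assms by (metis div_mult_mod_eq)
      then show ?thesis
      proof cases
        case 1 then show ?thesis using kl sp assms by (simp add: label_def)
      next
        case 2 then show ?thesis using kl sp assms by (simp add: label_def)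
      next
        case 3 then show ?thesis using assms by (auto simp: label_def)
      next
        case 4
        then have "c \<noteq> ?k" "c \<noteq> ?l" using index_div_mod(2) assms(3,4) by metis+
        then show ?thesis using 4 by (simp add: label_def)
      qed
    qed
    then have "special_facet ?F' = (special_facet F)(?k := special_facet F ?l, ?l := special_facet F ?k)" by blast
    then have "cdet M (special_facet ?F') = - cdet M (special_facet F)"
      using cdet_swap[OF kl, of "special_facet F"] by simp
    then show ?thesis
      unfolding signed_volume_good[OF assms(1)] signed_volume_good[OF good] fs
      using special_facet_independent[OF F] by auto
  qed
qed

lemma signed_volume_permute:
  assumes "\<sigma> permutes {..<n}" "good F" "i < q"
  shows "good (F(i := F i \<circ> \<sigma>)) \<and> signed_volume (F(i := F i \<circ> \<sigma>)) = signed_volume F"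
  using finite_lessThan[of n] assms(1)
proof (induction \<sigma> rule: permutes_rev_induct)
  case id
  then show ?case using assms(2) by simp
next
  case (swap a b \<sigma>)
  let ?F = "F(i := F i \<circ> \<sigma>)"
  have "F(i := F i \<circ> (\<sigma> \<circ> Transposition.transpose a b)) = ?F(i := ?F i \<circ> Transposition.transpose a b)"
    by (simp add: comp_assoc)
  moreover have "good (?F(i := ?F i \<circ> Transposition.transpose a b))"
    "signed_volume (?F(i := ?F i \<circ> Transposition.transpose a b)) = signed_volume ?F"
    using signed_volume_swap[of ?F i a b] swap assms(3) by blast+
  ultimately show ?case using swap by metis
qed

definition base_facet :: "nat \<Rightarrow> nat \<Rightarrow> nat" where
  "base_facet = (\<lambda>i\<in>{..<q}. Transposition.transpose 1 n)"

lemma base_permutes: "Transposition.transpose 1 n permutes {..n}"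
  using n_pos by (intro permutes_swap_id) auto

lemma good_base: "good base_facet"
  using base_permutes by (auto simp: good_def base_facet_def facets_def)

lemma base_factor:
  assumes "\<phi> permutes {..n}" "\<phi> n = 1"
  obtains \<sigma> where "\<sigma> permutes {..<n}" "\<phi> = Transposition.transpose 1 n \<circ> \<sigma>"
proof
  let ?\<sigma> = "Transposition.transpose 1 n \<circ> \<phi>"
  have p: "?\<sigma> permutes {..n}" using assms(1) base_permutes by (rule permutes_compose)
  have "?\<sigma> n = n" using assms(2) by simp
  then have "?\<sigma> x = x" if "x \<in> {..n} - {..<n}" for x using that by (auto simp: not_less dest: le_antisym)
  with p show "?\<sigma> permutes {..<n}" by (rule permutes_superset)
  show "\<phi> = Transposition.transpose 1 n \<circ> ?\<sigma>" by (simp add: comp_assoc[symmetric])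
qed

text \<open>The colours are changed one after another, each by a product of transpositions.\<close>
lemma signed_volume_const:
  assumes "good F" shows "signed_volume F = signed_volume base_facet"
proof -
  define H where "H m = (\<lambda>i\<in>{..<q}. if i < m then F i else base_facet i)" for m
  have FE: "F \<in> facets" using assms by (simp add: good_def)
  have "good (H m) \<and> signed_volume (H m) = signed_volume base_facet" if "m \<le> q" for m
    using that
  proof (induction m)
    case 0
    have "H 0 = base_facet" by (auto simp: H_def base_facet_def)
    then show ?case using good_base by simp
  next
    case (Suc m)
    then have m: "m < q" and IH: "good (H m)" "signed_volume (H m) = signed_volume base_facet" by auto
    have "F m permutes {..n}" "F m n = 1" using facets_permutes[OF FE m] assms m by (auto simp: good_def)
    then obtain \<sigma> where \<sigma>: "\<sigma> permutes {..<n}" "F m = Transposition.transpose 1 n \<circ> \<sigma>" by (rule base_factor)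
    have "H (Suc m) = (H m)(m := H m m \<circ> \<sigma>)"
      using m \<sigma>(2) by (auto simp: H_def base_facet_def fun_eq_iff less_Suc_eq)
    then show ?case using signed_volume_permute[OF \<sigma>(1) IH(1) m] IH(2) by (simp only: simp_thms)
  qed
  moreover have "H q = F" using FE by (auto simp: H_def facets_def PiE_iff extensional_def)
  ultimately show ?thesis by (metis order_refl)
qed

lemma card_good: "card {F. good F} = fact n ^ q"
proof -
  have eq: "{F. good F} = PiE {..<q} (\<lambda>_. {\<phi>. \<phi> permutes {..n} \<and> \<phi> n = 1})"
  proof (rule Set.set_eqI)
    fix F
    show "F \<in> {F. good F} \<longleftrightarrow> F \<in> PiE {..<q} (\<lambda>_. {\<phi>. \<phi> permutes {..n} \<and> \<phi> n = 1})"
      unfolding mem_Collect_eq good_def facets_def PiE_iff lessThan_iff by blast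
  qed
  have "{\<phi>. \<phi> permutes {..n} \<and> \<phi> n = 1} = (\<lambda>\<sigma>. Transposition.transpose 1 n \<circ> \<sigma>) ` {\<sigma>. \<sigma> permutes {..<n}}"
  proof (intro Set.set_eqI iffI)
    fix \<phi> assume "\<phi> \<in> {\<phi>. \<phi> permutes {..n} \<and> \<phi> n = 1}"
    then show "\<phi> \<in> (\<lambda>\<sigma>. Transposition.transpose 1 n \<circ> \<sigma>) ` {\<sigma>. \<sigma> permutes {..<n}}"
      using base_factor[of \<phi>] by blast
  next
    fix \<phi> assume "\<phi> \<in> (\<lambda>\<sigma>. Transposition.transpose 1 n \<circ> \<sigma>) ` {\<sigma>. \<sigma> permutes {..<n}}"
    then obtain \<sigma> where \<sigma>: "\<sigma> permutes {..<n}" "\<phi> = Transposition.transpose 1 n \<circ> \<sigma>" by blast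
    have "\<sigma> permutes {..n}" using \<sigma>(1) by (rule permutes_subset) auto
    then have "\<phi> permutes {..n}" unfolding \<sigma>(2) using base_permutes by (rule permutes_compose)
    moreover have "\<sigma> n = n" using \<sigma>(1) by (simp add: permutes_def)
    ultimately show "\<phi> \<in> {\<phi>. \<phi> permutes {..n} \<and> \<phi> n = 1}" using \<sigma>(2) by simp
  qed
  moreover have "inj_on (\<lambda>\<sigma>. Transposition.transpose 1 n \<circ> \<sigma>) {\<sigma>. \<sigma> permutes {..<n}}"
    by (rule inj_onI) (metis comp_assoc transpose_comp_involutory id_comp)
  ultimately have "card {\<phi>. \<phi> permutes {..n} \<and> \<phi> n = 1} = fact n"
    by (simp add: card_image card_permutations)
  then show ?thesis unfolding eq by (simp add: card_PiE)
qed

text \<open>The degree of the special map is \<open>\<plusminus> (n!)^q\<close>.\<close>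
lemma special_degree_not_dvd:
  assumes "prime p" shows "\<not> int p dvd (\<Sum>F\<in>facets. signed_volume F)"
proof -
  have "(\<Sum>F\<in>facets. signed_volume F) = (\<Sum>F\<in>{F. good F}. signed_volume base_facet)"
    by (rule sum.mono_neutral_cong_right)
       (use finite_facets signed_volume_bad signed_volume_const in \<open>auto simp: good_def\<close>)
  also have "\<dots> = int (fact n ^ q) * signed_volume base_facet" by (simp add: card_good)
  finally have S: "(\<Sum>F\<in>facets. signed_volume F) = int (fact n ^ q) * signed_volume base_facet" .
  have "\<bar>facet_sign base_facet\<bar> = 1" unfolding facet_sign_def abs_prod by (rule prod.neutral) (simp add: sign_def)
  then have "\<bar>signed_volume base_facet\<bar> = 1"
    unfolding signed_volume_good[OF good_base] by (simp add: abs_mult)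
  then have "int p dvd int (fact n ^ q) * signed_volume base_facet \<longleftrightarrow> int p dvd int (fact n ^ q)"
    by (auto simp: abs_if split: if_splits)
  also have "\<dots> \<longleftrightarrow> p dvd fact n ^ q" by (rule int_dvd_int_iff)
  also have "\<not> \<dots>"
  proof
    assume "p dvd fact n ^ q"
    then have "p dvd fact n" using assms prime_dvd_power by blast
    then show False using assms by (simp add: prime_dvd_fact_iff)
  qed
  finally show ?thesis using S by simp
qed

text \<open>Points \<open>0, ..., M - 1\<close> of the family are close to the special positions and points
  \<open>M, ..., 2 M - 1\<close> are the positions of interest. Points \<open>2 M\<close> and \<open>2 M + 1\<close> span the two rays on which
  the degree is counted, and point \<open>2 M + 2\<close> serves to compare these rays. The columns are moved
  from the special positions one at a time.\<close>
lemma generic_cone_hit: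
  assumes gp: "in_general_position x (2 * M + 3)" and prime: "prime p"
    and sp: "\<And>F. F \<in> facets \<Longrightarrow> cone_sign M (\<lambda>c. shift (label F c) (x c)) (x (2 * M)) =
      cone_sign M (special_facet F) (\<lambda>_. 1)"
  shows "\<exists>F\<in>facets. \<exists>\<omega>. (\<forall>c<M. \<omega> c > 0) \<and>
      (\<forall>r<M. x (2 * M + 1) r = (\<Sum>c<M. \<omega> c * shift (label F c) (x (M + c)) r))"
proof -
  define \<pi> where "\<pi> j c = (if c < j then M + c else c)" for j c
  have less: "\<pi> j c < 2 * M" if "c < M" for j c using that by (auto simp: \<pi>_def mult.commute)
  have pl: "placed (\<pi> j) (2 * M + 3)" for j
    unfolding placed_def
  proof (intro conjI inj_onI subsetI)
    fix c c' assume "c \<in> {..<M}" "c' \<in> {..<M}" "\<pi> j c = \<pi> j c'"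
    then show "c = c'" by (auto simp: \<pi>_def split: if_splits)
  next
    fix b assume "b \<in> \<pi> j ` {..<M}"
    then obtain c where "c < M" "b = \<pi> j c" by auto
    then show "b \<in> {..<2 * M + 3}" using less[of c j] by (simp del: mult_Suc)
  qed
  have notin: "2 * M + e \<notin> \<pi> j ` {..<M}" for e j
  proof
    assume "2 * M + e \<in> \<pi> j ` {..<M}"
    then obtain c where "c < M" "2 * M + e = \<pi> j c" by (auto simp del: mult_2)
    with less[of c j] show False by linarith
  qed
  define D where "D j = degree_sum (\<lambda>c k. shift k (x (\<pi> j c))) (x (2 * M + 1))" for j
  have "degree_sum (\<lambda>c k. shift k (x (\<pi> 0 c))) (x (2 * M + 0)) = (\<Sum>F\<in>facets. signed_volume F)"
    unfolding degree_sum_def signed_volume_def by (rule sum.cong) (auto simp: \<pi>_def sp)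
  moreover have "degree_sum (\<lambda>c k. shift k (x (\<pi> 0 c))) (x (2 * M + 0)) = D 0"
    unfolding D_def
    by (rule degree_sum_target_independent[where B = "2 * M + 3" and d = "2 * M + 0"
          and d' = "2 * M + 1" and e = "2 * M + 2"]) ((rule gp pl notin | simp)+)
  ultimately have D0: "\<not> int p dvd D 0" using special_degree_not_dvd[OF prime] by simp
  have "int p dvd D 0 - D j" if "j \<le> M" for j
    using that
  proof (induction j)
    case (Suc j)
    then have j: "j < M" by simp
    have upd: "(\<pi> j)(j := M + j) = \<pi> (Suc j)" by (auto simp: \<pi>_def fun_eq_iff)
    have "M + j \<notin> \<pi> j ` {..<M}" using j by (auto simp: \<pi>_def)
    moreover have "M + j < 2 * M + 3" "M + j \<noteq> 2 * M + 1" "2 * M + 1 < 2 * M + 3" using j by linarith+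
    ultimately have "int p dvd D j - degree_sum (\<lambda>c k. shift k (x (((\<pi> j)(j := M + j)) c))) (x (2 * M + 1))"
      unfolding D_def using notin by (intro degree_sum_move_point[OF gp pl j])
    then have "int p dvd D j - D (Suc j)" unfolding upd D_def .
    then have "int p dvd (D 0 - D j) + (D j - D (Suc j))" using Suc by (intro dvd_add) auto
    then show ?case by simp
  qed simp
  then have "D M \<noteq> 0" using D0 by (metis diff_zero order_refl)
  then obtain F where F: "F \<in> facets" "cone_sign M (\<lambda>c. shift (label F c) (x (\<pi> M c))) (x (2 * M + 1)) \<noteq> 0"
    unfolding D_def degree_sum_def by (metis (no_types, lifting) mult_zero_right sum.neutral)
  then obtain \<omega> where \<omega>: "\<forall>c<M. \<omega> c > 0"
      "\<forall>r<M. x (2 * M + 1) r = (\<Sum>c<M. \<omega> c * shift (label F c) (x (\<pi> M c)) r)"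
    unfolding cone_sign_def by (auto split: if_splits)
  then show ?thesis using F(1) by (intro bexI[of _ F] exI[of _ \<omega>]) (auto simp: \<pi>_def)
qed

text \<open>For positions in general position a facet meets the ray through \<open>w\<close>. Arbitrary positions are
  limits of such; the coefficients, scaled to have sum \<open>1\<close>, have a convergent
  subsequence, and only then may some of them vanish.\<close>
theorem chessboard_zero:
  assumes prime: "prime p"
  shows "\<exists>F\<in>facets. \<exists>l l0. (\<forall>c<M. l c \<ge> 0) \<and> l0 \<ge> 0 \<and> (\<Sum>c<M. l c) + l0 = 1 \<and>
      (\<forall>r<M. (\<Sum>c<M. l c * shift (label F c) (Y c) r) = l0 * w r)"
proof -
  define y where "y b = (if b < M then special b else if b < 2 * M then Y (b - M)
     else if b = 2 * M then (\<lambda>_. 1) else w)" for b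
  obtain z where z: "eventually (\<lambda>t. in_general_position (\<lambda>b r. (1 - t) * y b r + t * z b r) (2 * M + 3)) (at_right 0)"
    by (rule general_position_perturbation)
  define x where "x t b r = (1 - t) * y b r + t * z b r" for t :: real and b r
  have lim: "((\<lambda>t. shift k (x t b) r) \<longlongrightarrow> shift k (y b) r) (at_right 0)" for k b r
  proof -
    have "((\<lambda>t. (1 - t) * shift k (y b) r + t * shift k (z b) r) \<longlongrightarrow> (1 - 0) * shift k (y b) r + 0 * shift k (z b) r) (at_right 0)"
      by (intro tendsto_intros)
    then show ?thesis unfolding x_def[abs_def] shift_affine by simp
  qed
  have lim0: "((\<lambda>t. x t b r) \<longlongrightarrow> y b r) (at_right 0)" for b r using lim[of 0 b r] by simp
  have "eventually (\<lambda>t. \<forall>F\<in>facets. cone_sign M (\<lambda>c. shift (label F c) (x t c)) (x t (2 * M)) =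
      cone_sign M (special_facet F) (\<lambda>_. 1)) (at_right 0)"
  proof (intro eventually_ball_finite finite_facets ballI)
    fix F assume F: "F \<in> facets"
    obtain \<omega> where \<omega>: "\<And>r. r < M \<Longrightarrow> 1 = (\<Sum>c<M. \<omega> c * special_facet F c r)"
        "(\<forall>c<M. \<omega> c > 0) \<or> (\<exists>c<M. \<omega> c < 0)"
    proof (cases "good F")
      case True
      show thesis by (rule that[of "\<lambda>_. 1"]) (use special_good[OF True] in auto)
    next
      case False
      obtain \<omega> where \<omega>: "\<And>r. r < M \<Longrightarrow> 1 = (\<Sum>c<M. \<omega> c * special_facet F c r)"
        using cdet_solve[OF special_facet_independent[OF F], of "\<lambda>_. 1"] by blast
      show thesis by (rule that[OF \<omega>]) (use special_bad[OF F False \<omega>] in auto)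
    qed
    show "eventually (\<lambda>t. cone_sign M (\<lambda>c. shift (label F c) (x t c)) (x t (2 * M)) =
      cone_sign M (special_facet F) (\<lambda>_. 1)) (at_right 0)"
    proof (rule cone_sign_eventually_eq[OF special_facet_independent[OF F] \<omega>])
      fix c r assume "c < M"
      then have "y c = special c" by (simp add: y_def)
      then show "((\<lambda>t. shift (label F c) (x t c) r) \<longlongrightarrow> special_facet F c r) (at_right 0)"
        using lim[of "label F c" c r] by simp
    next
      fix r
      show "((\<lambda>t. x t (2 * M) r) \<longlongrightarrow> 1) (at_right 0)"
        using lim0[of "2 * M" r] by (simp add: y_def)
    qed
  qed
  with z have "eventually (\<lambda>t. \<exists>F\<in>facets. \<exists>\<omega>. (\<forall>c<M. \<omega> c > 0) \<and>
      (\<forall>r<M. x t (2 * M + 1) r = (\<Sum>c<M. \<omega> c * shift (label F c) (x t (M + c)) r))) (at_right 0)"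
  proof eventually_elim
    case (elim t)
    have "in_general_position (x t) (2 * M + 3)" using elim(1) by (simp add: x_def[abs_def])
    from generic_cone_hit[OF this prime] elim(2) show ?case by blast
  qed
  moreover have "filterlim (\<lambda>m. inverse (real (Suc m))) (at_right 0) sequentially"
    using LIMSEQ_inverse_real_of_nat by (auto simp: filterlim_at)
  ultimately have "eventually (\<lambda>m. \<exists>F\<in>facets. \<exists>\<omega>. (\<forall>c<M. \<omega> c > 0) \<and>
      (\<forall>r<M. x (inverse (real (Suc m))) (2 * M + 1) r =
        (\<Sum>c<M. \<omega> c * shift (label F c) (x (inverse (real (Suc m))) (M + c)) r))) sequentially"
    by (rule eventually_compose_filterlim)
  then obtain N where N: "\<And>m. m \<ge> N \<Longrightarrow> \<exists>F\<in>facets. \<exists>\<omega>. (\<forall>c<M. \<omega> c > 0) \<and>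
      (\<forall>r<M. x (inverse (real (Suc m))) (2 * M + 1) r =
        (\<Sum>c<M. \<omega> c * shift (label F c) (x (inverse (real (Suc m))) (M + c)) r))"
    unfolding eventually_sequentially by blast
  define T where "T m = inverse (real (Suc (m + N)))" for m
  have "filterlim T (at_right 0) sequentially"
    unfolding T_def[abs_def] using LIMSEQ_ignore_initial_segment[OF LIMSEQ_inverse_real_of_nat, of N]
    by (auto simp: filterlim_at)
  then have limT: "(\<lambda>m. shift k (x (T m) b) r) \<longlonglongrightarrow> shift k (y b) r" for k b r
    using lim by (rule filterlim_compose[rotated])
  have "\<forall>m. \<exists>F \<omega>. F \<in> facets \<and> (\<forall>c<M. \<omega> c > 0) \<and>
      (\<forall>r<M. x (T m) (2 * M + 1) r = (\<Sum>c<M. \<omega> c * shift (label F c) (x (T m) (M + c)) r))"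
    using N unfolding T_def by (meson le_add2)
  from choice[OF this] obtain Fs where "\<forall>m. \<exists>\<omega>. Fs m \<in> facets \<and> (\<forall>c<M. \<omega> c > 0) \<and>
      (\<forall>r<M. x (T m) (2 * M + 1) r = (\<Sum>c<M. \<omega> c * shift (label (Fs m) c) (x (T m) (M + c)) r))"
    by (elim exE)
  from choice[OF this] obtain \<omega> where \<omega>: "\<forall>m. Fs m \<in> facets \<and> (\<forall>c<M. \<omega> m c > 0) \<and>
      (\<forall>r<M. x (T m) (2 * M + 1) r = (\<Sum>c<M. \<omega> m c * shift (label (Fs m) c) (x (T m) (M + c)) r))"
    by (elim exE)
  have Fs: "\<And>m. Fs m \<in> facets" and pos: "\<And>m c. c < M \<Longrightarrow> \<omega> m c > 0"
    and eq: "\<And>m r. r < M \<Longrightarrow> x (T m) (2 * M + 1) r = (\<Sum>c<M. \<omega> m c * shift (label (Fs m) c) (x (T m) (M + c)) r)"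
    using \<omega> by blast+
  have "finite (range Fs)" using Fs finite_facets by (meson finite_subset image_subsetI)
  then obtain m0 where "infinite {m \<in> UNIV. Fs m = Fs m0}"
    using pigeonhole_infinite[OF infinite_UNIV_nat] by auto
  then obtain r1 where r1: "strict_mono (r1 :: nat \<Rightarrow> nat)" "\<And>m. Fs (r1 m) = Fs m0"
    using infinite_enumerate by blast
  define F where "F = Fs m0"
  define S where "S m = 1 + (\<Sum>c<M. \<omega> m c)" for m
  have S1: "S m \<ge> 1" for m
  proof -
    have "(\<Sum>c<M. \<omega> m c) \<ge> 0" by (rule sum_nonneg) (auto intro: less_imp_le pos)
    then show ?thesis by (simp add: S_def)
  qed
  define l where "l m c = (if c < M then \<omega> m c / S m else 1 / S m)" for m c
  have suml: "(\<Sum>c<M. l m c) + l m M = 1" for m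
  proof -
    have "(\<Sum>c<M. l m c) = (\<Sum>c<M. \<omega> m c) / S m" by (simp add: l_def sum_divide_distrib)
    moreover have "(\<Sum>c<M. \<omega> m c) = S m - 1" by (simp add: S_def)
    moreover have "l m M = 1 / S m" by (simp add: l_def)
    moreover have "S m \<noteq> 0" using S1[of m] by linarith
    ultimately show ?thesis by (simp add: diff_divide_distrib)
  qed
  have l0: "l m c \<ge> 0" for m c using pos[of c m] S1[of m] by (auto simp: l_def less_imp_le)
  have l1: "l m c \<le> 1" if "c \<le> M" for m c
  proof (cases "c < M")
    case True
    have "l m c \<le> (\<Sum>c<M. l m c)" using True l0 by (intro member_le_sum) auto
    then show ?thesis using suml[of m] l0[of m M] by linarith
  next
    case False
    then have "c = M" using that by simp
    moreover have "(\<Sum>c<M. l m c) \<ge> 0" using l0 by (simp add: sum_nonneg)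
    ultimately show ?thesis using suml[of m] by simp
  qed
  have "\<exists>r L. strict_mono (r :: nat \<Rightarrow> nat) \<and> (\<forall>c\<in>{..M}. (\<lambda>m. l (r1 (r m)) c) \<longlonglongrightarrow> L c)"
    by (rule finite_product_convergent_subseq) (use l0 l1 in auto)
  then obtain r2 L where r2: "strict_mono (r2 :: nat \<Rightarrow> nat)"
    and L: "\<And>c. c \<le> M \<Longrightarrow> (\<lambda>m. l (r1 (r2 m)) c) \<longlonglongrightarrow> L c" by auto
  define r where "r = r1 \<circ> r2"
  have r: "strict_mono r" unfolding r_def by (rule strict_mono_o[OF r1(1) r2])
  have Lr: "(\<lambda>m. l (r m) c) \<longlonglongrightarrow> L c" if "c \<le> M" for c using L[OF that] by (simp add: r_def)
  have limr: "(\<lambda>m. shift k (x (T (r m)) b) s) \<longlonglongrightarrow> shift k (y b) s" for k b s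
    using LIMSEQ_subseq_LIMSEQ[OF limT r] by (simp add: o_def)
  have "F \<in> facets" using Fs by (simp add: F_def)
  moreover have "L c \<ge> 0" if "c \<le> M" for c
    by (rule LIMSEQ_le_const[OF Lr[OF that]]) (use l0 in auto)
  moreover have "(\<Sum>c<M. L c) + L M = 1"
  proof (rule LIMSEQ_unique)
    show "(\<lambda>m. (\<Sum>c<M. l (r m) c) + l (r m) M) \<longlonglongrightarrow> (\<Sum>c<M. L c) + L M"
      by (intro tendsto_intros Lr) auto
    show "(\<lambda>m. (\<Sum>c<M. l (r m) c) + l (r m) M) \<longlonglongrightarrow> 1" by (simp add: suml)
  qed
  moreover have "(\<Sum>c<M. L c * shift (label F c) (Y c) s) = L M * w s" if s: "s < M" for s
  proof (rule LIMSEQ_unique)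
    have "(\<lambda>m. \<Sum>c<M. l (r m) c * shift (label F c) (x (T (r m)) (M + c)) s) \<longlonglongrightarrow>
        (\<Sum>c<M. L c * shift (label F c) (y (M + c)) s)"
      by (intro tendsto_intros Lr limr) auto
    moreover have "(\<Sum>c<M. L c * shift (label F c) (y (M + c)) s) = (\<Sum>c<M. L c * shift (label F c) (Y c) s)"
    proof (rule sum.cong[OF refl])
      fix c assume "c \<in> {..<M}"
      then have "M + c < 2 * M" by (simp only: lessThan_iff mult_2 nat_add_left_cancel_less)
      then have "y (M + c) = Y c" unfolding y_def by simp
      then show "L c * shift (label F c) (y (M + c)) s = L c * shift (label F c) (Y c) s" by simp
    qed
    ultimately show "(\<lambda>m. \<Sum>c<M. l (r m) c * shift (label F c) (x (T (r m)) (M + c)) s) \<longlonglongrightarrow>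
        (\<Sum>c<M. L c * shift (label F c) (Y c) s)" by simp
    have "(\<Sum>c<M. l (r m) c * shift (label F c) (x (T (r m)) (M + c)) s) = l (r m) M * x (T (r m)) (2 * M + 1) s" for m
    proof -
      have "Fs (r m) = F" using r1(2) by (simp add: r_def F_def)
      then show ?thesis using eq[OF s, of "r m"]
        by (simp add: l_def sum_divide_distrib)
    qed
    moreover have "(\<lambda>m. l (r m) M * x (T (r m)) (2 * M + 1) s) \<longlonglongrightarrow> L M * y (2 * M + 1) s"
      using limr[of 0 "2 * M + 1" s] by (intro tendsto_mult Lr) auto
    ultimately show "(\<lambda>m. \<Sum>c<M. l (r m) c * shift (label F c) (x (T (r m)) (M + c)) s) \<longlonglongrightarrow> L M * w s"
      by (simp add: y_def)
  qed
  ultimately show ?thesis by (intro bexI[of _ F] exI[of _ L] exI[of _ "L M"]) auto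
qed

end

section \<open>The optimal coloured Tverberg theorem\<close>

context chessboard
begin

lemma sum_columns: "(\<Sum>c<M. f c) = (\<Sum>i<q. \<Sum>j<n. f (i * n + j) :: real)"
proof -
  have "(\<Sum>c<M. f c) = (\<Sum>i<q. sum f {i * n..<i * n + n})" by (rule sum.nat_group[symmetric])
  also have "\<dots> = (\<Sum>i<q. \<Sum>j<n. f (i * n + j))"
  proof (rule sum.cong[OF refl])
    fix i
    show "sum f {i * n..<i * n + n} = (\<Sum>j<n. f (i * n + j))"
      by (rule sum.reindex_bij_witness[of _ "\<lambda>j. i * n + j" "\<lambda>c. c - i * n"]) auto
  qed
  finally show ?thesis .
qed

text \<open>The part with label \<open>0\<close> contains the auxiliary point and is dropped. A point with label \<open>0\<close> is moved to
  the part that its colour misses, so that all points are used; \<open>slot F i k\<close> is the point of colour \<open>i\<close> in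
  part \<open>k\<close>.\<close>
definition slot :: "(nat \<Rightarrow> nat \<Rightarrow> nat) \<Rightarrow> nat \<Rightarrow> nat \<Rightarrow> nat" where
  "slot F i k = Hilbert_Choice.inv (F i) (Transposition.transpose 0 (F i n) k)"

lemma slot_bij:
  assumes F: "F \<in> facets" and i: "i < q" shows "bij_betw (slot F i) {1..n} {..<n}"
proof -
  have perm: "F i permutes {..n}" by (rule facets_permutes[OF F i])
  have "F i n \<le> n" using perm permutes_in_image[of "F i" "{..n}" n] by simp
  then have "Transposition.transpose 0 (F i n) permutes {..n}" by (intro permutes_swap_id) auto
  then have "Hilbert_Choice.inv (F i) \<circ> Transposition.transpose 0 (F i n) permutes {..n}"
    using permutes_inv[OF perm] by (rule permutes_compose)
  then have "bij_betw (slot F i) {..n} {..n}"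
    using permutes_imp_bij by (simp add: slot_def[abs_def] o_def)
  moreover have "slot F i 0 = n" using permutes_inverses(2)[OF perm] by (simp add: slot_def)
  ultimately have "bij_betw (slot F i) ({..n} - {0}) ({..n} - {n})"
    using bij_betw_DiffI[of "slot F i" "{..n}" "{..n}" "{0}" "{n}"] by (simp add: bij_betw_def)
  moreover have "{..n} - {0} = {1..n}" "{..n} - {n} = {..<n}" by auto
  ultimately show ?thesis by simp
qed

lemma sum_label:
  assumes F: "F \<in> facets" and i: "i < q" and k: "k \<in> {1..n}"
  shows "(\<Sum>j<n. g j * of_bool (F i j = k)) = (if F i n = k then 0 else g (slot F i k) :: real)"
proof (cases "F i n = k")
  case True
  have "(\<Sum>j<n. g j * of_bool (F i j = k)) = 0"
    by (rule sum.neutral) (use True facet_inj[OF F i] in auto)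
  then show ?thesis using True by simp
next
  case False
  have perm: "F i permutes {..n}" by (rule facets_permutes[OF F i])
  have s: "slot F i k = Hilbert_Choice.inv (F i) k" using False k by (simp add: slot_def)
  have Fs: "F i (slot F i k) = k" unfolding s by (rule permutes_inverses(1)[OF perm])
  have "slot F i k < n" using slot_bij[OF F i] k by (auto simp: bij_betw_def)
  moreover have "(\<Sum>j<n. g j * of_bool (F i j = k)) = (\<Sum>j<n. if j = slot F i k then g j else 0)"
    by (rule sum.cong[OF refl]) (use Fs facet_inj[OF F i] in auto)
  ultimately show ?thesis using False by simp
qed

text \<open>Sarkaria's trick: points are tensored with the labels, and \<open>w\<close> belongs to the negative of an auxiliary
  point \<open>v0\<close> with label \<open>0\<close>. A vanishing combination says that the weighted sums \<open>W m k\<close> of the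
  points with label \<open>k\<close> do not depend on \<open>k\<close>. The last coordinate is constantly \<open>1\<close>, so the total
  weight of each label is \<open>1 / p\<close>.\<close>
lemma coloured_tverberg_coordinates:
  assumes prime: "prime p" and q: "q = Suc d" and last: "\<And>i j. V i j d = (1 :: real)"
  shows "\<exists>J x. (\<forall>i<q. bij_betw (J i) {1..n} {..<n}) \<and> (\<forall>k\<in>{1..n}. \<exists>\<alpha>. (\<forall>i<q. \<alpha> i \<ge> 0) \<and>
     (\<Sum>i<q. \<alpha> i) = 1 \<and> (\<forall>m<d. (\<Sum>i<q. \<alpha> i * V i (J i k) m) = x m))"
proof -
  define v0 :: "nat \<Rightarrow> real" where "v0 m = of_bool (m = d)" for m
  define U where "U c = V (c div n) (c mod n)" for c
  obtain F l l0 where F: "F \<in> facets" and l: "\<And>c. c < M \<Longrightarrow> l c \<ge> 0" "l0 \<ge> 0" "(\<Sum>c<M. l c) + l0 = 1"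
    and eq: "\<And>r. r < M \<Longrightarrow> (\<Sum>c<M. l c * shift (label F c) (column (U c)) r) = l0 * column (\<lambda>m. - v0 m) r"
    using chessboard_zero[OF prime, of "\<lambda>c. column (U c)" "column (\<lambda>m. - v0 m)"] by auto
  define W where "W m k = (\<Sum>c<M. l c * U c m * of_bool (label F c = k)) + l0 * v0 m * of_bool (k = 0)" for m k
  have W1: "W m k = W m 1" if m: "m < q" and k: "k \<le> n" for m k
  proof (cases "k = 1")
    case False
    with k obtain s where s: "s < n" "(p - s) mod p = k" by (rule label_reached)
    have "(\<Sum>c<M. l c * shift (label F c) (column (U c)) (m * n + s)) =
        (\<Sum>c<M. l c * U c m * of_bool (label F c = k)) - (\<Sum>c<M. l c * U c m * of_bool (label F c = 1))"
      unfolding sum_subtractf[symmetric]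
    proof (rule sum.cong[OF refl])
      fix c assume "c \<in> {..<M}"
      then have "label F c \<le> n" using label_le[OF F] by simp
      then show "l c * shift (label F c) (column (U c)) (m * n + s) =
          l c * U c m * of_bool (label F c = k) - l c * U c m * of_bool (label F c = 1)"
        unfolding shift_column[OF s(1) \<open>label F c \<le> n\<close>] s(2) by (simp only: right_diff_distrib mult.assoc)
    qed
    moreover have "column (\<lambda>m. - v0 m) (m * n + s) = - v0 m * of_bool (k = 0)"
    proof -
      have "k = 0 \<longleftrightarrow> s = 0" using s n_pos by (cases "s = 0") auto
      then show ?thesis using s(1) by (simp add: column_def)
    qed
    ultimately show ?thesis using eq[OF index_less[OF m s(1)]] by (simp add: W_def)
  qed simp
  have Wd: "W d 1 = 1 / real p"
  proof -
    have "(\<Sum>k\<le>n. W d k) = (\<Sum>k\<le>n. W d 1)" by (rule sum.cong[OF refl]) (use W1[of d] q in auto)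
    moreover have "(\<Sum>k\<le>n. W d k) = (\<Sum>c<M. l c * (\<Sum>k\<le>n. of_bool (label F c = k))) + l0 * (\<Sum>k\<le>n. of_bool (k = 0))"
      unfolding W_def sum.distrib by (subst sum.swap) (simp add: U_def last v0_def sum_distrib_left mult.commute)
    moreover have "(\<Sum>k\<le>n. of_bool (k = (0 :: nat))) = (1 :: real)"
      by (subst sum.remove[of _ 0]) auto
    moreover have "(\<Sum>k\<le>n. of_bool (label F c = k)) = (1 :: real)" if "c < M" for c
      using label_le[OF F that] by (subst sum.remove[of _ "label F c"]) auto
    ultimately have "real p * W d 1 = (\<Sum>c<M. l c) + l0" by simp
    then show ?thesis using l(3) by (simp add: field_simps)
  qed
  define \<alpha> where "\<alpha> k i = (if F i n = k then 0 else real p * l (i * n + slot F i k))" for k i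
  have sum\<alpha>: "(\<Sum>i<q. \<alpha> k i * V i (slot F i k) m) = real p * W m 1" if m: "m < q" and k: "k \<in> {1..n}" for m k
  proof -
    have "W m 1 = W m k" using k by (intro W1[OF m, symmetric]) simp
    also have "\<dots> = (\<Sum>i<q. \<Sum>j<n. l (i * n + j) * V i j m * of_bool (F i j = k))"
      using k unfolding W_def sum_columns by (simp add: U_def label_def)
    also have "\<dots> = (\<Sum>i<q. if F i n = k then 0 else l (i * n + slot F i k) * V i (slot F i k) m)"
      by (rule sum.cong[OF refl]) (use sum_label[OF F _ k] in auto)
    finally have eq: "W m 1 = (\<Sum>i<q. if F i n = k then 0 else l (i * n + slot F i k) * V i (slot F i k) m)" .
    show ?thesis unfolding eq sum_distrib_left by (rule sum.cong[OF refl]) (simp add: \<alpha>_def mult.assoc)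
  qed
  show ?thesis
  proof (rule exI[of _ "slot F"], rule exI[of _ "\<lambda>m. real p * W m 1"], intro conjI allI impI ballI)
    fix i assume "i < q" then show "bij_betw (slot F i) {1..n} {..<n}" by (rule slot_bij[OF F])
  next
    fix k assume k: "k \<in> {1..n}"
    have "\<alpha> k i \<ge> 0" if i: "i < q" for i
    proof -
      have "slot F i k < n" using slot_bij[OF F i] k by (auto simp: bij_betw_def)
      then show ?thesis using l(1)[OF index_less[OF i]] by (simp add: \<alpha>_def)
    qed
    moreover have "(\<Sum>i<q. \<alpha> k i) = 1" using sum\<alpha>[of d k] k q Wd by (simp add: last)
    moreover have "(\<Sum>i<q. \<alpha> k i * V i (slot F i k) m) = real p * W m 1" if "m < d" for m
      using sum\<alpha>[of m k] that k q by simp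
    ultimately show "\<exists>\<alpha>. (\<forall>i<q. \<alpha> i \<ge> 0) \<and> (\<Sum>i<q. \<alpha> i) = 1 \<and>
        (\<forall>m<d. (\<Sum>i<q. \<alpha> i * V i (slot F i k) m) = real p * W m 1)" by blast
  qed
qed

end

text \<open>The theorem of Blagojevic, Matschke and Ziegler for affine maps. Rainbow set number \<open>k\<close> consists of
  the points \<open>c i (J i k)\<close>.\<close>
theorem optimal_coloured_tverberg:
  fixes c :: "nat \<Rightarrow> nat \<Rightarrow> real ^ 'd"
  assumes "prime (Suc n)" "even n"
  obtains J x where "\<And>i. i \<le> CARD('d) \<Longrightarrow> bij_betw (J i) {1..n} {..<n}"
    and "\<And>k. k \<in> {1..n} \<Longrightarrow> \<exists>\<alpha>. (\<forall>i\<le>CARD('d). \<alpha> i \<ge> 0) \<and> (\<Sum>i\<le>CARD('d). \<alpha> i) = 1 \<and>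
      (\<Sum>i\<le>CARD('d). \<alpha> i *\<^sub>R c i (J i k)) = x"
proof -
  let ?d = "CARD('d)"
  have "n > 0" using assms(1) by (cases n) auto
  then interpret chessboard "Suc ?d" n using assms(2) by unfold_locales
  obtain e where e: "bij_betw e {0..<?d} (UNIV :: 'd set)"
    using ex_bij_betw_nat_finite[of "UNIV :: 'd set"] by auto
  define V where "V i j m = (if m < ?d then c i j $ e m else 1)" for i j m
  have last: "V i j ?d = 1" for i j by (simp add: V_def)
  from coloured_tverberg_coordinates[OF assms(1) refl, of V, OF last] obtain J x
    where J: "\<forall>i<Suc ?d. bij_betw (J i) {1..n} {..<n}"
    and x: "\<forall>k\<in>{1..n}. \<exists>\<alpha>. (\<forall>i<Suc ?d. \<alpha> i \<ge> 0) \<and>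
     (\<Sum>i<Suc ?d. \<alpha> i) = 1 \<and> (\<forall>m<?d. (\<Sum>i<Suc ?d. \<alpha> i * V i (J i k) m) = x m)"
    by (elim exE conjE)
  define X :: "real ^ 'd" where "X = (\<chi> m. x (the_inv_into {0..<?d} e m))"
  show thesis
  proof (rule that[of J X])
    show "bij_betw (J i) {1..n} {..<n}" if "i \<le> ?d" for i using J that by simp
    fix k assume "k \<in> {1..n}"
    from x[rule_format, OF this] obtain \<alpha> where \<alpha>: "\<forall>i<Suc ?d. \<alpha> i \<ge> 0" "(\<Sum>i<Suc ?d. \<alpha> i) = 1"
      "\<forall>m<?d. (\<Sum>i<Suc ?d. \<alpha> i * V i (J i k) m) = x m" by blast
    have "(\<Sum>i\<le>?d. \<alpha> i *\<^sub>R c i (J i k)) = X"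
    proof (rule Finite_Cartesian_Product.vec_eq_iff[THEN iffD2], rule allI)
      fix m :: 'd
      define a where "a = the_inv_into {0..<?d} e m"
      have m: "m \<in> e ` {0..<?d}" using e by (simp add: bij_betw_def)
      have ea: "e a = m" unfolding a_def by (rule f_the_inv_into_f[OF bij_betw_imp_inj_on[OF e] m])
      have a: "a < ?d" using the_inv_into_into[OF bij_betw_imp_inj_on[OF e] m subset_refl] by (auto simp: a_def)
      have "(\<Sum>i\<le>?d. \<alpha> i *\<^sub>R c i (J i k)) $ m = (\<Sum>i<Suc ?d. \<alpha> i * V i (J i k) a)"
        using a ea by (simp add: V_def lessThan_Suc_atMost)
      also have "\<dots> = x a" using \<alpha>(3) a by blast
      finally show "(\<Sum>i\<le>?d. \<alpha> i *\<^sub>R c i (J i k)) $ m = X $ m" by (simp add: X_def a_def)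
    qed
    then show "\<exists>\<alpha>. (\<forall>i\<le>?d. \<alpha> i \<ge> 0) \<and> (\<Sum>i\<le>?d. \<alpha> i) = 1 \<and>
      (\<Sum>i\<le>?d. \<alpha> i *\<^sub>R c i (J i k)) = X"
      using \<alpha>(1,2) by (intro exI[of _ \<alpha>]) (simp add: lessThan_Suc_atMost less_Suc_eq_le)
  qed
qed

section \<open>Colourful Caratheodory and Steinitz theorems\<close>

lemma hull_support:
  fixes S :: "('a::real_inner) set"
  assumes "z \<in> convex hull S" shows "\<exists>x\<in>S. x \<bullet> v \<ge> z \<bullet> v"
proof (rule ccontr)
  assume "\<not> ?thesis"
  then have "S \<subseteq> {x. v \<bullet> x < z \<bullet> v}" by (auto simp: inner_commute not_le)
  then have "convex hull S \<subseteq> {x. v \<bullet> x < z \<bullet> v}"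
    by (rule hull_minimal) (rule convex_halfspace_lt)
  with assms show False by (auto simp: inner_commute)
qed

lemma hull_insert_0_eq:
  fixes x :: "'k::finite \<Rightarrow> 'a::real_vector"
  shows "convex hull (insert 0 (range x)) = {\<Sum>j\<in>UNIV. l j *\<^sub>R x j | l. (\<forall>j. l j \<ge> 0) \<and> sum l UNIV \<le> 1}"
    (is "_ = ?R")
proof
  have mem: "(\<Sum>j\<in>UNIV. l j *\<^sub>R x j) \<in> ?R" if "\<forall>j. l j \<ge> 0" "sum l UNIV \<le> 1" for l using that by blast
  have conv: "convex ?R"
  proof (rule convexI)
    fix y z u v assume y: "y \<in> ?R" and z: "z \<in> ?R" and uv: "(0::real) \<le> u" "0 \<le> v" "u + v = 1"
    obtain l where l: "y = (\<Sum>j\<in>UNIV. l j *\<^sub>R x j)" "\<forall>j. l j \<ge> 0" "sum l UNIV \<le> 1" using y by blast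
    obtain l' where l': "z = (\<Sum>j\<in>UNIV. l' j *\<^sub>R x j)" "\<forall>j. l' j \<ge> 0" "sum l' UNIV \<le> 1" using z by blast
    have "u *\<^sub>R y + v *\<^sub>R z = (\<Sum>j\<in>UNIV. (u * l j + v * l' j) *\<^sub>R x j)"
      by (simp add: l(1) l'(1) scaleR_sum_right scaleR_left_distrib sum.distrib)
    moreover have "\<forall>j. u * l j + v * l' j \<ge> 0" using uv l(2) l'(2) by simp
    moreover have "(\<Sum>j\<in>UNIV. u * l j + v * l' j) \<le> 1"
    proof -
      have "(\<Sum>j\<in>UNIV. u * l j + v * l' j) = u * sum l UNIV + v * sum l' UNIV"
        by (simp add: sum.distrib sum_distrib_left)
      also have "\<dots> \<le> u * 1 + v * 1" using uv l(3) l'(3) by (intro add_mono mult_left_mono) auto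
      finally show ?thesis using uv by simp
    qed
    ultimately show "u *\<^sub>R y + v *\<^sub>R z \<in> ?R" using mem[of "\<lambda>j. u * l j + v * l' j"] by simp
  qed
  have "0 \<in> ?R" using mem[of "\<lambda>_. 0"] by simp
  moreover have "x j \<in> ?R" for j
  proof -
    have "(\<Sum>i\<in>UNIV. of_bool (i = j) *\<^sub>R x i) = (\<Sum>i\<in>UNIV. if i = j then x i else 0)"
      by (rule sum.cong) auto
    then have "(\<Sum>i\<in>UNIV. of_bool (i = j) *\<^sub>R x i) = x j" by simp
    moreover have "sum (\<lambda>i. of_bool (i = j) :: real) UNIV = (\<Sum>i\<in>UNIV. if i = j then 1 else 0)"
      by (rule sum.cong) auto
    ultimately show ?thesis using mem[of "\<lambda>i. of_bool (i = j)"] by simp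
  qed
  ultimately show "convex hull (insert 0 (range x)) \<subseteq> ?R"
    by (intro hull_minimal conv) auto
  show "?R \<subseteq> convex hull (insert 0 (range x))"
  proof
    fix y assume "y \<in> ?R"
    then obtain l where l: "y = (\<Sum>j\<in>UNIV. l j *\<^sub>R x j)" "\<forall>j. l j \<ge> 0" "sum l UNIV \<le> 1" by blast
    let ?K = "convex hull (insert 0 (range x))"
    have K0: "0 \<in> ?K" and Kx: "\<And>j. x j \<in> ?K" by (auto intro: hull_inc)
    define s where "s = sum l UNIV"
    show "y \<in> ?K"
    proof (cases "s = 0")
      case True
      then have "\<forall>j. l j = 0" using l(2) unfolding s_def by (simp add: sum_nonneg_eq_0_iff)
      then show ?thesis using l(1) K0 by simp
    next
      case False
      then have s: "s > 0" using l(2) by (simp add: s_def sum_nonneg order_less_le)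
      have "(\<Sum>j\<in>UNIV. (l j / s) *\<^sub>R x j) \<in> ?K"
        by (rule convex_sum) (use l(2) s Kx in \<open>auto simp: sum_divide_distrib[symmetric] s_def[symmetric]\<close>)
      then have "s *\<^sub>R (\<Sum>j\<in>UNIV. (l j / s) *\<^sub>R x j) + (1 - s) *\<^sub>R 0 \<in> ?K"
        using s l(3) K0 by (intro convexD[OF convex_convex_hull]) (auto simp: s_def)
      also have "s *\<^sub>R (\<Sum>j\<in>UNIV. (l j / s) *\<^sub>R x j) + (1 - s) *\<^sub>R 0 = y"
        using False by (simp add: l(1) scaleR_sum_right)
      finally show ?thesis .
    qed
  qed
qed

lemma det_0_iff_kernel:
  fixes A :: "real ^ 'n ^ 'n"
  shows "Determinants.det A = 0 \<longleftrightarrow> (\<exists>x. x \<noteq> 0 \<and> A *v x = 0)"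
  using invertible_det_nz[of A] invertible_left_inverse[of A] matrix_left_invertible_ker[of A] by blast

text \<open>Barany's colourful Caratheodory theorem for cones. Choose the transversal whose cone is closest to
  \<open>a\<close>, and let \<open>y\<close> be the point of the cone next to \<open>a\<close>. If \<open>w = a - y\<close> were not zero, then \<open>y\<close> would need at most
  \<open>d - 1\<close> of the \<open>d\<close> generators, since otherwise all of them would be orthogonal to \<open>w\<close> and hence dependent.
  Replacing an unneeded generator by one with positive product with \<open>w\<close> would bring the cone closer.\<close>
lemma colourful_cone:
  fixes S :: "'d::finite \<Rightarrow> (real ^ 'd) set"
  assumes fin: "\<And>j. finite (S j)" and pos: "\<And>j v. v \<noteq> 0 \<Longrightarrow> \<exists>x\<in>S j. x \<bullet> v > 0"
  shows "\<exists>x c. (\<forall>j. x j \<in> S j) \<and> (\<forall>j. c j \<ge> 0) \<and> a = (\<Sum>j\<in>UNIV. c j *\<^sub>R x j)"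
proof -
  define C where "C x = {\<Sum>j\<in>UNIV. c j *\<^sub>R x j | c. \<forall>j. c j \<ge> (0 :: real)}" for x :: "'d \<Rightarrow> real ^ 'd"
  have CI: "(\<Sum>j\<in>UNIV. c j *\<^sub>R x j) \<in> C x" if "\<forall>j. c j \<ge> 0" for c and x :: "'d \<Rightarrow> real ^ 'd"
    using that unfolding C_def by blast
  have CE: "\<exists>c. y = (\<Sum>j\<in>UNIV. c j *\<^sub>R x j) \<and> (\<forall>j. c j \<ge> 0)" if "y \<in> C x" for y x
    using that unfolding C_def by blast
  have unitsum: "(\<Sum>i\<in>UNIV. of_bool (i = j) *\<^sub>R x i) = x j" for j and x :: "'d \<Rightarrow> real ^ 'd"
  proof -
    have "(\<Sum>i\<in>UNIV. of_bool (i = j) *\<^sub>R x i) = (\<Sum>i\<in>UNIV. if i = j then x i else 0)"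
      by (rule sum.cong) auto
    then show ?thesis by simp
  qed
  have C0: "0 \<in> C x" and Cx: "x j \<in> C x" for x :: "'d \<Rightarrow> real ^ 'd" and j
    using CI[of "\<lambda>_. 0" x] CI[of "\<lambda>i. of_bool (i = j)" x] unitsum[of j x] by auto
  have Cadd: "y + z \<in> C x" if y: "y \<in> C x" and z: "z \<in> C x" for x y z
  proof -
    obtain b where "y = (\<Sum>j\<in>UNIV. b j *\<^sub>R x j)" "\<forall>j. b j \<ge> 0" using CE[OF y] by (elim exE conjE)
    moreover obtain c where "z = (\<Sum>j\<in>UNIV. c j *\<^sub>R x j)" "\<forall>j. c j \<ge> 0" using CE[OF z] by (elim exE conjE)
    ultimately show ?thesis using CI[of "\<lambda>j. b j + c j" x] by (simp add: scaleR_left_distrib sum.distrib)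
  qed
  have Cmul: "s *\<^sub>R y \<in> C x" if y: "y \<in> C x" and s: "s \<ge> 0" for x y s
  proof -
    obtain b where "y = (\<Sum>j\<in>UNIV. b j *\<^sub>R x j)" "\<forall>j. b j \<ge> 0" using CE[OF y] by (elim exE conjE)
    then show ?thesis using CI[of "\<lambda>j. s * b j" x] s by (simp add: scaleR_sum_right)
  qed
  have cone: "convex_cone (C x)" for x
    unfolding convex_cone_iff using C0 Cadd Cmul by blast
  have Ceq: "C x = convex_cone hull (range x)" for x
  proof
    show "convex_cone hull (range x) \<subseteq> C x"
      by (rule hull_minimal) (use Cx cone in auto)
    have "(\<Sum>j\<in>J. c j *\<^sub>R x j) \<in> convex_cone hull (range x)" if "finite J" "\<forall>j. c j \<ge> 0" for J c
      using that(1)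
    proof (induction J rule: finite_induct)
      case (insert i J)
      have "c i *\<^sub>R x i \<in> convex_cone hull (range x)"
        using that(2) by (intro convex_cone_hull_mul hull_inc) auto
      with insert show ?case by (simp add: convex_cone_hull_add)
    qed (simp add: convex_cone_hull_contains_0)
    then show "C x \<subseteq> convex_cone hull (range x)" unfolding C_def by auto
  qed
  have closed: "closed (C x)" for x
    unfolding Ceq by (intro polyhedron_imp_closed polyhedron_convex_cone_hull) simp
  have convex: "convex (C x)" for x using cone unfolding convex_cone_def by blast
  define T where "T = PiE UNIV S"
  have finT: "finite T" unfolding T_def by (intro finite_PiE) (auto simp: fin)
  have "axis undefined 1 \<noteq> (0 :: real ^ 'd)" by (simp add: axis_eq_0_iff)
  then have ne: "S j \<noteq> {}" for j using pos[of "axis undefined 1" j] by blast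
  have "T \<noteq> {}" unfolding T_def by (simp add: PiE_eq_empty_iff ne)
  define D where "D x = dist a (closest_point (C x) a)" for x
  obtain x where x: "x \<in> T" and min: "\<And>x'. x' \<in> T \<Longrightarrow> D x \<le> D x'"
    using arg_min_if_finite(1)[OF finT \<open>T \<noteq> {}\<close>, of D] arg_min_least[OF finT \<open>T \<noteq> {}\<close>, of _ D] by blast
  define y where "y = closest_point (C x) a"
  have ne: "C x \<noteq> {}" for x using C0 by blast
  have yC: "y \<in> C x" unfolding y_def using closed ne by (rule closest_point_in_set)
  define w where "w = a - y"
  have opt: "w \<bullet> (z - y) \<le> 0" if "z \<in> C x" for z
    unfolding w_def y_def by (rule closest_point_dot[OF convex closed that])
  have "w = 0"
  proof (rule ccontr)
    assume w0: "w \<noteq> 0"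
    obtain c where c: "y = (\<Sum>j\<in>UNIV. c j *\<^sub>R x j)" "\<forall>j. c j \<ge> 0" using CE[OF yC] by (elim exE conjE)
    have wx: "w \<bullet> x j \<le> 0" for j using opt[OF Cadd[OF yC Cx[of x j]]] by simp
    have wy: "w \<bullet> y = 0"
    proof -
      have "w \<bullet> (0 - y) \<le> 0" by (rule opt[OF C0])
      moreover have "w \<bullet> (2 *\<^sub>R y - y) \<le> 0" by (rule opt[OF Cmul[OF yC]]) simp
      ultimately show ?thesis by (simp add: inner_diff_right)
    qed
    obtain c' j0 where c': "y = (\<Sum>j\<in>UNIV. c' j *\<^sub>R x j)" "\<forall>j. c' j \<ge> 0" "c' j0 = 0"
    proof (cases "\<exists>j. c j = 0")
      case True with c that show thesis by blast
    next
      case False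
      then have cpos: "c j > 0" for j using c(2) by (metis order_less_le)
      have "(\<Sum>j\<in>UNIV. c j * - (w \<bullet> x j)) = 0"
        using wy unfolding c(1) by (simp add: inner_sum_right sum_negf)
      then have "\<forall>j\<in>UNIV. c j * - (w \<bullet> x j) = 0"
        using wx c(2) by (subst (asm) sum_nonneg_eq_0_iff) (auto simp: mult_nonneg_nonpos)
      then have orth: "w \<bullet> x j = 0" for j using cpos[of j] by (metis UNIV_I less_irrefl mult_eq_0_iff neg_equal_0_iff_equal)
      define A :: "real ^ 'd ^ 'd" where "A = (\<chi> i j. x j $ i)"
      have "Finite_Cartesian_Product.transpose A *v w = 0"
        using orth by (simp add: Finite_Cartesian_Product.vec_eq_iff A_def Finite_Cartesian_Product.transpose_def matrix_vector_mult_def inner_vec_def mult.commute)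
      then have "Determinants.det (Finite_Cartesian_Product.transpose A) = 0" using w0 det_0_iff_kernel by blast
      then have "Determinants.det A = 0" by (simp add: Determinants.det_transpose)
      then obtain \<mu> where \<mu>: "\<mu> \<noteq> 0" "A *v \<mu> = 0" using det_0_iff_kernel by blast
      have rel: "(\<Sum>j\<in>UNIV. \<mu> $ j *\<^sub>R x j) = 0"
        using \<mu>(2) by (simp add: Finite_Cartesian_Product.vec_eq_iff A_def matrix_vector_mult_def mult.commute)
      obtain \<nu> :: "'d \<Rightarrow> real" and j1 where \<nu>: "(\<Sum>j\<in>UNIV. \<nu> j *\<^sub>R x j) = 0" "\<nu> j1 > 0"
      proof -
        obtain j where "\<mu> $ j \<noteq> 0" using \<mu>(1) by (auto simp: Finite_Cartesian_Product.vec_eq_iff)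
        then consider "\<mu> $ j > 0" | "- \<mu> $ j > 0" by fastforce
        then show thesis
        proof cases
          case 1 show thesis by (rule that[of "\<lambda>j. \<mu> $ j" j]) (use 1 rel in simp_all)
        next
          case 2
          show thesis by (rule that[of "\<lambda>j. - \<mu> $ j" j]) (use 2 rel in \<open>simp_all add: sum_negf\<close>)
        qed
      qed
      define P where "P = {j. \<nu> j > 0}"
      have P: "finite P" "P \<noteq> {}" using \<nu>(2) by (auto simp: P_def)
      obtain j0 where j0: "j0 \<in> P" "\<And>j. j \<in> P \<Longrightarrow> c j0 / \<nu> j0 \<le> c j / \<nu> j"
        using arg_min_if_finite(1)[OF P, of "\<lambda>j. c j / \<nu> j"] arg_min_least[OF P, of _ "\<lambda>j. c j / \<nu> j"] by blast
      define t where "t = c j0 / \<nu> j0"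
      have t0: "t \<ge> 0" using c(2) j0(1) by (simp add: t_def P_def)
      show thesis
      proof (rule that[of "\<lambda>j. c j - t * \<nu> j" j0])
        show "y = (\<Sum>j\<in>UNIV. (c j - t * \<nu> j) *\<^sub>R x j)"
        proof -
          have "(\<Sum>j\<in>UNIV. (c j - t * \<nu> j) *\<^sub>R x j) = y - t *\<^sub>R (\<Sum>j\<in>UNIV. \<nu> j *\<^sub>R x j)"
            by (simp add: c(1) scaleR_left_diff_distrib sum_subtractf scaleR_sum_right)
          then show ?thesis using \<nu>(1) by simp
        qed
        show "\<forall>j. c j - t * \<nu> j \<ge> 0"
        proof
          fix j
          show "c j - t * \<nu> j \<ge> 0"
          proof (cases "j \<in> P")
            case True
            then show ?thesis using j0(2)[OF True] by (simp add: t_def[symmetric] P_def pos_le_divide_eq)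
          next
            case False
            then have "t * \<nu> j \<le> 0" using t0 by (simp add: P_def mult_nonneg_nonpos)
            then show ?thesis using c(2) by (metis diff_ge_0_iff_ge order_trans)
          qed
        qed
        show "c j0 - t * \<nu> j0 = 0" using j0(1) by (simp add: t_def P_def)
      qed
    qed
    obtain x0 where x0: "x0 \<in> S j0" "x0 \<bullet> w > 0" using pos[OF w0] by blast
    define x' where "x' = x(j0 := x0)"
    have x'T: "x' \<in> T" using x x0(1) by (auto simp: T_def x'_def PiE_iff)
    have "y = (\<Sum>j\<in>UNIV. c' j *\<^sub>R x' j)"
      unfolding c'(1) by (rule sum.cong) (auto simp: x'_def c'(3))
    then have "y \<in> C x'" using CI[OF c'(2), of x'] by simp
    moreover have "x0 \<in> C x'" using Cx[of x' j0] by (simp add: x'_def)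
    define s where "s = (x0 \<bullet> w) / (x0 \<bullet> x0)"
    have xx: "x0 \<bullet> x0 > 0" using x0(2) by auto
    have s0: "s \<ge> 0" using x0(2) xx by (simp add: s_def)
    ultimately have "y + s *\<^sub>R x0 \<in> C x'" using \<open>x0 \<in> C x'\<close> by (intro Cadd Cmul) auto
    then have "D x' \<le> dist a (y + s *\<^sub>R x0)" unfolding D_def by (rule closest_point_le[OF closed])
    also have "\<dots> = norm (w - s *\<^sub>R x0)" by (simp add: dist_norm w_def algebra_simps)
    also have "\<dots> < norm w"
    proof -
      have "(w - s *\<^sub>R x0) \<bullet> (w - s *\<^sub>R x0) = w \<bullet> w - 2 * s * (x0 \<bullet> w) + s * (s * (x0 \<bullet> x0))"
        by (simp add: inner_diff_left inner_diff_right inner_commute algebra_simps)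
      also have "s * (x0 \<bullet> x0) = x0 \<bullet> w" using xx by (simp add: s_def)
      finally have "(w - s *\<^sub>R x0) \<bullet> (w - s *\<^sub>R x0) = w \<bullet> w - s * (x0 \<bullet> w)" by simp
      moreover have "s * (x0 \<bullet> w) > 0" using x0(2) xx by (simp add: s_def)
      ultimately show ?thesis by (simp add: norm_lt)
    qed
    also have "norm w = D x" by (simp add: D_def w_def y_def dist_norm)
    finally show False using min[OF x'T] by simp
  qed
  then have "a \<in> C x" using yC by (simp add: w_def)
  then show ?thesis using x unfolding C_def T_def by auto
qed

text \<open>For \<open>q\<close> inside the open ball the sets \<open>S j - q\<close> positively span the space, and if \<open>q\<close> is in the cone of
  points \<open>x j - q\<close>, then it is in the hull of the points \<open>x j\<close> and \<open>0\<close>. The sphere is reached by a limit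
  among finitely many transversals of finite subsets.\<close>
lemma colourful_capture:
  fixes S :: "'d::finite \<Rightarrow> (real ^ 'd) set"
  assumes S: "\<And>j. cball 0 r \<subseteq> convex hull (S j)" and r: "r > 0" and q: "norm q \<le> r"
  shows "\<exists>x. (\<forall>j. x j \<in> S j) \<and> q \<in> convex hull (insert 0 (range x))"
proof -
  define Q :: "(real ^ 'd) set" where "Q = insert q (range (\<lambda>i. axis i r) \<union> range (\<lambda>i. axis i (- r)))"
  have "norm (axis i t :: real ^ 'd) = \<bar>t\<bar>" for i t
    by (simp add: norm_eq_sqrt_inner inner_axis_axis)
  then have Qball: "Q \<subseteq> cball 0 r" using q r by (auto simp: Q_def)
  have "\<exists>F. finite F \<and> F \<subseteq> S j \<and> Q \<subseteq> convex hull F" for j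
  proof -
    have "\<exists>F. finite F \<and> F \<subseteq> S j \<and> z \<in> convex hull F" if "z \<in> Q" for z
    proof -
      have "z \<in> convex hull (S j)" using S Qball that by blast
      then show ?thesis unfolding caratheodory[of "S j"] by blast
    qed
    then obtain f where f: "\<And>z. z \<in> Q \<Longrightarrow> finite (f z) \<and> f z \<subseteq> S j \<and> z \<in> convex hull (f z)" by metis
    have "finite (\<Union>(f ` Q))" using f by (auto simp: Q_def)
    moreover have "\<Union>(f ` Q) \<subseteq> S j" using f by blast
    moreover have "Q \<subseteq> convex hull (\<Union>(f ` Q))"
      using f hull_mono by (metis (no_types, opaque_lifting) UN_upper subset_eq)
    ultimately show ?thesis by blast
  qed
  then obtain F where F: "\<And>j. finite (F j)" "\<And>j. F j \<subseteq> S j" "\<And>j. Q \<subseteq> convex hull (F j)" by metis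
  define T where "T = PiE UNIV F"
  have finT: "finite T" unfolding T_def by (intro finite_PiE) (auto simp: F)
  define K where "K = (\<Union>x\<in>T. convex hull (insert 0 (range x)))"
  have "compact K" unfolding K_def
    by (intro compact_UN finT finite_imp_compact_convex_hull) auto
  then have Kclosed: "closed K" by (rule compact_imp_closed)
  have inK: "(1 - t) *\<^sub>R q \<in> K" if t: "0 < t" "t < 1" for t
  proof -
    define a where "a = (1 - t) *\<^sub>R q"
    have "\<exists>z\<in>(\<lambda>x. x - a) ` F j. z \<bullet> v > 0" if v: "v \<noteq> 0" for j v
    proof (cases "q \<bullet> v > 0")
      case True
      obtain x where x: "x \<in> F j" "x \<bullet> v \<ge> q \<bullet> v" using hull_support[of q "F j" v] F(3) by (auto simp: Q_def)
      have "a \<bullet> v < q \<bullet> v" using True t by (simp add: a_def)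
      then show ?thesis using x by (intro bexI[of _ "x - a"]) (auto simp: inner_diff_left)
    next
      case False
      obtain i where i: "v $ i \<noteq> 0" using v by (auto simp: Finite_Cartesian_Product.vec_eq_iff)
      define e where "e = axis i (if v $ i > 0 then r else - r)"
      have "e \<in> Q" by (auto simp: e_def Q_def)
      moreover have "e \<bullet> v = (if v $ i > 0 then r else - r) * v $ i" by (simp add: e_def inner_axis')
      then have "e \<bullet> v > 0" using i r by (cases "v $ i > 0") (auto simp: mult_pos_neg linorder_neq_iff)
      ultimately obtain x where x: "x \<in> F j" "x \<bullet> v > 0"
        using hull_support[of e "F j" v] F(3) by (metis in_mono less_le_trans)
      have "a \<bullet> v \<le> 0" using False t by (simp add: a_def mult_nonneg_nonpos)
      then show ?thesis using x by (intro bexI[of _ "x - a"]) (auto simp: inner_diff_left)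
    qed
    then have "\<exists>z c. (\<forall>j. z j \<in> (\<lambda>x. x - a) ` F j) \<and> (\<forall>j. c j \<ge> 0) \<and> a = (\<Sum>j\<in>UNIV. c j *\<^sub>R z j)"
      by (intro colourful_cone) (auto simp: F)
    then obtain z c where z: "\<And>j. z j \<in> (\<lambda>x. x - a) ` F j" and c: "\<And>j. c j \<ge> 0" and a: "a = (\<Sum>j\<in>UNIV. c j *\<^sub>R z j)"
      by blast
    define x where "x j = z j + a" for j
    have "x j \<in> F j" for j using z[of j] by (auto simp: x_def)
    then have x: "x \<in> T" by (simp add: T_def PiE_iff)
    \<comment> \<open>Solving \<open>a = (\<Sum>j. c j *\<^sub>R (x j - a))\<close> for \<open>a\<close>.\<close>
    define s where "s = 1 + sum c UNIV"
    have s: "s \<ge> 1" using c by (simp add: s_def sum_nonneg)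
    have "s *\<^sub>R a = (\<Sum>j\<in>UNIV. c j *\<^sub>R x j)"
      by (subst (1) s_def) (simp add: x_def scaleR_right_distrib sum.distrib scaleR_sum_left scaleR_left_distrib a[symmetric])
    then have "(1 / s) *\<^sub>R (s *\<^sub>R a) = (1 / s) *\<^sub>R (\<Sum>j\<in>UNIV. c j *\<^sub>R x j)" by simp
    then have "a = (\<Sum>j\<in>UNIV. (c j / s) *\<^sub>R x j)" using s by (simp add: scaleR_sum_right)
    moreover have "(\<Sum>j\<in>UNIV. c j / s) \<le> 1"
      using s by (simp add: sum_divide_distrib[symmetric] divide_le_eq) (simp add: s_def)
    ultimately have "a \<in> convex hull (insert 0 (range x))"
      unfolding hull_insert_0_eq using c s by (intro CollectI exI[of _ "\<lambda>j. c j / s"]) auto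
    then show ?thesis using x unfolding K_def a_def by blast
  qed
  have "(\<lambda>m. (1 - inverse (real (Suc (Suc m)))) *\<^sub>R q) \<longlonglongrightarrow> (1 - 0) *\<^sub>R q"
    by (intro tendsto_intros LIMSEQ_Suc[OF LIMSEQ_inverse_real_of_nat])
  then have "(1 - 0) *\<^sub>R q \<in> K"
    by (rule closed_sequentially[OF Kclosed, rotated]) (rule inK, auto simp: inverse_eq_divide)
  then obtain x where "x \<in> T" "q \<in> convex hull (insert 0 (range x))" by (auto simp: K_def)
  moreover from this have "\<forall>j. x j \<in> S j" using F(2) by (auto simp: T_def PiE_iff)
  ultimately show ?thesis by blast
qed

text \<open>The origin is an interior point of the hull, hence not an extreme one.\<close>
lemma cball_hull_insert_0:
  fixes Y :: "('a::euclidean_space) set"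
  assumes Y: "finite Y" and ball: "cball 0 \<rho> \<subseteq> convex hull (insert 0 Y)" and \<rho>: "\<rho> > 0"
  shows "cball 0 \<rho> \<subseteq> convex hull Y"
proof -
  have "0 \<in> convex hull Y"
  proof (rule ccontr)
    assume "0 \<notin> convex hull Y"
    then obtain a b where a: "a \<noteq> 0" "0 < b" "\<forall>x\<in>convex hull Y. inner a x > b"
      using separating_hyperplane_closed_0[of "convex hull Y"] Y
      by (auto simp: compact_imp_closed finite_imp_compact_convex_hull)
    have "inner a x > b" if "x \<in> Y" for x using a(3) hull_inc[OF that] by blast
    then have "insert 0 Y \<subseteq> {x. inner a x \<ge> 0}" using a(2) by (auto intro: less_imp_le less_trans)
    then have "convex hull (insert 0 Y) \<subseteq> {x. inner a x \<ge> 0}"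
      by (rule hull_minimal) (rule convex_halfspace_ge)
    moreover have "- (\<rho> / norm a) *\<^sub>R a \<in> cball 0 \<rho>" using \<rho> a(1) by simp
    ultimately have "inner a (- (\<rho> / norm a) *\<^sub>R a) \<ge> 0" using ball by blast
    moreover have "inner a (- (\<rho> / norm a) *\<^sub>R a) < 0" using \<rho> a(1) by simp
    ultimately show False by linarith
  qed
  then have "convex hull (insert 0 Y) \<subseteq> convex hull Y"
    by (intro hull_minimal) (auto intro: hull_inc)
  with ball show ?thesis by blast
qed

text \<open>One set suffices for the first vertex: it has a point \<open>y0\<close> of norm at least \<open>1\<close>, and \<open>Q\<close> may be rotated
  until its vertex \<open>q1\<close> lies between \<open>0\<close> and \<open>y0\<close>. Each other vertex is captured by a block of \<open>d\<close> sets.\<close>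
lemma colourful_polytope:
  fixes S :: "'k \<Rightarrow> (real ^ 'd) set" and Q :: "(real ^ 'd) set"
  assumes K: "finite K" "card K \<ge> (N - 1) * CARD('d) + 1"
    and S: "\<And>k. k \<in> K \<Longrightarrow> cball 0 1 \<subseteq> convex hull (S k)"
    and Q: "finite Q" "Q \<noteq> {}" "card Q \<le> N" "Q \<subseteq> cball 0 1" "cball 0 \<rho> \<subseteq> convex hull Q" and \<rho>: "\<rho> > 0"
  shows "\<exists>y. (\<forall>k\<in>K. y k \<in> S k) \<and> cball 0 \<rho> \<subseteq> convex hull (y ` K)"
proof -
  have "K \<noteq> {}" using K(2) by auto
  then obtain k0 where k0: "k0 \<in> K" by blast
  have "axis undefined 1 \<in> cball (0 :: real ^ 'd) 1" by simp
  then have "axis undefined 1 \<in> convex hull (S k0)" using S[OF k0] by blast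
  then obtain y0 where y0: "y0 \<in> S k0" "y0 \<bullet> axis undefined 1 \<ge> axis undefined 1 \<bullet> (axis undefined 1 :: real ^ 'd)"
    using hull_support by blast
  have "1 \<le> y0 \<bullet> axis undefined 1" using y0(2) by (simp add: inner_axis_axis)
  also have "\<dots> \<le> norm y0 * norm (axis undefined 1 :: real ^ 'd)" by (rule norm_cauchy_schwarz)
  finally have y01: "norm y0 \<ge> 1" by simp
  obtain q1 where q1: "q1 \<in> Q" using Q(2) by blast
  have "norm q1 = norm ((norm q1 / norm y0) *\<^sub>R y0)" using y01 by auto
  then obtain f where f: "orthogonal_transformation f" "f q1 = (norm q1 / norm y0) *\<^sub>R y0"
    by (rule orthogonal_transformation_exists)
  have lin: "linear f" using f(1) by (rule orthogonal_transformation_linear)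
  have normf: "norm (f q) = norm q" for q using f(1) by (rule orthogonal_transformation_norm)
  have "card ((Q - {q1}) \<times> (UNIV :: 'd set)) = (card Q - 1) * CARD('d)"
    using Q(1) q1 by (simp add: card_cartesian_product)
  also have "\<dots> \<le> (N - 1) * CARD('d)" using Q(3) by (intro mult_right_mono) auto
  also have "\<dots> \<le> card (K - {k0})" using K k0 by simp
  finally obtain g where g: "g ` ((Q - {q1}) \<times> (UNIV :: 'd set)) \<subseteq> K - {k0}" "inj_on g ((Q - {q1}) \<times> (UNIV :: 'd set))"
    using card_le_inj[of "(Q - {q1}) \<times> (UNIV :: 'd set)" "K - {k0}"] Q(1) K(1) by auto
  have "\<exists>x. (\<forall>j. x j \<in> S (g (q, j))) \<and> f q \<in> convex hull (insert 0 (range x))" if q: "q \<in> Q - {q1}" for q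
  proof (rule colourful_capture[where r = 1])
    show "cball 0 1 \<subseteq> convex hull (S (g (q, j)))" for j using g(1) q by (intro S) auto
    show "norm (f q) \<le> 1" using q Q(4) by (auto simp: normf)
  qed simp
  then obtain x where x: "\<And>q j. q \<in> Q - {q1} \<Longrightarrow> x q j \<in> S (g (q, j))"
      "\<And>q. q \<in> Q - {q1} \<Longrightarrow> f q \<in> convex hull (insert 0 (range (x q)))" by metis
  let ?P = "(Q - {q1}) \<times> (UNIV :: 'd set)"
  define y where "y k = (if k = k0 then y0 else if k \<in> g ` ?P then case_prod x (the_inv_into ?P g k) else SOME z. z \<in> S k)" for k
  have yg: "y (g (q, j)) = x q j" if "q \<in> Q - {q1}" for q j
  proof -
    have "g (q, j) \<noteq> k0" using g(1) that by blast
    moreover have "the_inv_into ?P g (g (q, j)) = (q, j)" using that by (intro the_inv_into_f_f[OF g(2)]) auto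
    moreover have "g (q, j) \<in> g ` ?P" using that by blast
    ultimately show ?thesis by (simp add: y_def)
  qed
  have yS: "y k \<in> S k" if k: "k \<in> K" for k
  proof -
    consider "k = k0" | q j where "q \<in> Q - {q1}" "k = g (q, j)" | "k \<noteq> k0" "k \<notin> g ` ?P" by auto
    then show ?thesis
    proof cases
      case 1 then show ?thesis using y0 by (simp add: y_def)
    next
      case 2 then show ?thesis using yg x(1) by simp
    next
      case 3
      have "S k \<noteq> {}" using S[OF k] by auto
      then show ?thesis using 3 by (simp add: y_def some_in_eq)
    qed
  qed
  let ?H = "convex hull (insert 0 (y ` K))"
  have fQ: "f q \<in> ?H" if q: "q \<in> Q" for q
  proof (cases "q = q1")
    case True
    have "(norm q1 / norm y0) *\<^sub>R y0 + (1 - norm q1 / norm y0) *\<^sub>R 0 \<in> ?H"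
    proof (rule convexD[OF convex_convex_hull])
      have "norm q1 \<le> 1" using Q(4) q1 by auto
      then show "0 \<le> 1 - norm q1 / norm y0" using y01 by (auto simp: divide_le_eq)
      have "y k0 = y0" by (simp add: y_def)
      then show "y0 \<in> ?H" using k0 by (intro hull_inc) auto
    qed (auto intro: hull_inc)
    then show ?thesis using True f(2) by simp
  next
    case False
    then have q': "q \<in> Q - {q1}" using q by simp
    have "range (x q) \<subseteq> y ` K"
    proof
      fix z assume "z \<in> range (x q)"
      then obtain j where "z = x q j" by blast
      then have "z = y (g (q, j))" using yg[OF q'] by simp
      moreover have "g (q, j) \<in> K" using g(1) q' by blast
      ultimately show "z \<in> y ` K" by blast
    qed
    then have "convex hull (insert 0 (range (x q))) \<subseteq> ?H" by (intro hull_mono) auto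
    then show ?thesis using x(2)[OF q'] by blast
  qed
  have "cball 0 \<rho> = f ` cball 0 \<rho>"
    using image_orthogonal_transformation_cball[OF f(1), of 0 \<rho>] linear_0[OF lin] by simp
  also have "\<dots> \<subseteq> f ` (convex hull Q)" using Q(5) by blast
  also have "\<dots> = convex hull (f ` Q)" by (rule convex_hull_linear_image[OF lin])
  also have "\<dots> \<subseteq> ?H" by (rule hull_minimal) (use fQ in auto)
  finally have "cball 0 \<rho> \<subseteq> ?H" .
  then have "cball 0 \<rho> \<subseteq> convex hull (y ` K)"
    by (rule cball_hull_insert_0[OF finite_imageI[OF K(1)] _ \<rho>])
  then show ?thesis using yS by (intro exI[of _ y] conjI ballI)
qed

text \<open>The vertices of a regular simplex have sum zero and form a tight frame, which gives the barycentric
  coordinates \<open>(1 + d * (y \<bullet> v i)) / (d + 1)\<close> of a point \<open>y\<close>. In coordinates one vertex is a multiple of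
  \<open>(1, ..., 1)\<close> and the others are obtained from the standard basis.\<close>
lemma regular_simplex_exists:
  "\<exists>Q :: (real ^ 'd) set. finite Q \<and> Q \<noteq> {} \<and> card Q \<le> CARD('d) + 1 \<and> Q \<subseteq> cball 0 1 \<and>
     cball 0 (1 / real CARD('d)) \<subseteq> convex hull Q"
proof -
  define d where "d = real CARD('d)"
  have d: "d \<ge> 1" by (simp add: d_def Suc_le_eq)
  \<comment> \<open>These values make all vertices unit vectors with sum \<open>0\<close>; see \<open>adb\<close> and \<open>key\<close>.\<close>
  define s a b where "s = sqrt (1 / d)" and "a = sqrt ((d + 1) / d)" and "b = (s - a) / d"
  have s2: "s * s = 1 / d" and a2: "a * a = (d + 1) / d" using d by (simp_all add: s_def a_def)
  have adb: "a + d * b = s" using d by (simp add: b_def)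
  have key: "2 * a * b + d * b * b = - (1 / d)"
  proof -
    have "2 * a * b + d * b * b = b * (a + (a + d * b))" by (simp add: algebra_simps)
    also have "\<dots> = (s * s - a * a) / d" unfolding adb b_def using d by (simp add: field_simps)
    also have "\<dots> = - (1 / d)" unfolding s2 a2 using d by (simp add: field_simps)
    finally show ?thesis .
  qed
  define one :: "real ^ 'd" where "one = (\<chi> j. 1)"
  define v :: "'d option \<Rightarrow> real ^ 'd" where
    "v i = (case i of None \<Rightarrow> - s *\<^sub>R one | Some i \<Rightarrow> a *\<^sub>R axis i 1 + b *\<^sub>R one)" for i
  have vN: "v None = - s *\<^sub>R one" and vS: "v (Some i) = a *\<^sub>R axis i 1 + b *\<^sub>R one" for i
    by (simp_all add: v_def)
  have oneone: "one \<bullet> one = d" by (simp add: one_def inner_vec_def d_def)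
  have axone: "axis i 1 \<bullet> one = 1" "one \<bullet> axis i 1 = 1" for i :: 'd
    by (simp_all add: inner_axis' inner_axis one_def)
  have norm1: "norm (v i) = 1" for i
  proof -
    have "v i \<bullet> v i = 1"
    proof (cases i)
      case None
      have "v i \<bullet> v i = s * s * d" by (simp add: None vN oneone)
      then show ?thesis using d by (simp add: s2)
    next
      case (Some j)
      have "v i \<bullet> v i = a * a + (2 * a * b + d * b * b)"
        by (simp add: Some vS inner_add_left inner_add_right oneone axone inner_axis_axis algebra_simps)
      then show ?thesis unfolding key a2 using d by (simp add: field_simps)
    qed
    then show ?thesis by (simp add: norm_eq_sqrt_inner)
  qed
  have sum_option: "(\<Sum>i\<in>UNIV. f i) = f None + (\<Sum>i\<in>UNIV. f (Some i))" for f :: "'d option \<Rightarrow> 'b::comm_monoid_add"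
    by (simp add: UNIV_option_conv sum.reindex)
  have comp: "v (Some i) $ j = a * of_bool (i = j) + b" "v None $ j = - s" for i j
    by (auto simp: vS vN one_def axis_def)
  have sum0: "(\<Sum>i\<in>UNIV. v i) = 0"
  proof (rule Finite_Cartesian_Product.vec_eq_iff[THEN iffD2], rule allI)
    fix j
    have "(\<Sum>i\<in>UNIV. v i) $ j = - s + (a * (\<Sum>i\<in>UNIV. of_bool (i = j)) + d * b)"
      by (simp add: sum_option comp sum.distrib sum_distrib_left d_def)
    also have "(\<Sum>i\<in>UNIV. of_bool (i = j)) = (1 :: real)" by (subst sum.remove[of _ j]) auto
    finally show "(\<Sum>i\<in>UNIV. v i) $ j = 0 $ j" using adb by simp
  qed
  have frame: "(\<Sum>i\<in>UNIV. (y \<bullet> v i) *\<^sub>R v i) = ((d + 1) / d) *\<^sub>R y" for y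
  proof (rule Finite_Cartesian_Product.vec_eq_iff[THEN iffD2], rule allI)
    fix j
    define \<sigma> where "\<sigma> = y \<bullet> one"
    have \<sigma>: "\<sigma> = (\<Sum>i\<in>UNIV. y $ i)" by (simp add: \<sigma>_def one_def inner_vec_def)
    have ys: "y \<bullet> v (Some i) = a * y $ i + b * \<sigma>" "y \<bullet> v None = - s * \<sigma>" for i
      by (simp_all add: vS vN inner_add_right inner_axis \<sigma>_def)
    have "(\<Sum>i\<in>UNIV. (y \<bullet> v i) *\<^sub>R v i) $ j
        = s * s * \<sigma> + (\<Sum>i\<in>UNIV. (a * y $ i + b * \<sigma>) * (a * of_bool (i = j) + b))"
      by (simp add: sum_option comp ys)
    also have "(\<Sum>i\<in>UNIV. (a * y $ i + b * \<sigma>) * (a * of_bool (i = j) + b)) =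
        (\<Sum>i\<in>UNIV. of_bool (i = j) * (a * (a * y $ i + b * \<sigma>))) + (\<Sum>i\<in>UNIV. b * (a * y $ i + b * \<sigma>))"
      unfolding sum.distrib[symmetric] by (rule sum.cong[OF refl]) (simp add: algebra_simps)
    also have "(\<Sum>i\<in>UNIV. of_bool (i = j) * (a * (a * y $ i + b * \<sigma>))) = a * (a * y $ j + b * \<sigma>)"
      by (subst sum.remove[of _ j]) auto
    also have "(\<Sum>i\<in>UNIV. b * (a * y $ i + b * \<sigma>)) = b * (a * \<sigma> + d * (b * \<sigma>))"
      by (simp add: \<sigma> sum.distrib sum_distrib_left[symmetric] d_def)
    also have "s * s * \<sigma> + (a * (a * y $ j + b * \<sigma>) + b * (a * \<sigma> + d * (b * \<sigma>)))
        = a * a * y $ j + (s * s + (2 * a * b + d * b * b)) * \<sigma>" by (simp add: algebra_simps)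
    also have "\<dots> = (((d + 1) / d) *\<^sub>R y) $ j" unfolding key s2 a2 by simp
    finally show "(\<Sum>i\<in>UNIV. (y \<bullet> v i) *\<^sub>R v i) $ j = (((d + 1) / d) *\<^sub>R y) $ j" .
  qed
  have "y \<in> convex hull (range v)" if y: "norm y \<le> 1 / d" for y
  proof -
    define l where "l i = (1 + d * (y \<bullet> v i)) / (d + 1)" for i
    have "l i \<ge> 0" for i
    proof -
      have "\<bar>y \<bullet> v i\<bar> \<le> norm y * norm (v i)" by (rule Cauchy_Schwarz_ineq2)
      then have "- (1 / d) \<le> y \<bullet> v i" using y norm1[of i] by simp
      then have "- 1 \<le> d * (y \<bullet> v i)" using d by (simp add: field_simps)
      then show ?thesis using d by (simp add: l_def)
    qed
    moreover have "(\<Sum>i\<in>UNIV. l i) = 1"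
    proof -
      have "(\<Sum>i\<in>UNIV. l i) = ((\<Sum>i\<in>(UNIV :: 'd option set). 1) + d * (\<Sum>i\<in>UNIV. y \<bullet> v i)) / (d + 1)"
        by (simp only: l_def sum_divide_distrib[symmetric] sum.distrib sum_distrib_left)
      also have "(\<Sum>i\<in>UNIV. y \<bullet> v i) = 0" using sum0 by (simp add: inner_sum_right[symmetric])
      also have "(\<Sum>i\<in>(UNIV :: 'd option set). 1) = 1 + d" unfolding sum_option by (simp add: d_def)
      finally show ?thesis using d by simp
    qed
    ultimately have "(\<Sum>i\<in>UNIV. l i *\<^sub>R v i) \<in> convex hull (range v)"
      by (intro convex_sum) (auto intro: hull_inc)
    also have "(\<Sum>i\<in>UNIV. l i *\<^sub>R v i) = (1 / (d + 1)) *\<^sub>R (\<Sum>i\<in>UNIV. v i) + (d / (d + 1)) *\<^sub>R (\<Sum>i\<in>UNIV. (y \<bullet> v i) *\<^sub>R v i)"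
      unfolding scaleR_sum_right sum.distrib[symmetric]
      by (rule sum.cong[OF refl]) (simp add: l_def add_divide_distrib scaleR_left_distrib)
    also have "\<dots> = y" unfolding sum0 frame using d by simp
    finally show ?thesis .
  qed
  moreover have "card (range v) \<le> CARD('d) + 1"
    using card_image_le[of "UNIV :: 'd option set" v] by (simp add: card_UNIV_option)
  ultimately show ?thesis
    using norm1 unfolding d_def by (intro exI[of _ "range v"]) auto
qed

text \<open>Bang's lemma: the longest signed sum of the unit vectors will do, because flipping a sign must not
  make it longer.\<close>
lemma bang_avoid_hyperplanes:
  fixes \<nu> :: "'i \<Rightarrow> 'a::real_inner"
  assumes I: "finite I" and unit: "\<And>i. i \<in> I \<Longrightarrow> norm (\<nu> i) = 1"
  shows "\<exists>z. norm z \<le> real (card I) \<and> (\<forall>i\<in>I. \<bar>z \<bullet> \<nu> i\<bar> \<ge> 1)"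
proof -
  define E where "E = PiE I (\<lambda>_. {-1, 1 :: real})"
  define Z where "Z \<epsilon> = (\<Sum>i\<in>I. \<epsilon> i *\<^sub>R \<nu> i)" for \<epsilon>
  have fin: "finite E" unfolding E_def using I by (intro finite_PiE) auto
  have ne: "E \<noteq> {}" unfolding E_def by (simp add: PiE_eq_empty_iff)
  have "Max ((\<lambda>\<epsilon>. norm (Z \<epsilon>)) ` E) \<in> (\<lambda>\<epsilon>. norm (Z \<epsilon>)) ` E" using fin ne by (intro Max_in) auto
  then obtain \<epsilon> where \<epsilon>: "\<epsilon> \<in> E" and eq: "norm (Z \<epsilon>) = Max ((\<lambda>\<epsilon>. norm (Z \<epsilon>)) ` E)" by auto
  have max: "norm (Z \<epsilon>') \<le> norm (Z \<epsilon>)" if "\<epsilon>' \<in> E" for \<epsilon>'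
    unfolding eq using fin that by (intro Max_ge) auto
  have \<epsilon>1: "\<epsilon> i = -1 \<or> \<epsilon> i = 1" if "i \<in> I" for i using \<epsilon> that by (auto simp: E_def PiE_iff)
  have "norm (Z \<epsilon>) \<le> (\<Sum>i\<in>I. 1)"
    unfolding Z_def
  proof (rule sum_norm_le)
    fix i assume i: "i \<in> I"
    have "\<bar>\<epsilon> i\<bar> = 1" using \<epsilon>1[OF i] by auto
    then show "norm (\<epsilon> i *\<^sub>R \<nu> i) \<le> 1" using unit[OF i] by simp
  qed
  moreover have "\<bar>Z \<epsilon> \<bullet> \<nu> k\<bar> \<ge> 1" if k: "k \<in> I" for k
  proof -
    define \<epsilon>' where "\<epsilon>' = \<epsilon>(k := - \<epsilon> k)"
    have "\<epsilon>' \<in> E" using \<epsilon> k by (auto simp: E_def \<epsilon>'_def PiE_iff extensional_def)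
    moreover have Z': "Z \<epsilon>' = Z \<epsilon> - (2 * \<epsilon> k) *\<^sub>R \<nu> k"
    proof -
      have "Z \<epsilon>' = (- \<epsilon> k) *\<^sub>R \<nu> k + (\<Sum>i\<in>I - {k}. \<epsilon> i *\<^sub>R \<nu> i)"
        unfolding Z_def by (subst sum.remove[OF I k]) (auto simp: \<epsilon>'_def intro!: sum.cong)
      moreover have "Z \<epsilon> = \<epsilon> k *\<^sub>R \<nu> k + (\<Sum>i\<in>I - {k}. \<epsilon> i *\<^sub>R \<nu> i)"
        unfolding Z_def by (rule sum.remove[OF I k])
      moreover have "(2 * \<epsilon> k) *\<^sub>R \<nu> k = \<epsilon> k *\<^sub>R \<nu> k + \<epsilon> k *\<^sub>R \<nu> k"
        by (simp add: scaleR_left_distrib[symmetric])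
      ultimately show ?thesis by simp
    qed
    ultimately have "norm (Z \<epsilon> - (2 * \<epsilon> k) *\<^sub>R \<nu> k) \<le> norm (Z \<epsilon>)" using max by metis
    then have "(Z \<epsilon> - (2 * \<epsilon> k) *\<^sub>R \<nu> k) \<bullet> (Z \<epsilon> - (2 * \<epsilon> k) *\<^sub>R \<nu> k) \<le> Z \<epsilon> \<bullet> Z \<epsilon>"
      by (simp add: norm_le)
    moreover have "\<nu> k \<bullet> \<nu> k = 1" using unit[OF k] by (simp add: norm_eq_1)
    ultimately have "4 * (\<epsilon> k * \<epsilon> k) \<le> 4 * (\<epsilon> k * (Z \<epsilon> \<bullet> \<nu> k))"
      by (simp add: inner_diff_left inner_diff_right inner_commute algebra_simps)
    then show ?thesis using \<epsilon>1[OF k] by auto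
  qed
  ultimately show ?thesis by (intro exI[of _ "Z \<epsilon>"]) auto
qed

lemma common_normal:
  fixes z :: "'d::finite \<Rightarrow> real ^ 'd"
  shows "\<exists>\<nu>. norm \<nu> = 1 \<and> (\<forall>j. j \<noteq> j0 \<longrightarrow> \<nu> \<bullet> z j = 0)"
proof -
  define B :: "real ^ 'd ^ 'd" where "B = (\<chi> i. if i = j0 then 0 else z i)"
  have "Finite_Cartesian_Product.row j0 B = 0"
    by (simp add: Finite_Cartesian_Product.row_def B_def Finite_Cartesian_Product.vec_eq_iff)
  then have "Determinants.det B = 0" by (rule det_zero_row(1))
  then obtain \<mu> where \<mu>: "\<mu> \<noteq> 0" "B *v \<mu> = 0" using det_0_iff_kernel by blast
  have "\<mu> \<bullet> z j = 0" if "j \<noteq> j0" for j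
  proof -
    have "(B *v \<mu>) $ j = z j \<bullet> \<mu>" using that by (simp add: matrix_vector_mult_def B_def inner_vec_def)
    then show ?thesis using \<mu>(2) by (simp add: inner_commute)
  qed
  then show ?thesis using \<mu>(1) by (intro exI[of _ "(1 / norm \<mu>) *\<^sub>R \<mu>"]) auto
qed

text \<open>A point \<open>q + u\<close> with \<open>u\<close> no longer than \<open>\<delta>\<close> has nonnegative coefficients \<open>l j + \<mu> j\<close>, since \<open>q\<close> is at
  distance at least \<open>\<delta>\<close> from the walls of the cone. The same holds for \<open>q - u\<close>, so \<open>\<mu> j \<le> l j\<close> and the sum of the
  coefficients of \<open>q + u\<close> is at most \<open>2\<close>. Halving puts it into the simplex.\<close>
lemma deep_point_ball:
  fixes x \<nu> :: "'d::finite \<Rightarrow> real ^ 'd"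
  assumes q: "q \<in> convex hull (insert 0 (range x))"
    and orth: "\<And>i j. i \<noteq> j \<Longrightarrow> \<nu> i \<bullet> x j = 0" and unit: "\<And>i. norm (\<nu> i) = 1"
    and deep: "\<And>i. \<bar>q \<bullet> \<nu> i\<bar> \<ge> \<delta>" and \<delta>: "\<delta> > 0"
  shows "cball ((1 / 2) *\<^sub>R q) (\<delta> / 2) \<subseteq> convex hull (insert 0 (range x))"
proof
  obtain l where l: "q = (\<Sum>j\<in>UNIV. l j *\<^sub>R x j)" "\<forall>j. l j \<ge> 0" "sum l UNIV \<le> 1"
    using q unfolding hull_insert_0_eq by blast
  have proj: "\<nu> i \<bullet> (\<Sum>j\<in>UNIV. m j *\<^sub>R x j) = m i * (\<nu> i \<bullet> x i)" for m i
  proof -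
    have "\<nu> i \<bullet> (\<Sum>j\<in>UNIV. m j *\<^sub>R x j) = (\<Sum>j\<in>UNIV. if j = i then m i * (\<nu> i \<bullet> x i) else 0)"
      unfolding inner_sum_right by (rule sum.cong[OF refl]) (use orth in auto)
    then show ?thesis by simp
  qed
  have nz: "\<nu> i \<bullet> x i \<noteq> 0" for i
    using deep[of i] \<delta> proj[of i l] l(1) by (auto simp: inner_commute)
  define A :: "real ^ 'd ^ 'd" where "A = (\<chi> i j. x j $ i)"
  have Av: "A *v \<mu> = (\<Sum>j\<in>UNIV. \<mu> $ j *\<^sub>R x j)" for \<mu>
    by (simp add: Finite_Cartesian_Product.vec_eq_iff A_def matrix_vector_mult_def mult.commute)
  have "\<mu> = 0" if "A *v \<mu> = 0" for \<mu>
  proof -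
    have "\<mu> $ i * (\<nu> i \<bullet> x i) = 0" for i using proj[of i "\<lambda>j. \<mu> $ j"] that by (simp add: Av)
    then show ?thesis using nz by (simp add: Finite_Cartesian_Product.vec_eq_iff)
  qed
  then have "Determinants.det A \<noteq> 0" using det_0_iff_kernel[of A] by blast
  then have "invertible A" by (simp add: invertible_det_nz)
  then obtain B where B: "A ** B = mat 1" using invertible_right_inverse by blast
  fix w assume "w \<in> cball ((1 / 2) *\<^sub>R q) (\<delta> / 2)"
  then have w: "norm (w - (1 / 2) *\<^sub>R q) \<le> \<delta> / 2" by (simp add: dist_norm norm_minus_commute)
  define u where "u = 2 *\<^sub>R (w - (1 / 2) *\<^sub>R q)"
  have u: "norm u \<le> \<delta>" using w by (simp add: u_def)
  define \<mu> where "\<mu> = B *v u"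
  have "A *v \<mu> = u" unfolding \<mu>_def by (simp add: matrix_vector_mul_assoc B)
  then have u\<mu>: "u = (\<Sum>j\<in>UNIV. \<mu> $ j *\<^sub>R x j)" by (simp add: Av)
  have bound: "\<bar>\<mu> $ i\<bar> \<le> l i" for i
  proof -
    have "\<bar>\<nu> i \<bullet> u\<bar> \<le> norm (\<nu> i) * norm u" by (rule Cauchy_Schwarz_ineq2)
    then have "\<bar>\<nu> i \<bullet> u\<bar> \<le> \<bar>\<nu> i \<bullet> q\<bar>" using u unit deep[of i] by (simp add: inner_commute)
    then have "\<bar>\<mu> $ i\<bar> * \<bar>\<nu> i \<bullet> x i\<bar> \<le> l i * \<bar>\<nu> i \<bullet> x i\<bar>"
      unfolding u\<mu> l(1) proj by (simp add: abs_mult l(2))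
    then show ?thesis using nz[of i] by simp
  qed
  have "w = (\<Sum>j\<in>UNIV. ((l j + \<mu> $ j) / 2) *\<^sub>R x j)"
  proof -
    have "w = (1 / 2) *\<^sub>R (q + u)" by (simp add: u_def algebra_simps)
    also have "q + u = (\<Sum>j\<in>UNIV. (l j + \<mu> $ j) *\<^sub>R x j)"
      unfolding u\<mu> l(1) by (simp add: scaleR_left_distrib sum.distrib)
    finally show ?thesis by (simp add: scaleR_sum_right)
  qed
  moreover have "\<forall>j. (l j + \<mu> $ j) / 2 \<ge> 0"
  proof
    fix j show "(l j + \<mu> $ j) / 2 \<ge> 0" using abs_le_D2[OF bound[of j]] by simp
  qed
  moreover have "(\<Sum>j\<in>UNIV. (l j + \<mu> $ j) / 2) \<le> 1"
  proof -
    have "(\<Sum>j\<in>UNIV. (l j + \<mu> $ j) / 2) \<le> (\<Sum>j\<in>UNIV. l j)"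
      by (rule sum_mono) (use bound in \<open>auto simp: abs_le_iff\<close>)
    with l(3) show ?thesis by linarith
  qed
  ultimately show "w \<in> convex hull (insert 0 (range x))" unfolding hull_insert_0_eq
    by (intro CollectI exI[of _ "\<lambda>j. (l j + \<mu> $ j) / 2"] conjI)
qed

lemma steinitz_constant_bound:
  assumes "d \<ge> 2"
  shows "pi / exp 1 ^ 2 * real d powr (- 2 * real d - 2) \<le> 1 / real d / real (d * (d\<^sup>2 + 1) ^ (d - 1)) / 4"
proof -
  define D where "D = real d"
  have D: "D \<ge> 2" using assms by (simp add: D_def)
  have e: "exp 1 \<ge> (5 / 2 :: real)"
    using exp_lower_Taylor_quadratic[of 1] by simp
  have "exp 1 ^ 2 \<ge> (5 / 2 :: real) ^ 2" by (rule power_mono[OF e]) simp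
  then have "pi / exp 1 ^ 2 \<le> pi / (5 / 2) ^ 2" by (intro divide_left_mono) auto
  also have "\<dots> \<le> 13 / 20"
    using pi_less_4 by (simp add: power2_eq_square)
  finally have c: "pi / exp 1 ^ 2 \<le> 13 / 20" .
  have pw: "D powr (- 2 * D - 2) = 1 / D ^ (2 * d + 2)"
  proof -
    have "- 2 * D - 2 = - real (2 * d + 2)" by (simp add: D_def)
    then have "D powr (- 2 * D - 2) = D powr (- real (2 * d + 2))" by (simp only:)
    also have "\<dots> = inverse (D powr real (2 * d + 2))" by (rule powr_minus)
    also have "\<dots> = 1 / D ^ (2 * d + 2)" using D by (subst powr_realpow) (auto simp: inverse_eq_divide)
    finally show ?thesis .
  qed
  have bern: "(D\<^sup>2 + 1) ^ (d - 1) \<le> 5 / 4 * (D\<^sup>2) ^ (d - 1)"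
  proof -
    define h where "h = 1 / (D\<^sup>2 + 1)"
    have hpos: "D\<^sup>2 + 1 > 0" by (simp add: add_nonneg_pos)
    have h1: "h \<le> 1" using hpos by (simp add: h_def)
    have "1 + real (d - 1) * (- h) \<le> (1 + (- h)) ^ (d - 1)"
      by (rule Bernoulli_inequality) (use h1 in simp)
    moreover have "real (d - 1) * h \<le> 1 / 5"
    proof -
      \<comment> \<open>This is \<open>5 (d - 1) \<le> d^2 + 1\<close>, and it holds because \<open>d\<close> is an integer.\<close>
      have "(D - 2) * (D - 3) \<ge> 0"
      proof (cases "d = 2")
        case False
        then have "d \<ge> 3" using assms by simp
        then have "D \<ge> 3" by (simp add: D_def)
        then show ?thesis by simp
      qed (simp add: D_def)
      then have "5 * (D - 1) \<le> D\<^sup>2 + 1" by (simp add: power2_eq_square algebra_simps)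
      moreover have "real (d - 1) = D - 1" using assms by (simp add: D_def of_nat_diff)
      ultimately show ?thesis using hpos by (simp add: h_def divide_le_eq)
    qed
    ultimately have "4 / 5 \<le> (1 - h) ^ (d - 1)" by simp
    also have "1 - h = D\<^sup>2 / (D\<^sup>2 + 1)" using hpos by (simp add: h_def divide_simps)
    finally have "4 / 5 \<le> (D\<^sup>2) ^ (d - 1) / (D\<^sup>2 + 1) ^ (d - 1)" by (simp add: power_divide)
    moreover have "(D\<^sup>2 + 1) ^ (d - 1) > 0" using hpos by (rule zero_less_power)
    ultimately show ?thesis by (simp add: le_divide_eq)
  qed
  have "2 * d + 2 = 2 * (d - 1) + 2 + 2" using assms by simp
  then have p2: "D ^ (2 * d + 2) = (D\<^sup>2) ^ (d - 1) * D\<^sup>2 * D\<^sup>2"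
    by (simp only: power_add power_mult)
  have pos: "(D\<^sup>2 + 1) ^ (d - 1) > 0" "D\<^sup>2 > 0" using D by (auto intro!: add_pos_pos zero_less_power)
  have "pi / exp 1 ^ 2 * (1 / D ^ (2 * d + 2)) \<le> 13 / 20 * (1 / D ^ (2 * d + 2))"
    using D by (intro mult_right_mono c) auto
  also have "\<dots> \<le> 1 / (4 * D\<^sup>2 * (D\<^sup>2 + 1) ^ (d - 1))"
  proof -
    have "13 / 20 * (4 * D\<^sup>2 * (D\<^sup>2 + 1) ^ (d - 1)) = 13 / 5 * D\<^sup>2 * (D\<^sup>2 + 1) ^ (d - 1)" by simp
    also have "\<dots> \<le> 13 / 5 * D\<^sup>2 * (5 / 4 * (D\<^sup>2) ^ (d - 1))"
      by (intro mult_left_mono bern) simp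
    also have "\<dots> = (D\<^sup>2) ^ (d - 1) * D\<^sup>2 * (13 / 4)" by simp
    also have "\<dots> \<le> (D\<^sup>2) ^ (d - 1) * D\<^sup>2 * D\<^sup>2"
    proof -
      have "2\<^sup>2 \<le> D\<^sup>2" using D by (intro power_mono) auto
      then show ?thesis by (intro mult_left_mono) auto
    qed
    finally have le: "13 / 20 * (4 * D\<^sup>2 * (D\<^sup>2 + 1) ^ (d - 1)) \<le> D ^ (2 * d + 2)" unfolding p2 .
    have "0 < 4 * D\<^sup>2 * (D\<^sup>2 + 1) ^ (d - 1)" "0 < D ^ (2 * d + 2)"
      using D by (simp_all add: mult_pos_pos[OF pos(2,1)] mult.assoc del: One_nat_def)
    with le show ?thesis by (simp only: times_divide_eq_right mult_1_right pos_divide_le_eq pos_le_divide_eq mult_1 divide_divide_eq_left times_divide_eq_left)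
  qed
  also have "\<dots> = 1 / D / (D * (D\<^sup>2 + 1) ^ (d - 1)) / 4" by (simp add: power2_eq_square)
  finally show ?thesis unfolding pw[symmetric] by (simp add: D_def add.commute)
qed

text \<open>Half of the sets are replaced by subsets of \<open>M = d^2 + 1\<close> points whose hulls contain the ball of
  radius \<open>1 / d\<close>, by \<open>colourful_polytope\<close> for a regular simplex and for copies of one set. Any \<open>d - 1\<close> of
  these points from different sets span one of at most \<open>d * M^(d - 1)\<close> hyperplanes through \<open>0\<close>. A point \<open>q\<close>
  with distance at least \<open>\<delta>\<close> from all of them is captured by one point of each set, which then
  surround a ball about \<open>q / 2\<close>. Together with \<open>- q\<close>, captured by the other half, they surround a
  ball about \<open>0\<close>. In dimension one \<open>colourful_polytope\<close> already yields the whole unit ball.\<close>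
lemma colourful_steinitz:
  fixes S :: "'k \<Rightarrow> (real ^ 'd) set"
  assumes K: "finite K" "card K \<ge> 2 * CARD('d)"
    and S: "\<And>k. k \<in> K \<Longrightarrow> cball 0 1 \<subseteq> convex hull (S k)"
  shows "\<exists>y. (\<forall>k\<in>K. y k \<in> S k) \<and>
    cball 0 (pi / exp 1 ^ 2 * real CARD('d) powr (- 2 * real CARD('d) - 2)) \<subseteq> convex hull (y ` K)"
proof -
  let ?d = "CARD('d)"
  have d0: "?d > 0" by simp
  obtain Q :: "(real ^ 'd) set" where Q: "finite Q" "Q \<noteq> {}" "card Q \<le> ?d + 1" "Q \<subseteq> cball 0 1"
      "cball 0 (1 / real ?d) \<subseteq> convex hull Q"
    using regular_simplex_exists by blast
  show ?thesis
  proof (cases "?d = 1")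
    case True
    obtain y where y: "\<forall>k\<in>K. y k \<in> S k" "cball 0 (1 / real ?d) \<subseteq> convex hull (y ` K)"
      using colourful_polytope[OF K(1) _ S Q, of id] K(2) True by auto
    have "exp 1 \<ge> (5 / 2 :: real)" using exp_lower_Taylor_quadratic[of 1] by simp
    then have "exp 1 ^ 2 \<ge> (5 / 2 :: real) ^ 2" by (rule power_mono) simp
    then have "pi \<le> exp 1 ^ 2" using pi_less_4 by (simp add: power2_eq_square)
    then have "pi / exp 1 ^ 2 * real ?d powr (- 2 * real ?d - 2) \<le> 1 / real ?d"
      unfolding True by simp
    then have "cball 0 (pi / exp 1 ^ 2 * real ?d powr (- 2 * real ?d - 2)) \<subseteq> cball (0 :: real ^ 'd) (1 / real ?d)"
      by (rule subset_cball)
    then have "cball 0 (pi / exp 1 ^ 2 * real ?d powr (- 2 * real ?d - 2)) \<subseteq> convex hull (y ` K)"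
      using y(2) by (rule order_trans)
    with y(1) show ?thesis by (intro exI[of _ y] conjI)
  next
    case False
    then have d2: "?d \<ge> 2" using d0 by linarith
    define \<sigma> where "\<sigma> = 1 / real ?d"
    have \<sigma>: "0 < \<sigma>" "\<sigma> \<le> 1" using d2 by (simp_all add: \<sigma>_def)
    have "card (UNIV :: ('d \<times> bool) set) \<le> card K" using K(2) by (simp add: card_UNIV_bool mult.commute)
    then obtain g :: "'d \<times> bool \<Rightarrow> 'k" where g: "range g \<subseteq> K" "inj g"
      using card_le_inj[of "UNIV :: ('d \<times> bool) set" K] K(1) by auto
    have gK: "g i \<in> K" for i using g(1) by blast
    define M where "M = ?d\<^sup>2 + 1"
    have "\<exists>F. finite F \<and> F \<subseteq> S (g (j, True)) \<and> card F \<le> M \<and> cball 0 \<sigma> \<subseteq> convex hull F" for j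
    proof -
      have "\<exists>y. (\<forall>k\<in>{..<M}. y k \<in> S (g (j, True))) \<and> cball 0 \<sigma> \<subseteq> convex hull (y ` {..<M})"
      proof (rule colourful_polytope[OF _ _ _ Q(1-4)])
        show "(?d + 1 - 1) * ?d + 1 \<le> card {..<M}" by (simp add: M_def power2_eq_square)
      qed (use Q(5) \<sigma> S[OF gK] in \<open>auto simp: \<sigma>_def\<close>)
      then obtain y where y: "\<forall>k\<in>{..<M}. y k \<in> S (g (j, True))" "cball 0 \<sigma> \<subseteq> convex hull (y ` {..<M})" by blast
      have "card (y ` {..<M}) \<le> M" using card_image_le[of "{..<M}" y] by simp
      then show ?thesis using y by (intro exI[of _ "y ` {..<M}"]) auto
    qed
    then obtain F where F: "\<And>j. finite (F j)" "\<And>j. F j \<subseteq> S (g (j, True))" "\<And>j. card (F j) \<le> M"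
        "\<And>j. cball 0 \<sigma> \<subseteq> convex hull (F j)" by metis
    define I where "I = Sigma (UNIV :: 'd set) (\<lambda>j0. PiE (UNIV - {j0}) F)"
    have finI: "finite I" unfolding I_def by (intro finite_SigmaI finite_PiE) (auto simp: F)
    define L where "L = ?d * M ^ (?d - 1)"
    have cardI: "card I \<le> L"
    proof -
      have "card I = (\<Sum>j0\<in>(UNIV :: 'd set). card (PiE (UNIV - {j0}) F))"
        unfolding I_def by (rule card_SigmaI) (auto intro!: finite_PiE simp: F)
      also have "\<dots> \<le> (\<Sum>j0\<in>(UNIV :: 'd set). M ^ (?d - 1))"
      proof (rule sum_mono)
        fix j0 :: 'd
        have "card (PiE (UNIV - {j0}) F) = (\<Prod>j\<in>UNIV - {j0}. card (F j))" by (rule card_PiE) simp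
        also have "\<dots> \<le> (\<Prod>j\<in>UNIV - {j0}. M)" by (rule prod_mono) (auto simp: F)
        also have "\<dots> = M ^ (?d - 1)" by simp
        finally show "card (PiE (UNIV - {j0}) F) \<le> M ^ (?d - 1)" .
      qed
      finally show ?thesis by (simp add: L_def)
    qed
    have L0: "L > 0" using d0 by (simp add: L_def M_def)
    have "\<exists>\<nu>. norm \<nu> = 1 \<and> (\<forall>j. j \<noteq> fst i \<longrightarrow> \<nu> \<bullet> snd i j = 0)" for i :: "'d \<times> ('d \<Rightarrow> real ^ 'd)"
      by (rule common_normal)
    then obtain \<nu> :: "'d \<times> ('d \<Rightarrow> real ^ 'd) \<Rightarrow> real ^ 'd" where
        \<nu>: "\<And>i. norm (\<nu> i) = 1" "\<And>i j. j \<noteq> fst i \<Longrightarrow> \<nu> i \<bullet> snd i j = 0" by metis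
    \<comment> \<open>A point \<open>q\<close> of the small ball that is far from all hyperplanes, by scaling the point of Bang.\<close>
    obtain z where z: "norm z \<le> real (card I)" "\<And>i. i \<in> I \<Longrightarrow> \<bar>z \<bullet> \<nu> i\<bar> \<ge> 1"
      using bang_avoid_hyperplanes[OF finI, of \<nu>] \<nu>(1) by blast
    define \<delta> where "\<delta> = \<sigma> / real L"
    have \<delta>: "\<delta> > 0" using \<sigma> L0 by (simp add: \<delta>_def)
    define q where "q = \<delta> *\<^sub>R z"
    have qn: "norm q \<le> \<sigma>"
    proof -
      have "norm q \<le> \<delta> * real L" using z(1) cardI \<delta> by (simp add: q_def)
      then show ?thesis using L0 by (simp add: \<delta>_def)
    qed
    have deep: "\<bar>q \<bullet> \<nu> i\<bar> \<ge> \<delta>" if "i \<in> I" for i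
      using z(2)[OF that] \<delta> by (simp add: q_def abs_mult)
    obtain x where x: "\<And>j. x j \<in> F j" "q \<in> convex hull (insert 0 (range x))"
      using colourful_capture[where S = F and r = \<sigma>, OF F(4) \<sigma>(1) qn] by blast
    have ball1: "cball ((1 / 2) *\<^sub>R q) (\<delta> / 2) \<subseteq> convex hull (insert 0 (range x))"
    proof (rule deep_point_ball[where \<nu> = "\<lambda>i. \<nu> (i, restrict x (UNIV - {i}))"])
      show "\<nu> (i, restrict x (UNIV - {i})) \<bullet> x j = 0" if "i \<noteq> j" for i j
        using \<nu>(2)[of j "(i, restrict x (UNIV - {i}))"] that by simp
      show "\<delta> \<le> \<bar>q \<bullet> \<nu> (i, restrict x (UNIV - {i}))\<bar>" for i
        by (rule deep) (auto simp: I_def x(1))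
    qed (use x(2) \<nu>(1) \<delta> in auto)
    have S2: "cball 0 1 \<subseteq> convex hull (S (g (j, False)))" for j by (rule S[OF gK])
    have "norm (- q) \<le> 1" using qn \<sigma>(2) by simp
    then obtain x' where x': "\<And>j. x' j \<in> S (g (j, False))" "- q \<in> convex hull (insert 0 (range x'))"
      using colourful_capture[where S = "\<lambda>j. S (g (j, False))" and r = 1 and q = "- q", OF S2] by auto
    define y where "y k = (if k \<in> range g then (case the_inv g k of (j, b) \<Rightarrow> if b then x j else x' j) else SOME z. z \<in> S k)" for k
    have yg: "y (g (j, b)) = (if b then x j else x' j)" for j b
      using g(2) by (simp add: y_def the_inv_f_f)
    have yS: "y k \<in> S k" if k: "k \<in> K" for k
    proof (cases "k \<in> range g")
      case True
      then obtain j b where "k = g (j, b)" by auto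
      then show ?thesis using yg[of j b] x(1)[of j] F(2)[of j] x'(1)[of j] by (cases b) auto
    next
      case False
      have "S k \<noteq> {}" using S[OF k] by auto
      then show ?thesis using False by (simp add: y_def some_in_eq)
    qed
    let ?H = "convex hull (insert 0 (y ` K))"
    have "range x \<subseteq> y ` K" "range x' \<subseteq> y ` K"
      using yg[of _ True] yg[of _ False] gK by (auto simp: image_iff) metis+
    then have H1: "convex hull (insert 0 (range x)) \<subseteq> ?H" and H2: "convex hull (insert 0 (range x')) \<subseteq> ?H"
      by (auto intro!: hull_mono)
    have "cball 0 (\<delta> / 4) \<subseteq> ?H"
    proof
      fix w :: "real ^ 'd" assume "w \<in> cball 0 (\<delta> / 4)"
      then have "(1 / 2) *\<^sub>R q + 2 *\<^sub>R w \<in> cball ((1 / 2) *\<^sub>R q) (\<delta> / 2)" by (simp add: dist_norm)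
      then have a: "(1 / 2) *\<^sub>R q + 2 *\<^sub>R w \<in> ?H" using ball1 H1 by blast
      have "(1 / 2) *\<^sub>R (- q) + (1 / 2) *\<^sub>R 0 \<in> ?H"
        using x'(2) H2 by (intro convexD[OF convex_convex_hull]) (auto intro: hull_inc)
      then have b: "- ((1 / 2) *\<^sub>R q) \<in> ?H" by simp
      have "(1 / 2) *\<^sub>R ((1 / 2) *\<^sub>R q + 2 *\<^sub>R w) + (1 / 2) *\<^sub>R (- ((1 / 2) *\<^sub>R q)) \<in> ?H"
        by (rule convexD[OF convex_convex_hull a b]) auto
      then show "w \<in> ?H" by (simp add: algebra_simps)
    qed
    then have small: "cball 0 (\<delta> / 4) \<subseteq> convex hull (y ` K)"
      using \<delta> by (intro cball_hull_insert_0[OF finite_imageI[OF K(1)]]) simp_all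
    have "pi / exp 1 ^ 2 * real ?d powr (- 2 * real ?d - 2) \<le> \<delta> / 4"
      using steinitz_constant_bound[OF d2] by (simp add: \<delta>_def \<sigma>_def L_def M_def)
    then have "cball 0 (pi / exp 1 ^ 2 * real ?d powr (- 2 * real ?d - 2)) \<subseteq> cball (0 :: real ^ 'd) (\<delta> / 4)"
      by (rule subset_cball)
    then have "cball 0 (pi / exp 1 ^ 2 * real ?d powr (- 2 * real ?d - 2)) \<subseteq> convex hull (y ` K)"
      using small by (rule order_trans)
    with yS show ?thesis by (intro exI[of _ y] conjI ballI)
  qed
qed

section \<open>Approximation of symmetric bodies by polytopes\<close>

text \<open>Compare the minima of a linear form \<open>a\<close> on both sides. If \<open>z\<close> minimizes it on \<open>K\<close>, then
  \<open>z = y + \<delta> k\<close> with \<open>y\<close> in \<open>X\<close> and \<open>k\<close> in \<open>K\<close>, so the minimum on \<open>X\<close> is at most \<open>1 - \<delta>\<close> times the minimum on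
  \<open>K\<close>.\<close>
lemma separated_net_covers:
  fixes K :: "('a::euclidean_space) set"
  assumes K: "compact K" and X: "finite X" and cover: "\<And>x. x \<in> K \<Longrightarrow> \<exists>y\<in>X. x - y \<in> (\<lambda>z. \<delta> *\<^sub>R z) ` K"
    and \<delta>: "0 < \<delta>" "\<delta> < 1"
  shows "K \<subseteq> (\<lambda>x. (1 / (1 - \<delta>)) *\<^sub>R x) ` (convex hull X)"
proof
  fix x assume x: "x \<in> K"
  have "(1 - \<delta>) *\<^sub>R x \<in> convex hull X"
  proof (rule ccontr)
    assume "(1 - \<delta>) *\<^sub>R x \<notin> convex hull X"
    moreover have "closed (convex hull X)" using X by (simp add: compact_imp_closed finite_imp_compact_convex_hull)
    ultimately obtain a b where ab: "a \<bullet> ((1 - \<delta>) *\<^sub>R x) < b" "\<forall>y\<in>convex hull X. a \<bullet> y > b"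
      using separating_hyperplane_closed_point[of "convex hull X" "(1 - \<delta>) *\<^sub>R x"] by auto
    obtain z where z: "z \<in> K" "\<And>y. y \<in> K \<Longrightarrow> a \<bullet> z \<le> a \<bullet> y"
    proof -
      have "continuous_on K (\<lambda>y. a \<bullet> y)" by (intro continuous_intros)
      then show thesis using continuous_attains_inf[OF K, of "\<lambda>y. a \<bullet> y"] x that by blast
    qed
    obtain y k where y: "y \<in> X" "k \<in> K" "z - y = \<delta> *\<^sub>R k" using cover[OF z(1)] by blast
    have "b < a \<bullet> y" using ab(2) y(1) by (auto intro: hull_inc)
    moreover have "a \<bullet> z = a \<bullet> y + \<delta> * (a \<bullet> k)"
    proof -
      have "z = y + \<delta> *\<^sub>R k" using y(3) by (simp add: algebra_simps)
      then show ?thesis by (simp add: inner_add_right)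
    qed
    moreover have "\<delta> * (a \<bullet> k) \<ge> \<delta> * (a \<bullet> z)" using z(2)[OF y(2)] \<delta> by (intro mult_left_mono) auto
    ultimately have "b < (1 - \<delta>) * (a \<bullet> z)" by (simp add: algebra_simps)
    also have "\<dots> \<le> (1 - \<delta>) * (a \<bullet> x)" using z(2)[OF x] \<delta> by (intro mult_left_mono) auto
    finally show False using ab(1) by simp
  qed
  moreover have "x = (1 / (1 - \<delta>)) *\<^sub>R ((1 - \<delta>) *\<^sub>R x)" using \<delta> by simp
  ultimately show "x \<in> (\<lambda>x. (1 / (1 - \<delta>)) *\<^sub>R x) ` (convex hull X)" by blast
qed

text \<open>The translates \<open>x + (\<delta> / 2) K\<close> are disjoint and contained in \<open>(1 + \<delta> / 2) K\<close>.\<close>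
lemma separated_set_card_bound:
  fixes K :: "('a::euclidean_space) set"
  assumes K: "convex K" "compact K" and sym: "\<And>x. x \<in> K \<Longrightarrow> - x \<in> K"
    and pos: "measure lebesgue K > 0"
    and X: "X \<subseteq> K" "finite X" and \<delta>: "0 < \<delta>"
    and sep: "\<And>x y. x \<in> X \<Longrightarrow> y \<in> X \<Longrightarrow> x \<noteq> y \<Longrightarrow> x - y \<notin> (\<lambda>z. \<delta> *\<^sub>R z) ` K"
  shows "real (card X) \<le> ((1 + \<delta> / 2) / (\<delta> / 2)) ^ DIM('a)"
proof -
  define B where "B s = (\<lambda>z. s *\<^sub>R z) ` K" for s :: real
  have Bmeas: "B s \<in> lmeasurable" for s
    unfolding B_def by (intro lmeasurable_compact compact_scaling K(2))
  have Bvol: "measure lebesgue (B s) = \<bar>s\<bar> ^ DIM('a) * measure lebesgue K" for s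
    unfolding B_def using measure_lebesgue_affine[of s 0 K] by simp
  have meas: "(+) x ` B (\<delta> / 2) \<in> lmeasurable" for x by (rule measurable_translation[OF Bmeas])
  have disj: "(+) x ` B (\<delta> / 2) \<inter> (+) y ` B (\<delta> / 2) = {}" if "x \<in> X" "y \<in> X" "x \<noteq> y" for x y
  proof (rule ccontr)
    assume "\<not> ?thesis"
    then obtain k k' where k: "k \<in> K" "k' \<in> K" "x + (\<delta> / 2) *\<^sub>R k = y + (\<delta> / 2) *\<^sub>R k'"
      by (auto simp: B_def)
    have "(1 / 2) *\<^sub>R k' + (1 / 2) *\<^sub>R (- k) \<in> K" using k sym by (intro convexD[OF K(1)]) auto
    moreover have "x - y = \<delta> *\<^sub>R ((1 / 2) *\<^sub>R k' + (1 / 2) *\<^sub>R (- k))"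
      using k(3) by (simp add: algebra_simps)
    ultimately show False using sep[OF that] by blast
  qed
  have "real (card X) * measure lebesgue (B (\<delta> / 2)) = (\<Sum>x\<in>X. measure lebesgue ((+) x ` B (\<delta> / 2)))"
    by (simp add: measure_translation)
  also have "\<dots> = measure lebesgue (\<Union>x\<in>X. (+) x ` B (\<delta> / 2))"
    using X(2) meas disj by (intro measure_UNION'[symmetric]) (auto simp: pairwise_def disjnt_def)
  also have "\<dots> \<le> measure lebesgue (B (1 + \<delta> / 2))"
  proof (rule measure_mono_fmeasurable)
    show "(\<Union>x\<in>X. (+) x ` B (\<delta> / 2)) \<subseteq> B (1 + \<delta> / 2)"
    proof
      fix w assume "w \<in> (\<Union>x\<in>X. (+) x ` B (\<delta> / 2))"
      then obtain x k where xk: "x \<in> K" "k \<in> K" "w = x + (\<delta> / 2) *\<^sub>R k" using X(1) by (auto simp: B_def)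
      define s where "s = 1 + \<delta> / 2"
      have s: "s > 0" using \<delta> by (simp add: s_def)
      have "1 / s + (\<delta> / 2) / s = (1 + \<delta> / 2) / s" by (rule add_divide_distrib[symmetric])
      also have "\<dots> = 1" using s by (simp add: s_def)
      finally have "(1 / s) *\<^sub>R x + ((\<delta> / 2) / s) *\<^sub>R k \<in> K"
        using s \<delta> by (intro convexD[OF K(1) xk(1,2)]) auto
      moreover have "w = s *\<^sub>R ((1 / s) *\<^sub>R x + ((\<delta> / 2) / s) *\<^sub>R k)"
        using s by (simp add: xk(3) scaleR_right_distrib)
      ultimately show "w \<in> B (1 + \<delta> / 2)" unfolding B_def s_def by blast
    qed
    show "(\<Union>x\<in>X. (+) x ` B (\<delta> / 2)) \<in> sets lebesgue"
      using X(2) meas by (intro sets.finite_UN) (auto simp: fmeasurableD)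
  qed (rule Bmeas)
  finally have "real (card X) * ((\<delta> / 2) ^ DIM('a) * measure lebesgue K) \<le> (1 + \<delta> / 2) ^ DIM('a) * measure lebesgue K"
    using \<delta> by (simp add: Bvol)
  then have "real (card X) * (\<delta> / 2) ^ DIM('a) \<le> (1 + \<delta> / 2) ^ DIM('a)"
    using pos by (simp add: mult.assoc[symmetric])
  moreover have half: "(\<delta> / 2) ^ DIM('a) > 0" using \<delta> by simp
  ultimately show ?thesis
    by (simp only: power_divide[of "1 + \<delta> / 2" "\<delta> / 2"] pos_le_divide_eq[OF half])
qed

lemma symmetric_convex_contains_0:
  assumes "convex K" "\<And>x. x \<in> K \<Longrightarrow> - x \<in> K" "K \<noteq> {}"
  shows "(0 :: 'a::real_vector) \<in> K"
proof -
  obtain x where "x \<in> K" using assms(3) by blast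
  then have "(1 / 2) *\<^sub>R x + (1 / 2) *\<^sub>R (- x) \<in> K"
    using assms(2) by (intro convexD[OF assms(1)]) auto
  then show ?thesis by simp
qed

lemma maximal_separated_set:
  fixes K :: "('a::euclidean_space) set"
  assumes K: "convex K" "compact K" and sym: "\<And>x. x \<in> K \<Longrightarrow> - x \<in> K"
    and pos: "measure lebesgue K > 0" and \<delta>: "0 < \<delta>"
  obtains X where "finite X" "X \<subseteq> K" "real (card X) \<le> ((1 + \<delta> / 2) / (\<delta> / 2)) ^ DIM('a)"
    and "\<And>x. x \<in> K \<Longrightarrow> \<exists>y\<in>X. x - y \<in> (\<lambda>z. \<delta> *\<^sub>R z) ` K"
proof -
  define sep where "sep X \<longleftrightarrow> finite X \<and> X \<subseteq> K \<and>
    (\<forall>x\<in>X. \<forall>y\<in>X. x \<noteq> y \<longrightarrow> x - y \<notin> (\<lambda>z. \<delta> *\<^sub>R z) ` K)" for X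
  define N where "N = nat \<lceil>((1 + \<delta> / 2) / (\<delta> / 2)) ^ DIM('a)\<rceil>"
  have bound: "real (card X) \<le> ((1 + \<delta> / 2) / (\<delta> / 2)) ^ DIM('a)" if "sep X" for X
    by (rule separated_set_card_bound[OF K sym pos _ _ \<delta>]) (use that in \<open>auto simp: sep_def\<close>)
  have "card X \<le> N" if "sep X" for X
    using bound[OF that] unfolding N_def by linarith
  moreover have "sep {}" by (simp add: sep_def)
  ultimately obtain X where X: "sep X" and max: "\<And>X'. sep X' \<Longrightarrow> card X' \<le> card X"
    using ex_has_greatest_nat[of sep "{}" card "Suc N"] by (metis less_Suc_eq_le)
  have "K \<noteq> {}" using pos by auto
  then have K0: "0 \<in> K" using symmetric_convex_contains_0[OF K(1) sym] by blast
  have "\<exists>y\<in>X. x - y \<in> (\<lambda>z. \<delta> *\<^sub>R z) ` K" if x: "x \<in> K" for x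
  proof (rule ccontr)
    assume no: "\<not> ?thesis"
    have "0 \<in> (\<lambda>z. \<delta> *\<^sub>R z) ` K" using K0 by force
    then have "x \<notin> X" using no by auto
    have no': "y - x \<notin> (\<lambda>z. \<delta> *\<^sub>R z) ` K" if "y \<in> X" for y
    proof
      assume "y - x \<in> (\<lambda>z. \<delta> *\<^sub>R z) ` K"
      then obtain k where k: "k \<in> K" "y - x = \<delta> *\<^sub>R k" by blast
      then have "x - y = \<delta> *\<^sub>R (- k)" by (simp add: algebra_simps)
      then show False using no that sym[OF k(1)] by blast
    qed
    have "sep (insert x X)"
      using X x no no' unfolding sep_def by auto
    then have "card (insert x X) \<le> card X" by (rule max)
    then show False using \<open>x \<notin> X\<close> X by (simp add: sep_def)
  qed
  with X bound[OF X] show thesis by (intro that[of X]) (auto simp: sep_def)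
qed

text \<open>The vertices are taken from a maximal \<open>\<delta>\<close>-separated set in the norm with unit ball \<open>K\<close>, where
  \<open>1 / (1 - \<delta>) = 1 + \<epsilon>\<close>. Distances in this norm are invariant under linear maps, so the identity serves as \<open>l\<close>.
  A bound is required because a least number with an unsatisfiable property would be unspecified.\<close>
lemma bms_bound_exists:
  assumes \<epsilon>: "\<epsilon> > 0"
  shows "\<exists>N. \<forall>K :: (real ^ 'd) set. symmetric_C2_body K \<longrightarrow>
        (\<exists>P (l :: real ^ 'd \<Rightarrow> real ^ 'd).
           polytope P \<and> card {v. v extreme_point_of P} \<le> N \<and> linear l \<and> bij l \<and>
           P \<subseteq> l ` K \<and> l ` K \<subseteq> (\<lambda>x. (1 + \<epsilon>) *\<^sub>R x) ` P)"
proof -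
  define \<delta> where "\<delta> = \<epsilon> / (1 + \<epsilon>)"
  have \<delta>: "0 < \<delta>" "\<delta> < 1" "1 / (1 - \<delta>) = 1 + \<epsilon>" using \<epsilon> by (auto simp: \<delta>_def field_simps)
  define N where "N = nat \<lfloor>((1 + \<delta> / 2) / (\<delta> / 2)) ^ DIM(real ^ 'd)\<rfloor>"
  show ?thesis
  proof (intro exI[of _ N] allI impI)
    fix K :: "(real ^ 'd) set" assume "symmetric_C2_body K"
    then have K: "convex K" "compact K" and sym: "\<And>x. x \<in> K \<Longrightarrow> - x \<in> K" and pos: "measure lebesgue K > 0"
      by (auto simp: symmetric_C2_body_def)
    obtain X where X: "finite X" "X \<subseteq> K" "real (card X) \<le> ((1 + \<delta> / 2) / (\<delta> / 2)) ^ DIM(real ^ 'd)"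
      "\<And>x. x \<in> K \<Longrightarrow> \<exists>y\<in>X. x - y \<in> (\<lambda>z. \<delta> *\<^sub>R z) ` K"
      using maximal_separated_set[OF K sym pos \<delta>(1)] by blast
    have "card {v. v extreme_point_of (convex hull X)} \<le> card X"
      by (rule card_mono[OF X(1)]) (use extreme_point_of_convex_hull in blast)
    also have "\<dots> \<le> N" using X(3) unfolding N_def by (simp add: le_nat_floor)
    finally have "card {v. v extreme_point_of (convex hull X)} \<le> N" .
    moreover have "polytope (convex hull X)" using X(1) by (rule polytope_convex_hull)
    moreover have "convex hull X \<subseteq> K" using X(2) K(1) by (rule hull_minimal)
    moreover have "K \<subseteq> (\<lambda>x. (1 / (1 - \<delta>)) *\<^sub>R x) ` (convex hull X)"
      by (rule separated_net_covers[OF K(2) X(1,4) \<delta>(1,2)])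
    ultimately show "\<exists>P (l :: real ^ 'd \<Rightarrow> real ^ 'd).
           polytope P \<and> card {v. v extreme_point_of P} \<le> N \<and> linear l \<and> bij l \<and>
           P \<subseteq> l ` K \<and> l ` K \<subseteq> (\<lambda>x. (1 + \<epsilon>) *\<^sub>R x) ` P"
      unfolding \<delta>(3) by (intro exI[of _ "convex hull X"] exI[of _ id]) (auto simp: linear_id)
  qed
qed

text \<open>Away from the origin the sphere is the zero set of \<open>y \<bullet> y - 1\<close>.\<close>
lemma unit_ball_symmetric_C2_body: "symmetric_C2_body (cball 0 1 :: (real ^ 'd) set)"
proof -
  have "C2_boundary (cball 0 1 :: (real ^ 'd) set)"
    unfolding C2_boundary_def
  proof
    fix x :: "real ^ 'd" assume x: "x \<in> frontier (cball 0 1)"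
    define H :: "(real ^ 'd) \<Rightarrow>\<^sub>L (real ^ 'd)" where "H = Blinfun (\<lambda>h. 2 *\<^sub>R h)"
    have H: "blinfun_apply H = (\<lambda>h. 2 *\<^sub>R h)"
      unfolding H_def by (rule bounded_linear_Blinfun_apply) (rule bounded_linear_scaleR_right)
    show "\<exists>U (g :: real ^ 'd \<Rightarrow> real) (G :: real ^ 'd \<Rightarrow> real ^ 'd) (H :: real ^ 'd \<Rightarrow> (real ^ 'd) \<Rightarrow>\<^sub>L (real ^ 'd)).
        open U \<and> x \<in> U \<and>
        (\<forall>y\<in>U. (g has_derivative (\<lambda>h. G y \<bullet> h)) (at y)) \<and>
        (\<forall>y\<in>U. (G has_derivative blinfun_apply (H y)) (at y)) \<and>
        continuous_on U H \<and>
        (\<forall>y\<in>U. G y \<noteq> 0) \<and>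
        frontier (cball 0 1) \<inter> U = {y \<in> U. g y = 0}"
    proof (intro exI conjI ballI)
      show "open (- {0 :: real ^ 'd})" by (intro open_Compl) simp
      show "x \<in> - {0}" using x by auto
      show "((\<lambda>y. y \<bullet> y - 1) has_derivative (\<lambda>h. (2 *\<^sub>R y) \<bullet> h)) (at y)" for y :: "real ^ 'd"
        by (auto intro!: derivative_eq_intros simp: inner_commute)
      show "((\<lambda>y. 2 *\<^sub>R y) has_derivative blinfun_apply H) (at y)" for y :: "real ^ 'd"
        unfolding H by (auto intro!: derivative_eq_intros)
      show "continuous_on (- {0}) (\<lambda>_ :: real ^ 'd. H)" by (rule continuous_on_const)
      show "2 *\<^sub>R y \<noteq> 0" if "y \<in> - {0}" for y :: "real ^ 'd" using that by simp
      show "frontier (cball 0 1) \<inter> - {0} = {y \<in> - {0 :: real ^ 'd}. y \<bullet> y - 1 = 0}"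
        by (auto simp: norm_eq_1)
    qed
  qed
  moreover have "measure lebesgue (cball 0 1 :: (real ^ 'd) set) > 0"
    using content_cball_pos[of 1 "0 :: real ^ 'd"] by simp
  ultimately show ?thesis by (simp add: symmetric_C2_body_def)
qed

text \<open>The definition of \<open>n_bms\<close> is applied to the unit ball. Its image under the linear map is an ellipsoid,
  and the inverse map carries the polytope back.\<close>
lemma n_bms_polytope:
  assumes \<epsilon>: "\<epsilon> > 0"
  obtains Q :: "(real ^ 'd) set" where "finite Q" "Q \<noteq> {}" "card Q \<le> n_bms TYPE('d) \<epsilon>" "Q \<subseteq> cball 0 1"
    "cball 0 (1 / (1 + \<epsilon>)) \<subseteq> convex hull Q"
proof -
  let ?B = "cball 0 1 :: (real ^ 'd) set"
  obtain P :: "(real ^ 'd) set" and l :: "real ^ 'd \<Rightarrow> real ^ 'd" where P: "polytope P"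
    "card {v. v extreme_point_of P} \<le> n_bms TYPE('d) \<epsilon>" "linear l" "bij l"
    "P \<subseteq> l ` ?B" "l ` ?B \<subseteq> (\<lambda>x. (1 + \<epsilon>) *\<^sub>R x) ` P"
    using LeastI_ex[OF bms_bound_exists[OF \<epsilon>, where ?'d = 'd], folded n_bms_def[of "TYPE('d)" \<epsilon>]]
      unit_ball_symmetric_C2_body by blast
  define f where "f = Hilbert_Choice.inv l"
  have fl: "f (l x) = x" and lf: "l (f x) = x" for x
    using P(4) by (simp_all add: f_def bij_is_inj bij_is_surj surj_f_inv_f)
  have lin: "linear f" unfolding f_def using P(3,4) by (simp add: inj_linear_imp_inv_linear bij_is_inj)
  define V where "V = {v. v extreme_point_of P}"
  have PV: "P = convex hull V" unfolding V_def
    using P(1) by (intro Krein_Milman_Minkowski polytope_imp_compact polytope_imp_convex)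
  have finV: "finite V" unfolding V_def using P(1) by (rule finite_polyhedron_extreme_points[OF polytope_imp_polyhedron])
  have fP: "f ` P \<subseteq> ?B" using P(5) fl by auto
  show thesis
  proof (rule that[of "f ` V"])
    show "finite (f ` V)" using finV by simp
    show "f ` V \<noteq> {}"
    proof
      assume "f ` V = {}"
      then have "P = {}" using PV by simp
      then show False using P(6) by auto
    qed
    show "card (f ` V) \<le> n_bms TYPE('d) \<epsilon>" using card_image_le[OF finV, of f] P(2) by (simp add: V_def)
    show "f ` V \<subseteq> ?B" using fP unfolding PV by (auto intro: hull_inc)
    show "cball 0 (1 / (1 + \<epsilon>)) \<subseteq> convex hull (f ` V)"
    proof
      fix x :: "real ^ 'd" assume "x \<in> cball 0 (1 / (1 + \<epsilon>))"
      then have "(1 + \<epsilon>) *\<^sub>R x \<in> ?B" using \<epsilon> by (simp add: pos_le_divide_eq mult.commute)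
      then obtain y where y: "y \<in> P" "l ((1 + \<epsilon>) *\<^sub>R x) = (1 + \<epsilon>) *\<^sub>R y" using P(6) by blast
      then have "(1 + \<epsilon>) *\<^sub>R l x = (1 + \<epsilon>) *\<^sub>R y" using P(3) by (simp add: linear_cmul)
      then have "l x = y" using \<epsilon> by simp
      then have "x = f y" using fl by auto
      then show "x \<in> convex hull (f ` V)" using y(1) unfolding PV convex_hull_linear_image[OF lin, symmetric] by blast
    qed
  qed
qed

section \<open>Balls in the intersection of the hulls of the parts\<close>

text \<open>The hull of a Minkowski sum contains the sum of the hulls.\<close>
lemma weighted_sum_in_hull:
  fixes T :: "'i \<Rightarrow> ('a::real_vector) set"
  assumes "finite I" "\<And>i. i \<in> I \<Longrightarrow> z i \<in> convex hull (T i)"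
  shows "(\<Sum>i\<in>I. \<alpha> i *\<^sub>R z i) \<in> convex hull {\<Sum>i\<in>I. \<alpha> i *\<^sub>R t i | t. \<forall>i\<in>I. t i \<in> T i}"
  using assms
proof (induction I rule: finite_induct)
  case (insert a I)
  let ?Y = "{\<Sum>i\<in>I. \<alpha> i *\<^sub>R t i | t. \<forall>i\<in>I. t i \<in> T i}"
  let ?C = "convex hull {\<Sum>i\<in>insert a I. \<alpha> i *\<^sub>R t i | t. \<forall>i\<in>insert a I. t i \<in> T i}"
  define y where "y = (\<Sum>i\<in>I. \<alpha> i *\<^sub>R z i)"
  have y: "y \<in> convex hull ?Y" unfolding y_def using insert by simp
  have vertex: "\<alpha> a *\<^sub>R u + y \<in> ?C" if u: "u \<in> T a" for u
  proof -
    have "(+) (\<alpha> a *\<^sub>R u) ` ?Y \<subseteq> {\<Sum>i\<in>insert a I. \<alpha> i *\<^sub>R t i | t. \<forall>i\<in>insert a I. t i \<in> T i}"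
    proof
      fix w assume "w \<in> (+) (\<alpha> a *\<^sub>R u) ` ?Y"
      then obtain t where t: "\<forall>i\<in>I. t i \<in> T i" "w = \<alpha> a *\<^sub>R u + (\<Sum>i\<in>I. \<alpha> i *\<^sub>R t i)" by blast
      have "(\<Sum>i\<in>I. \<alpha> i *\<^sub>R (t(a := u)) i) = (\<Sum>i\<in>I. \<alpha> i *\<^sub>R t i)"
        by (rule sum.cong) (use insert.hyps in auto)
      then have "w = (\<Sum>i\<in>insert a I. \<alpha> i *\<^sub>R (t(a := u)) i)"
        using insert.hyps t(2) by simp
      moreover have "\<forall>i\<in>insert a I. (t(a := u)) i \<in> T i" using t(1) u by simp
      ultimately show "w \<in> {\<Sum>i\<in>insert a I. \<alpha> i *\<^sub>R t i | t. \<forall>i\<in>insert a I. t i \<in> T i}" by blast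
    qed
    then have "convex hull ((+) (\<alpha> a *\<^sub>R u) ` ?Y) \<subseteq> ?C" by (rule hull_mono)
    then show ?thesis using y unfolding convex_hull_translation by blast
  qed
  have "convex {u. \<alpha> a *\<^sub>R u + y \<in> ?C}"
  proof (rule convexI)
    fix v w :: 'a and r s :: real
    assume v: "v \<in> {u. \<alpha> a *\<^sub>R u + y \<in> ?C}" and w: "w \<in> {u. \<alpha> a *\<^sub>R u + y \<in> ?C}" and rs: "0 \<le> r" "0 \<le> s" "r + s = 1"
    have "r *\<^sub>R (\<alpha> a *\<^sub>R v + y) + s *\<^sub>R (\<alpha> a *\<^sub>R w + y) \<in> ?C"
      using v w rs by (intro convexD[OF convex_convex_hull]) auto
    also have "r *\<^sub>R (\<alpha> a *\<^sub>R v + y) + s *\<^sub>R (\<alpha> a *\<^sub>R w + y) = \<alpha> a *\<^sub>R (r *\<^sub>R v + s *\<^sub>R w) + (r + s) *\<^sub>R y"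
      by (simp add: algebra_simps)
    finally show "r *\<^sub>R v + s *\<^sub>R w \<in> {u. \<alpha> a *\<^sub>R u + y \<in> ?C}" using rs by simp
  qed
  with vertex have "convex hull (T a) \<subseteq> {u. \<alpha> a *\<^sub>R u + y \<in> ?C}"
    by (intro hull_minimal) auto
  then have "\<alpha> a *\<^sub>R z a + y \<in> ?C" using insert.prems by blast
  then show ?case using insert.hyps by (simp add: y_def)
qed simp

lemma next_prime_prime: "prime (next_prime q)" and next_prime_ge: "q \<le> next_prime q"
proof -
  obtain r where "prime r" "q < r" using bigger_prime by blast
  then have "\<exists>r. prime r \<and> q \<le> r" by (intro exI[of _ r]) simp
  from LeastI_ex[OF this] show "prime (next_prime q)" "q \<le> next_prime q"
    unfolding next_prime_def by blast+
qed

text \<open>The set \<open>S k\<close> consists of the combinations of the points of rainbow set \<open>k\<close>, translated by \<open>- x\<close>. Part \<open>g\<close>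
  consists of the rainbow sets \<open>K g\<close> with numbers \<open>(g - 1) s + 1, ..., g s\<close>, and \<open>key i j\<close> is the number of the
  rainbow set that contains point \<open>j\<close> of colour \<open>i\<close>. Colours and points are numbered from \<open>1\<close> in \<open>T\<close> and
  from \<open>0\<close> in the coloured Tverberg theorem. Rainbow sets with number above \<open>m s\<close> are not used.\<close>
lemma tverberg_choice_of_colourful_selection:
  fixes T :: "nat \<Rightarrow> nat \<Rightarrow> (real ^ 'd) set"
  assumes m: "m \<ge> 1" and s: "s \<ge> 2" and n: "n = next_prime (m * s + 1) - 1"
    and T: "\<And>i j. i \<in> {1..CARD('d) + 1} \<Longrightarrow> j \<in> {1..n} \<Longrightarrow> contains_ball 1 (convex hull (T i j))"
    and selection: "\<And>(K :: nat set) (S :: nat \<Rightarrow> (real ^ 'd) set). finite K \<Longrightarrow> card K = s \<Longrightarrow>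
      (\<And>k. k \<in> K \<Longrightarrow> cball 0 1 \<subseteq> convex hull (S k)) \<Longrightarrow>
      \<exists>y. (\<forall>k\<in>K. y k \<in> S k) \<and> cball 0 \<rho> \<subseteq> convex hull (y ` K)"
  shows "tverberg_choice m n s \<rho> T"
proof -
  let ?d = "CARD('d)"
  have ms: "m * s \<ge> 2" using m s mult_le_mono[of 1 m 2 s] by simp
  have p: "prime (Suc n)" and n_ge: "m * s \<le> n"
    using next_prime_prime[of "m * s + 1"] next_prime_ge[of "m * s + 1"] n by (auto simp: Suc_diff_1)
  have "odd (Suc n)" using p prime_odd_nat[of "Suc n"] ms n_ge by simp
  then have even: "even n" by simp
  have "\<exists>c. cball c 1 \<subseteq> convex hull (T (Suc i) (Suc j))" if "i \<le> ?d" "j < n" for i j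
    using T[of "Suc i" "Suc j"] that by (auto simp: contains_ball_def)
  then obtain c where c: "\<And>i j. i \<le> ?d \<Longrightarrow> j < n \<Longrightarrow> cball (c i j) 1 \<subseteq> convex hull (T (Suc i) (Suc j))"
    by metis
  obtain J x where J: "\<And>i. i \<le> ?d \<Longrightarrow> bij_betw (J i) {1..n} {..<n}"
    and "\<And>k. k \<in> {1..n} \<Longrightarrow> \<exists>\<alpha>. (\<forall>i\<le>?d. \<alpha> i \<ge> 0) \<and> (\<Sum>i\<le>?d. \<alpha> i) = 1 \<and> (\<Sum>i\<le>?d. \<alpha> i *\<^sub>R c i (J i k)) = x"
    using optimal_coloured_tverberg[OF p even, of c] by blast
  then obtain \<alpha> where \<alpha>: "\<And>k i. k \<in> {1..n} \<Longrightarrow> i \<le> ?d \<Longrightarrow> \<alpha> k i \<ge> 0"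
      "\<And>k. k \<in> {1..n} \<Longrightarrow> (\<Sum>i\<le>?d. \<alpha> k i) = 1" "\<And>k. k \<in> {1..n} \<Longrightarrow> (\<Sum>i\<le>?d. \<alpha> k i *\<^sub>R c i (J i k)) = x"
    by metis
  have Jn: "J i k < n" if "i \<le> ?d" "k \<in> {1..n}" for i k using J[OF that(1)] that(2) by (auto simp: bij_betw_def)
  define S where "S k = (\<lambda>y. - x + y) ` {\<Sum>i\<in>{..?d}. \<alpha> k i *\<^sub>R t i | t. \<forall>i\<in>{..?d}. t i \<in> T (Suc i) (Suc (J i k))}" for k
  have S: "cball 0 1 \<subseteq> convex hull (S k)" if k: "k \<in> {1..n}" for k
  proof
    fix u :: "real ^ 'd" assume u: "u \<in> cball 0 1"
    have "(\<Sum>i\<in>{..?d}. \<alpha> k i *\<^sub>R (c i (J i k) + u)) \<in> convex hull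
        {\<Sum>i\<in>{..?d}. \<alpha> k i *\<^sub>R t i | t. \<forall>i\<in>{..?d}. t i \<in> T (Suc i) (Suc (J i k))}"
    proof (rule weighted_sum_in_hull)
      fix i assume "i \<in> {..?d}"
      then have i: "i \<le> ?d" by simp
      have "c i (J i k) + u \<in> cball (c i (J i k)) 1" using u by (simp add: dist_norm)
      with c[OF i Jn[OF i k]] show "c i (J i k) + u \<in> convex hull T (Suc i) (Suc (J i k))" by (rule subsetD)
    qed simp
    moreover have "(\<Sum>i\<in>{..?d}. \<alpha> k i *\<^sub>R (c i (J i k) + u)) = x + u"
    proof -
      have "(\<Sum>i\<in>{..?d}. \<alpha> k i *\<^sub>R (c i (J i k) + u)) =
          (\<Sum>i\<le>?d. \<alpha> k i *\<^sub>R c i (J i k)) + (\<Sum>i\<le>?d. \<alpha> k i) *\<^sub>R u"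
        by (simp only: scaleR_right_distrib sum.distrib scaleR_sum_left)
      then show ?thesis by (simp only: \<alpha>(2,3)[OF k] scaleR_one)
    qed
    ultimately have "- x + (x + u) \<in> convex hull (S k)"
      unfolding S_def convex_hull_translation by (intro imageI) simp
    then show "u \<in> convex hull (S k)" by simp
  qed
  define group where "group k = Suc ((k - 1) div s)" for k
  define K where "K g = {k \<in> {1..n}. group k = g}" for g
  have group_iff: "group k = g \<longleftrightarrow> (g - 1) * s < k \<and> k \<le> g * s" if k1: "k \<ge> 1" and g1: "g \<ge> 1" for k g
  proof -
    obtain k' where k': "k = Suc k'" using k1 by (cases k) auto
    obtain g' where g': "g = Suc g'" using g1 by (cases g) auto
    note kg = k' g'
    have "k' div s = g' \<longleftrightarrow> g' * s \<le> k' \<and> k' < Suc g' * s"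
    proof
      assume "k' div s = g'"
      then show "g' * s \<le> k' \<and> k' < Suc g' * s"
        using s dividend_less_times_div[of s k'] by (auto simp: mult.commute)
    next
      assume "g' * s \<le> k' \<and> k' < Suc g' * s"
      then show "k' div s = g'" using s by (intro div_nat_eqI) (auto simp: mult.commute)
    qed
    moreover have "group k = g \<longleftrightarrow> k' div s = g'" by (simp add: group_def kg)
    moreover have "(g - 1) * s < k \<and> k \<le> g * s \<longleftrightarrow> g' * s \<le> k' \<and> k' < Suc g' * s"
      unfolding kg by (simp only: diff_Suc_1 less_Suc_eq_le Suc_le_eq)
    ultimately show ?thesis by (simp only:)
  qed
  have Kg: "K g = {(g - 1) * s<..g * s}" if g: "g \<in> {1..m}" for g
  proof -
    have "g * s \<le> m * s" using g by (intro mult_right_mono) auto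
    then have "g * s \<le> n" using n_ge by linarith
    show ?thesis
    proof (rule Set.set_eqI)
      fix k
      show "k \<in> K g \<longleftrightarrow> k \<in> {(g - 1) * s<..g * s}"
      proof (cases "k \<ge> 1")
        case True
        then have "group k = g \<longleftrightarrow> (g - 1) * s < k \<and> k \<le> g * s" using group_iff g by simp
        then show ?thesis using True \<open>g * s \<le> n\<close> by (auto simp: K_def)
      qed (simp add: K_def)
    qed
  qed
  have cardK: "card (K g) = s" if "g \<in> {1..m}" for g
  proof -
    have "card (K g) = g * s - (g - 1) * s" by (simp add: Kg[OF that])
    then show ?thesis using that by (cases g) auto
  qed
  have "\<exists>y. (\<forall>k\<in>K g. y k \<in> S k) \<and> cball 0 \<rho> \<subseteq> convex hull (y ` K g)" if "g \<in> {1..m}" for g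
    by (rule selection) (use cardK[OF that] S in \<open>auto simp: K_def\<close>)
  then obtain y where y: "\<And>g k. g \<in> {1..m} \<Longrightarrow> k \<in> K g \<Longrightarrow> y g k \<in> S k"
      "\<And>g. g \<in> {1..m} \<Longrightarrow> cball 0 \<rho> \<subseteq> convex hull (y g ` K g)" by metis
  have "\<exists>t. (\<forall>i\<le>?d. t i \<in> T (Suc i) (Suc (J i k))) \<and> x + y g k = (\<Sum>i\<le>?d. \<alpha> k i *\<^sub>R t i)"
    if "g \<in> {1..m}" "k \<in> K g" for g k
    using y(1)[OF that] unfolding S_def by auto
  then obtain \<tau> where \<tau>: "\<And>g k i. g \<in> {1..m} \<Longrightarrow> k \<in> K g \<Longrightarrow> i \<le> ?d \<Longrightarrow> \<tau> g k i \<in> T (Suc i) (Suc (J i k))"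
      "\<And>g k. g \<in> {1..m} \<Longrightarrow> k \<in> K g \<Longrightarrow> x + y g k = (\<Sum>i\<le>?d. \<alpha> k i *\<^sub>R \<tau> g k i)" by metis
  define key where "key i j = the_inv_into {1..n} (J (i - 1)) (j - 1)" for i j
  have key: "key i j \<in> {1..n} \<and> J (i - 1) (key i j) = j - 1" if "i \<in> {1..?d + 1}" "j \<in> {1..n}" for i j
  proof -
    have "i - 1 \<le> ?d" using that(1) by auto
    then have bij: "bij_betw (J (i - 1)) {1..n} {..<n}" by (rule J)
    note inj = bij_betw_imp_inj_on[OF bij]
    have "j - 1 \<in> {..<n}" using that(2) by auto
    then have mem: "j - 1 \<in> J (i - 1) ` {1..n}" using bij by (simp add: bij_betw_def)
    show ?thesis unfolding key_def
      using the_inv_into_into[OF inj mem subset_refl] f_the_inv_into_f[OF inj mem] by (rule conjI)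
  qed
  have key_J: "key (Suc i) (Suc (J i k)) = k" if "i \<le> ?d" "k \<in> {1..n}" for i k
    using J[OF that(1)] that(2) by (simp add: key_def bij_betw_def the_inv_into_f_f)
  define t where "t i j = (if group (key i j) \<le> m then \<tau> (group (key i j)) (key i j) (i - 1) else SOME z. z \<in> T i j)" for i j
  define A where "A g = {(i, j). i \<in> {1..?d + 1} \<and> j \<in> {1..n} \<and> group (key i j) = g}" for g
  have group1: "group k \<ge> 1" for k by (simp add: group_def)
  have tT: "t i j \<in> T i j" if ij: "i \<in> {1..?d + 1}" "j \<in> {1..n}" for i j
  proof (cases "group (key i j) \<le> m")
    case True
    have "key i j \<in> K (group (key i j))" using key[OF ij] by (simp add: K_def)
    then have "\<tau> (group (key i j)) (key i j) (i - 1) \<in> T (Suc (i - 1)) (Suc (J (i - 1) (key i j)))"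
      using True group1 ij by (intro \<tau>(1)) auto
    moreover have "Suc (i - 1) = i" "Suc (J (i - 1) (key i j)) = j" using key[OF ij] ij by auto
    ultimately show ?thesis using True by (simp add: t_def)
  next
    case False
    have "convex hull (T i j) \<noteq> {}" using T[OF ij] by (auto simp: contains_ball_def)
    then show ?thesis using False by (simp add: t_def some_in_eq)
  qed
  have ball: "cball x \<rho> \<subseteq> convex hull ((\<lambda>(i, j). t i j) ` A g)" if g: "g \<in> {1..m}" for g
  proof -
    let ?C = "convex hull ((\<lambda>(i, j). t i j) ` A g)"
    have "x + y g k \<in> ?C" if k: "k \<in> K g" for k
    proof -
      have kn: "k \<in> {1..n}" and kg: "group k = g" using k by (auto simp: K_def)
      have "\<tau> g k i \<in> ?C" if i: "i \<le> ?d" for i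
      proof -
        have "t (Suc i) (Suc (J i k)) = \<tau> g k i" using g kg by (simp add: t_def key_J[OF i kn])
        moreover have "(Suc i, Suc (J i k)) \<in> A g" using i Jn[OF i kn] kg by (simp add: A_def key_J[OF i kn] Suc_le_eq)
        ultimately have "\<tau> g k i \<in> (\<lambda>(i, j). t i j) ` A g" by force
        then show ?thesis by (rule hull_inc)
      qed
      then have "(\<Sum>i\<le>?d. \<alpha> k i *\<^sub>R \<tau> g k i) \<in> ?C"
        using \<alpha>(1,2)[OF kn] by (intro convex_sum) auto
      then show ?thesis using \<tau>(2)[OF g k] by simp
    qed
    then have "convex hull ((+) x ` (y g ` K g)) \<subseteq> ?C" by (intro hull_minimal) auto
    then have "(+) x ` (convex hull (y g ` K g)) \<subseteq> ?C" by (simp only: convex_hull_translation)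
    moreover have "cball x \<rho> = (+) x ` cball 0 \<rho>" by simp
    ultimately show ?thesis using y(2)[OF g] by blast
  qed
  show ?thesis
    unfolding tverberg_choice_def
  proof (intro exI[of _ t] exI[of _ A] conjI ballI impI)
    show "t i j \<in> T i j" if "i \<in> {1..?d + 1}" "j \<in> {1..n}" for i j by (rule tT[OF that])
    show "A k \<subseteq> {1..?d + 1} \<times> {1..n}" for k by (auto simp: A_def)
    show "disjoint_family_on A {1..m}" by (auto simp: disjoint_family_on_def A_def)
    show "(\<Union>k\<in>{1..m}. A k) = {1..?d + 1} \<times> {1..n}" if "n = m * s"
    proof
      show "(\<Union>k\<in>{1..m}. A k) \<subseteq> {1..?d + 1} \<times> {1..n}" by (auto simp: A_def)
      show "{1..?d + 1} \<times> {1..n} \<subseteq> (\<Union>k\<in>{1..m}. A k)"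
      proof
        fix z assume "z \<in> {1..?d + 1} \<times> {1..n}"
        then obtain i j where z: "z = (i, j)" and ij: "i \<in> {1..?d + 1}" "j \<in> {1..n}" by blast
        have "key i j - 1 < m * s" using key[OF ij] \<open>n = m * s\<close> by auto
        then have "(key i j - 1) div s < m" by (rule less_mult_imp_div_less)
        then have "group (key i j) \<in> {1..m}" by (simp add: group_def)
        moreover have "z \<in> A (group (key i j))" using ij by (simp add: A_def z)
        ultimately show "z \<in> (\<Union>k\<in>{1..m}. A k)" by blast
      qed
    qed
    show "card {j. (i, j) \<in> A k} \<le> s" if "k \<in> {1..m}" "i \<in> {1..?d + 1}" for k i
    proof -
      have "{j. (i, j) \<in> A k} \<subseteq> (\<lambda>k. Suc (J (i - 1) k)) ` K k"
      proof
        fix j assume "j \<in> {j. (i, j) \<in> A k}"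
        then have j: "j \<in> {1..n}" "group (key i j) = k" by (auto simp: A_def)
        then have "key i j \<in> K k" "j = Suc (J (i - 1) (key i j))" using key[OF that(2) j(1)] by (auto simp: K_def)
        then show "j \<in> (\<lambda>k. Suc (J (i - 1) k)) ` K k" by blast
      qed
      then have "card {j. (i, j) \<in> A k} \<le> card ((\<lambda>k. Suc (J (i - 1) k)) ` K k)"
        by (rule card_mono[rotated]) (simp add: K_def)
      also have "\<dots> \<le> card (K k)" by (rule card_image_le) (simp add: K_def)
      finally show ?thesis using cardK[OF that(1)] by simp
    qed
    show "contains_ball \<rho> (\<Inter>k\<in>{1..m}. convex hull ((\<lambda>(i, j). t i j) ` A k))"
      unfolding contains_ball_def using ball by (intro exI[of _ x]) blast
  qed
qed

theorem theorem4p2: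
  fixes m :: nat
  assumes "m \<ge> 1"
  shows
    "(\<forall>(n :: nat) (T :: nat \<Rightarrow> nat \<Rightarrow> (real ^ 'd) set).
        n = next_prime (2 * m * CARD('d) + 1) - 1 \<longrightarrow>
        (\<forall>i\<in>{1..CARD('d) + 1}. \<forall>j\<in>{1..n}. contains_ball 1 (convex hull (T i j))) \<longrightarrow>
        tverberg_choice m n (2 * CARD('d))
          (pi / exp 1 ^ 2 * real CARD('d) powr (- 2 * real CARD('d) - 2)) T) \<and>
     (\<forall>(\<epsilon> :: real) (s :: nat) (n :: nat) (T :: nat \<Rightarrow> nat \<Rightarrow> (real ^ 'd) set).
        \<epsilon> > 0 \<longrightarrow>
        s = (n_bms TYPE('d) \<epsilon> - 1) * CARD('d) + 1 \<longrightarrow>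
        n = next_prime (m * s + 1) - 1 \<longrightarrow>
        (\<forall>i\<in>{1..CARD('d) + 1}. \<forall>j\<in>{1..n}. contains_ball 1 (convex hull (T i j))) \<longrightarrow>
        tverberg_choice m n s (1 / (1 + \<epsilon>)) T)"
proof (intro conjI allI impI)
  fix n and T :: "nat \<Rightarrow> nat \<Rightarrow> (real ^ 'd) set"
  assume n: "n = next_prime (2 * m * CARD('d) + 1) - 1"
    and T: "\<forall>i\<in>{1..CARD('d) + 1}. \<forall>j\<in>{1..n}. contains_ball 1 (convex hull (T i j))"
  show "tverberg_choice m n (2 * CARD('d)) (pi / exp 1 ^ 2 * real CARD('d) powr (- 2 * real CARD('d) - 2)) T"
  proof (rule tverberg_choice_of_colourful_selection[OF assms])
    show "2 \<le> 2 * CARD('d)" by (simp add: Suc_le_eq)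
    show "n = next_prime (m * (2 * CARD('d)) + 1) - 1" using n by (simp add: mult_ac)
    show "contains_ball 1 (convex hull (T i j))" if "i \<in> {1..CARD('d) + 1}" "j \<in> {1..n}" for i j
      using T that by blast
    fix K :: "nat set" and S :: "nat \<Rightarrow> (real ^ 'd) set"
    assume K: "finite K" "card K = 2 * CARD('d)" and S: "\<And>k. k \<in> K \<Longrightarrow> cball 0 1 \<subseteq> convex hull (S k)"
    from K(2) have "2 * CARD('d) \<le> card K" by simp
    from colourful_steinitz[OF K(1) this S]
    show "\<exists>y. (\<forall>k\<in>K. y k \<in> S k) \<and>
      cball 0 (pi / exp 1 ^ 2 * real CARD('d) powr (- 2 * real CARD('d) - 2)) \<subseteq> convex hull (y ` K)" .
  qed
next
  fix \<epsilon> :: real and s n and T :: "nat \<Rightarrow> nat \<Rightarrow> (real ^ 'd) set"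
  assume \<epsilon>: "\<epsilon> > 0" and s: "s = (n_bms TYPE('d) \<epsilon> - 1) * CARD('d) + 1"
    and n: "n = next_prime (m * s + 1) - 1"
    and T: "\<forall>i\<in>{1..CARD('d) + 1}. \<forall>j\<in>{1..n}. contains_ball 1 (convex hull (T i j))"
  obtain Q :: "(real ^ 'd) set" where Q: "finite Q" "Q \<noteq> {}" "card Q \<le> n_bms TYPE('d) \<epsilon>" "Q \<subseteq> cball 0 1"
    "cball 0 (1 / (1 + \<epsilon>)) \<subseteq> convex hull Q"
    using n_bms_polytope[OF \<epsilon>] by blast
  have \<rho>: "1 / (1 + \<epsilon>) > 0" using \<epsilon> by simp
  have "card Q \<noteq> 1"
  proof
    assume "card Q = 1"
    then obtain v where "Q = {v}" by (auto simp: card_1_singleton_iff)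
    then have sub: "cball 0 (1 / (1 + \<epsilon>)) \<subseteq> {v}" using Q(5) by simp
    have "0 \<in> cball (0 :: real ^ 'd) (1 / (1 + \<epsilon>))" using \<rho> by simp
    moreover have "axis undefined r \<in> cball (0 :: real ^ 'd) r" if "r > 0" for r
      using that by (simp add: norm_eq_sqrt_inner inner_axis_axis)
    then have "axis undefined (1 / (1 + \<epsilon>)) \<in> cball (0 :: real ^ 'd) (1 / (1 + \<epsilon>))" using \<rho> .
    ultimately have "axis undefined (1 / (1 + \<epsilon>)) = (0 :: real ^ 'd)" using sub by blast
    then show False using \<rho> by (simp add: axis_eq_0_iff)
  qed
  moreover have "card Q \<noteq> 0" using Q(1,2) by simp
  ultimately have "n_bms TYPE('d) \<epsilon> - 1 \<ge> 1" using Q(3) by linarith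
  then have "(n_bms TYPE('d) \<epsilon> - 1) * CARD('d) \<ge> 1 * 1" by (intro mult_le_mono) (auto simp: Suc_le_eq)
  then have s2: "s \<ge> 2" using s by simp
  show "tverberg_choice m n s (1 / (1 + \<epsilon>)) T"
  proof (rule tverberg_choice_of_colourful_selection[OF assms s2 n])
    show "contains_ball 1 (convex hull (T i j))" if "i \<in> {1..CARD('d) + 1}" "j \<in> {1..n}" for i j
      using T that by blast
    fix K :: "nat set" and S :: "nat \<Rightarrow> (real ^ 'd) set"
    assume K: "finite K" "card K = s" and S: "\<And>k. k \<in> K \<Longrightarrow> cball 0 1 \<subseteq> convex hull (S k)"
    from K(2) s have "(n_bms TYPE('d) \<epsilon> - 1) * CARD('d) + 1 \<le> card K" by simp
    from colourful_polytope[OF K(1) this S Q \<rho>]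
    show "\<exists>y. (\<forall>k\<in>K. y k \<in> S k) \<and> cball 0 (1 / (1 + \<epsilon>)) \<subseteq> convex hull (y ` K)" .
  qed
qed

end
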